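(* Let $d\in\{2,3\}$, let $\Omega\subset\mathbb{R}^d$ be a bounded polytopal domain with Lipschitz boundary, and let $k\ge 1$ be an integer. Let $\{\mathcal{T}_h\}_{h>0}$ be a shape regular, contact regular and face regular sequence of simplicial meshes on $\Omega$ (hanging nodes being allowed). For each $h$, let $V_{h,k}$ be the space of real-valued piecewise polynomials of degree at most $k$ on $\mathcal{T}_h$ (with no continuity imposed between elements), let $\|\cdot\|_{1,h}$ be the mesh-dependent norm $$\|v_h\|_{1,h}^2=\sum_{K\in\mathcal{T}_h}\|\nabla v_h\|_{L^2(K)}^2+\sum_{F\in\mathcal{F}_h}\frac{1}{h_F}\|[\![v_h]\!]\|_{L^2(F)}^2,\qquad v_h\in V_{h,k},$$ and let $G_h(v_h)=\nabla_h v_h-\mathbf{r}_h([\![v_h]\!])$ be the lifted gradient, where $\nabla_h$ is the element-wise gradient and $\mathbf{r}_h$ is the lifting operator into the space $\mathbf{\Sigma}_{h,k+1}$ of vector-valued piecewise polynomials of degree at most $k+1$ on $\mathcal{T}_h$. Then there exist constants $C_1,C_2>0$, possibly depending on $d$, on $k$ and on the regularity parameters of the mesh sequence, but independent of $h$, of the element sizes and of $u_h$, such that for every $h$, $$C_1\,\|u_h\|_{1,h}\le\|G_h(u_h)\|_{L^2(\Omega)}\le C_2\,\|u_h\|_{1,h}\qquad\text{for all }u_h\in V_{h,k}.$$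
   Context: **Meshes.** A simplicial mesh $\mathcal{T}_h$ on $\Omega$ is a finite collection of closed nondegenerate $d$-simplices with pairwise disjoint interiors whose union is $\overline{\Omega}$. For $K\in\mathcal{T}_h$, $h_K=\operatorname{diam}K$, and $h=\max_{K\in\mathcal{T}_h}h_K$. Hanging nodes are allowed. **Element faces.** For $K\in\mathcal{T}_h$, $\mathcal{F}(K)$ denotes the set of the $d+1$ faces of the simplex $K$, i.e. $E\in\mathcal{F}(K)$ iff $E$ is the closed convex hull of $d$ of the vertices of $K$. **Mesh faces.** The set $\mathcal{F}_h^i$ of interior mesh faces consists of all sets $F=\partial K_1\cap\partial K_2$, with $K_1\ne K_2$ in $\mathcal{T}_h$, that have positive $(d-1)$-dimensional Hausdorff measure. The set $\mathcal{F}_h^b$ of boundary mesh faces consists of all sets $F=E\cap\partial\Omega$, with $E\in\mathcal{F}(K)$ and $K\in\mathcal{T}_h$, that have positive $(d-1)$-dimensional Hausdorff measure. Set $\mathcal{F}_h=\mathcal{F}_h^i\cup\mathcal{F}_h^b$ and $h_F=\operatorname{diam}F$ for $F\in\mathcal{F}_h$. A mesh face may be a proper subset of an element face. **Shape and contact regularity.** A mesh is matching if for any two distinct elements $K,K'$ with $K$ having vertices $a_0,\dots,a_d$, the set $\partial K\cap\partial K'$ is the convex hull of a (possibly empty) subset of $\{a_0,\dots,a_d\}$. The sequence $\{\mathcal{T}_h\}_{h>0}$ is shape and contact regular if there are constants $\varrho_1,\varrho_2>0$ independent of $h$ (the regularity parameters) such that every $\mathcal{T}_h$ admits a matching simplicial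 submesh $\mathcal{S}_h$ with the following properties. Here a matching simplicial submesh is a matching simplicial mesh on $\Omega$ such that each $K'\in\mathcal{S}_h$ is contained in exactly one $K\in\mathcal{T}_h$, and each mesh face of $\mathcal{S}_h$ is contained in at most one mesh face $F\in\mathcal{F}_h$. The properties are: (i) (shape regularity) $\varrho_1 h_{K'}\le r_{K'}$ for all $K'\in\mathcal{S}_h$, where $h_{K'}=\operatorname{diam}K'$ and $r_{K'}$ is the radius of the largest ball inscribed in $K'$; (ii) (contact regularity) $\varrho_2 h_K\le h_{K'}$ for all $K\in\mathcal{T}_h$ and all $K'\in\mathcal{S}_h$ with $K'\subset K$. **Face regularity.** A mesh face $F\in\mathcal{F}_h$ is regular with respect to the element $K$ if $F\in\mathcal{F}(K)$. The mesh $\mathcal{T}_h$ is face regular if every $F\in\mathcal{F}_h$ is regular with respect to at least one element of $\mathcal{T}_h$. The sequence is face regular if every $\mathcal{T}_h$ is. **Jumps and averages.** For each $F\in\mathcal{F}_h$ fix a unit normal $\mathbf{n}_F$. For $F\in\mathcal{F}_h^i$, write $F=\partial K_{\mathrm{ext}}\cap\partial K_{\mathrm{int}}$, labelled so that $\mathbf{n}_F$ is outward pointing with respect to $K_{\mathrm{ext}}$ and inward pointing with respect to $K_{\mathrm{int}}$. For $F\in\mathcal{F}_h^b$, $K_{\mathrm{ext}}$ is the element to which $F$ belongs and $\mathbf{n}_F$ is outward pointing. For a piecewise smooth scalar or vector function $w$ (traces being taken on $F$), $$[\![w]\!]|_F=w|_{K_{\mathrm{ext}}}-w|_{K_{\mathrm{int}}},\quad\{w\}|_F=\tfrac12\left(w|_{K_{\mathrm{ext}}}+w|_{K_{\mathrm{int}}}\right)\quad\text{if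 }F\in\mathcal{F}_h^i,$$ $$[\![w]\!]|_F=w|_{K_{\mathrm{ext}}},\quad\{w\}|_F=w|_{K_{\mathrm{ext}}}\quad\text{if }F\in\mathcal{F}_h^b.$$ **Lifting operator.** For $\phi\in L^2(\mathcal{F}_h)$ (a family of $L^2$ functions, one on each $F\in\mathcal{F}_h$), $\mathbf{r}_h(\phi)\in\mathbf{\Sigma}_{h,k+1}$ is the unique element satisfying $$\int_\Omega\mathbf{r}_h(\phi)\cdot\boldsymbol{\sigma}_h\,\mathrm{d}x=\sum_{F\in\mathcal{F}_h}\int_F\phi\,\{\boldsymbol{\sigma}_h\cdot\mathbf{n}_F\}\,\mathrm{d}s\qquad\text{for all }\boldsymbol{\sigma}_h\in\mathbf{\Sigma}_{h,k+1}.$$ *)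

theory Defs
  imports "HOL-Analysis.Analysis"
begin

text \<open>
  The factor \<open>unit_ball_vol s / 2 ^ s\<close> is the normalisation for which the \<open>s\<close>-dimensional
  Hausdorff measure is the usual surface measure on \<open>s\<close>-dimensional affine subspaces. Empty covering
  sets have weight 0; the explicit conditional only matters for \<open>s = 0\<close>, where \<open>0 ^ 0 = 1\<close>.
\<close>

definition hausdorff_pre :: "nat \<Rightarrow> real \<Rightarrow> 'a::metric_space set \<Rightarrow> ennreal" where
  "hausdorff_pre s \<delta> A =
     (INF U \<in> {U :: nat \<Rightarrow> 'a set. A \<subseteq> (\<Union>i. U i) \<and> (\<forall>i. bounded (U i) \<and> diameter (U i) \<le> \<delta>)}.
        \<Sum>i. if U i = {} then 0
            else ennreal (unit_ball_vol (real s) * (diameter (U i) / 2) ^ s))"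

definition hausdorff_outer :: "nat \<Rightarrow> 'a::metric_space set \<Rightarrow> ennreal" where
  "hausdorff_outer s A = (SUP \<delta> \<in> {0<..}. hausdorff_pre s \<delta> A)"

text \<open>
  The metric outer measure \<open>hausdorff_outer s\<close> is countably additive on Borel sets by
  Caratheodory's criterion, so \<open>measure_of\<close> does not take its degenerate branch here.
\<close>

definition hausdorff_measure :: "nat \<Rightarrow> 'a::metric_space measure" where
  "hausdorff_measure s = measure_of UNIV (sets borel) (hausdorff_outer s)"

definition surface_measure :: "(real^'n) measure" where
  "surface_measure = hausdorff_measure (CARD('n) - 1)"

text \<open>
  Near each boundary point, \<open>\<Omega>\<close> is the strict epigraph, in the direction of some unit vector \<open>e\<close>,
  of a Lipschitz function on the hyperplane orthogonal to \<open>e\<close>.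
\<close>

definition lipschitz_boundary :: "'a::euclidean_space set \<Rightarrow> bool" where
  "lipschitz_boundary \<Omega> \<longleftrightarrow>
     (\<forall>x \<in> frontier \<Omega>. \<exists>U e L \<gamma>. open U \<and> x \<in> U \<and> norm e = 1 \<and>
        L-lipschitz_on {y. y \<bullet> e = 0} (\<gamma> :: 'a \<Rightarrow> real) \<and>
        \<Omega> \<inter> U = {y \<in> U. \<gamma> (y - (y \<bullet> e) *\<^sub>R e) < y \<bullet> e})"

definition polytopal :: "'a::euclidean_space set \<Rightarrow> bool" where
  "polytopal \<Omega> \<longleftrightarrow> (\<exists>\<P>. finite \<P> \<and> (\<forall>P\<in>\<P>. polytope P) \<and> closure \<Omega> = \<Union>\<P>)"

definition polytopal_lipschitz_domain :: "'a::euclidean_space set \<Rightarrow> bool" where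
  "polytopal_lipschitz_domain \<Omega> \<longleftrightarrow>
     open \<Omega> \<and> connected \<Omega> \<and> \<Omega> \<noteq> {} \<and> bounded \<Omega> \<and> polytopal \<Omega> \<and> lipschitz_boundary \<Omega>"

definition simplicial_mesh :: "'a::euclidean_space set \<Rightarrow> 'a set set \<Rightarrow> bool" where
  "simplicial_mesh \<Omega> T \<longleftrightarrow>
     finite T \<and> (\<forall>K\<in>T. int DIM('a) simplex K) \<and>
     pairwise (\<lambda>K K'. interior K \<inter> interior K' = {}) T \<and> \<Union>T = closure \<Omega>"

definition mesh_size :: "'a::metric_space set set \<Rightarrow> real" where
  "mesh_size T = Max (diameter ` T)"

definition vertices :: "'a::euclidean_space set \<Rightarrow> 'a set" where
  "vertices K = {a. a extreme_point_of K}"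

definition element_faces :: "'a::euclidean_space set \<Rightarrow> 'a set set" where
  "element_faces K = {convex hull A |A. A \<subseteq> vertices K \<and> card A = DIM('a)}"

definition interior_faces :: "(real^'n) set set \<Rightarrow> (real^'n) set set" where
  "interior_faces T =
     {F. (\<exists>K\<^sub>1\<in>T. \<exists>K\<^sub>2\<in>T. K\<^sub>1 \<noteq> K\<^sub>2 \<and> F = frontier K\<^sub>1 \<inter> frontier K\<^sub>2) \<and>
         emeasure surface_measure F > 0}"

definition boundary_faces :: "(real^'n) set \<Rightarrow> (real^'n) set set \<Rightarrow> (real^'n) set set" where
  "boundary_faces \<Omega> T =
     {F. (\<exists>K\<in>T. \<exists>E\<in>element_faces K. F = E \<inter> frontier \<Omega>) \<and>
         emeasure surface_measure F > 0}"

definition mesh_faces :: "(real^'n) set \<Rightarrow> (real^'n) set set \<Rightarrow> (real^'n) set set" where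
  "mesh_faces \<Omega> T = interior_faces T \<union> boundary_faces \<Omega> T"

definition matching :: "'a::euclidean_space set set \<Rightarrow> bool" where
  "matching T \<longleftrightarrow>
     (\<forall>K\<in>T. \<forall>K'\<in>T. K \<noteq> K' \<longrightarrow>
        (\<exists>A. A \<subseteq> vertices K \<and> frontier K \<inter> frontier K' = convex hull A))"

definition matching_submesh ::
  "(real^'n) set \<Rightarrow> (real^'n) set set \<Rightarrow> (real^'n) set set \<Rightarrow> bool" where
  "matching_submesh \<Omega> T S \<longleftrightarrow>
     simplicial_mesh \<Omega> S \<and> matching S \<and>
     (\<forall>K'\<in>S. \<exists>!K. K \<in> T \<and> K' \<subseteq> K) \<and>
     (\<forall>F'\<in>mesh_faces \<Omega> S. \<forall>F\<^sub>1\<in>mesh_faces \<Omega> T. \<forall>F\<^sub>2\<in>mesh_faces \<Omega> T.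
        F' \<subseteq> F\<^sub>1 \<longrightarrow> F' \<subseteq> F\<^sub>2 \<longrightarrow> F\<^sub>1 = F\<^sub>2)"

definition inradius :: "'a::metric_space set \<Rightarrow> real" where
  "inradius K = Sup {r. 0 \<le> r \<and> (\<exists>x. cball x r \<subseteq> K)}"

definition shape_contact_regular ::
  "real \<Rightarrow> real \<Rightarrow> (real^'n) set \<Rightarrow> (real^'n) set set \<Rightarrow> bool" where
  "shape_contact_regular \<rho>\<^sub>1 \<rho>\<^sub>2 \<Omega> T \<longleftrightarrow>
     (\<exists>S. matching_submesh \<Omega> T S \<and>
        (\<forall>K'\<in>S. \<rho>\<^sub>1 * diameter K' \<le> inradius K') \<and>
        (\<forall>K\<in>T. \<forall>K'\<in>S. K' \<subseteq> K \<longrightarrow> \<rho>\<^sub>2 * diameter K \<le> diameter K'))"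

definition face_regular :: "(real^'n) set \<Rightarrow> (real^'n) set set \<Rightarrow> bool" where
  "face_regular \<Omega> T \<longleftrightarrow> (\<forall>F\<in>mesh_faces \<Omega> T. \<exists>K\<in>T. F \<in> element_faces K)"

text \<open>
  The index set \<open>H\<close> of a mesh sequence is a set of positive reals, and the index of each mesh is its
  mesh size. (It cannot be all of \<open>{0<..}\<close>, since mesh sizes are at most \<open>diameter \<Omega>\<close>.)
\<close>

definition mesh_sequence :: "'a::euclidean_space set \<Rightarrow> real set \<Rightarrow> (real \<Rightarrow> 'a set set) \<Rightarrow> bool" where
  "mesh_sequence \<Omega> H T \<longleftrightarrow>
     H \<subseteq> {0<..} \<and> (\<forall>h\<in>H. simplicial_mesh \<Omega> (T h) \<and> mesh_size (T h) = h)"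

definition poly_space :: "nat \<Rightarrow> (real^'n \<Rightarrow> real) set" where
  "poly_space k =
     {p. \<exists>c. p = (\<lambda>x. \<Sum>\<alpha> | (\<Sum>i\<in>UNIV. \<alpha> i) \<le> k. c \<alpha> * (\<Prod>i\<in>UNIV. (x $ i) ^ \<alpha> i))}"

definition vec_poly_space :: "nat \<Rightarrow> (real^'n \<Rightarrow> real^'n) set" where
  "vec_poly_space k = {q. \<forall>i. (\<lambda>x. q x $ i) \<in> poly_space k}"

text \<open>
  A piecewise polynomial is a family of polynomials, one for each element. Polynomials on an element
  are identified with their unique polynomial extensions to the whole space, so that the trace of
  \<open>v\<close> on a face from the element \<open>K\<close> is the restriction of \<open>v K\<close> to that face.
\<close>

definition dg_space :: "(real^'n) set set \<Rightarrow> nat \<Rightarrow> ((real^'n) set \<Rightarrow> real^'n \<Rightarrow> real) set" where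
  "dg_space T k = (\<Pi>\<^sub>E K\<in>T. poly_space k)"

definition dg_vec_space :: "(real^'n) set set \<Rightarrow> nat \<Rightarrow> ((real^'n) set \<Rightarrow> real^'n \<Rightarrow> real^'n) set" where
  "dg_vec_space T k = (\<Pi>\<^sub>E K\<in>T. vec_poly_space k)"

text \<open>The function on \<open>\<Omega>\<close> given by such a family, set to 0 on the (null) mesh skeleton.\<close>

definition assemble ::
  "'a::euclidean_space set set \<Rightarrow> ('a set \<Rightarrow> 'a \<Rightarrow> 'b::real_vector) \<Rightarrow> 'a \<Rightarrow> 'b" where
  "assemble T w x = (\<Sum>K\<in>T. indicator (interior K) x *\<^sub>R w K x)"

definition gradient :: "('a::real_inner \<Rightarrow> real) \<Rightarrow> 'a \<Rightarrow> 'a" where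
  "gradient f x = (THE D. GDERIV f x :> D)"

definition broken_gradient ::
  "'a::real_inner set set \<Rightarrow> ('a set \<Rightarrow> 'a \<Rightarrow> real) \<Rightarrow> 'a set \<Rightarrow> 'a \<Rightarrow> 'a" where
  "broken_gradient T v = (\<lambda>K\<in>T. gradient (v K))"

definition L2_norm_on ::
  "'a measure \<Rightarrow> 'a set \<Rightarrow> ('a \<Rightarrow> 'b::real_normed_vector) \<Rightarrow> real" where
  "L2_norm_on M A f = sqrt (LINT x:A|M. (norm (f x))\<^sup>2)"

record 'v face_data =
  face_normal :: "'v set \<Rightarrow> 'v"
  K_ext :: "'v set \<Rightarrow> 'v set"
  K_int :: "'v set \<Rightarrow> 'v set"

text \<open>
  \<open>K\<close> lies on the side of \<open>F\<close> opposite to \<open>n\<close>. For \<open>F \<subseteq> K\<close> this also forces \<open>n\<close> to be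
  orthogonal to \<open>F\<close>.
\<close>

definition outward_unit_normal :: "'a::real_inner \<Rightarrow> 'a set \<Rightarrow> 'a set \<Rightarrow> bool" where
  "outward_unit_normal n K F \<longleftrightarrow> norm n = 1 \<and> (\<forall>x\<in>F. \<forall>y\<in>K. (y - x) \<bullet> n \<le> 0)"

text \<open>
  The elements \<open>K_ext\<close> and \<open>K_int\<close> are determined by the choice of the normals;
  \<open>K_int\<close> is irrelevant on boundary faces.
\<close>

definition valid_face_data ::
  "(real^'n) set \<Rightarrow> (real^'n) set set \<Rightarrow> (real^'n) face_data \<Rightarrow> bool" where
  "valid_face_data \<Omega> T D \<longleftrightarrow>
     (\<forall>F\<in>interior_faces T.
        K_ext D F \<in> T \<and> K_int D F \<in> T \<and> K_ext D F \<noteq> K_int D F \<and>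
        F = frontier (K_ext D F) \<inter> frontier (K_int D F) \<and>
        outward_unit_normal (face_normal D F) (K_ext D F) F \<and>
        outward_unit_normal (- face_normal D F) (K_int D F) F) \<and>
     (\<forall>F\<in>boundary_faces \<Omega> T.
        K_ext D F \<in> T \<and> (\<exists>E\<in>element_faces (K_ext D F). F = E \<inter> frontier \<Omega>) \<and>
        outward_unit_normal (face_normal D F) (K_ext D F) F)"

definition jump :: "(real^'n) set set \<Rightarrow> (real^'n) face_data \<Rightarrow>
    ((real^'n) set \<Rightarrow> real^'n \<Rightarrow> 'b::real_vector) \<Rightarrow> (real^'n) set \<Rightarrow> real^'n \<Rightarrow> 'b" where
  "jump T D w F x =
     (if F \<in> interior_faces T then w (K_ext D F) x - w (K_int D F) x else w (K_ext D F) x)"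

definition average :: "(real^'n) set set \<Rightarrow> (real^'n) face_data \<Rightarrow>
    ((real^'n) set \<Rightarrow> real^'n \<Rightarrow> 'b::real_vector) \<Rightarrow> (real^'n) set \<Rightarrow> real^'n \<Rightarrow> 'b" where
  "average T D w F x =
     (if F \<in> interior_faces T then (1/2) *\<^sub>R (w (K_ext D F) x + w (K_int D F) x)
      else w (K_ext D F) x)"

definition lifting :: "(real^'n) set \<Rightarrow> (real^'n) set set \<Rightarrow> (real^'n) face_data \<Rightarrow> nat \<Rightarrow>
    ((real^'n) set \<Rightarrow> real^'n \<Rightarrow> real) \<Rightarrow> (real^'n) set \<Rightarrow> real^'n \<Rightarrow> real^'n" where
  "lifting \<Omega> T D m \<phi> =
     (THE r. r \<in> dg_vec_space T m \<and>
        (\<forall>\<sigma>\<in>dg_vec_space T m.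
           (LINT x:\<Omega>|lborel. assemble T r x \<bullet> assemble T \<sigma> x) =
           (\<Sum>F\<in>mesh_faces \<Omega> T.
              LINT x:F|surface_measure.
                \<phi> F x * average T D (\<lambda>K y. \<sigma> K y \<bullet> face_normal D F) F x)))"

definition lifted_gradient :: "(real^'n) set \<Rightarrow> (real^'n) set set \<Rightarrow> (real^'n) face_data \<Rightarrow> nat \<Rightarrow>
    ((real^'n) set \<Rightarrow> real^'n \<Rightarrow> real) \<Rightarrow> (real^'n) set \<Rightarrow> real^'n \<Rightarrow> real^'n" where
  "lifted_gradient \<Omega> T D k v =
     (\<lambda>K\<in>T. \<lambda>x. broken_gradient T v K x - lifting \<Omega> T D (k + 1) (jump T D v) K x)"

definition dg_norm :: "(real^'n) set \<Rightarrow> (real^'n) set set \<Rightarrow> (real^'n) face_data \<Rightarrow>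
    ((real^'n) set \<Rightarrow> real^'n \<Rightarrow> real) \<Rightarrow> real" where
  "dg_norm \<Omega> T D v =
     sqrt ((\<Sum>K\<in>T. (L2_norm_on lborel K (broken_gradient T v K))\<^sup>2) +
           (\<Sum>F\<in>mesh_faces \<Omega> T.
              1 / diameter F * (L2_norm_on surface_measure F (jump T D v F))\<^sup>2))"

end

theory Submission
  imports Defs "HOL-Computational_Algebra.Polynomial"
begin

text \<open>
  The lifted gradient is tested with two explicit fields. On an element with barycentric coordinates
  \<open>\<lambda>\<^sub>a\<close>, the field \<open>\<Sum>\<^sub>a\<^sub>b \<lambda>\<^sub>a \<lambda>\<^sub>b ((a - b) \<bullet> \<nabla>u) (a - b)\<close> has degree \<open>k + 1\<close>, has no normal component
  on the faces and controls the broken gradient. For a face \<open>F\<close> of an element with opposite vertex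
  \<open>a\<close>, the field \<open>h\<^sub>F\<inverse> \<lbrakk>u\<rbrakk>(P x) (x - a)\<close>, with \<open>P\<close> the projection onto the hyperplane of \<open>F\<close>, has
  degree \<open>k + 1\<close> and a normal component only on \<open>F\<close>; face regularity lets one use it for every mesh
  face, so it controls the jumps. The reverse inequality is a discrete trace inequality.

  No reference element is needed: every element contains a ball of comparable radius, and on
  polynomials the supremum over a large ball is bounded by the \<open>L\<^sup>2\<close> norm over a small
  concentric one. The Hausdorff measure enters only through two comparisons with Lebesgue measure, namely
  \<open>H(F) \<le> C (diam F)\<^sup>d\<^sup>-\<^sup>1\<close> and \<open>vol {x. P x \<in> F, dist(x, P x) \<le> r} \<le> C r H(F)\<close>.
\<close>


section \<open>Polynomials in several variables\<close>

text \<open>The obstacle to the lower bound is cancellation: the lifted jumps might undo part of the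
  broken gradient. Duality excludes this: the lifted gradient is paired with a single field whose
  pairing controls both parts of the norm. A field with vanishing normal components on all faces
  does not see the lifting, so the element fields isolate the gradient; they have degree (k - 1) +
  2. The face fields also see the gradient, but they enter with a small weight, and the disturbance
  is absorbed. Hanging nodes show up twice. A mesh face may be a full face of only one neighbour
  \<open>reg F\<close>, so its field lives in that element alone, and the average retains at least
  half of its normal trace. Moreover one element may contain many small mesh faces; what the trace
  inequality needs is the sum of \<open>h_F ^ d\<close> over them, which is bounded by counting the
  volume of the elements \<open>reg F\<close>. The Lipschitz boundary enters through
  \<open>interior (closure \<Omega>) = \<Omega>\<close>, which excludes slits, where elements would
  lie on both sides of a boundary face.\<close>

definition monom_fun :: "('n::finite \<Rightarrow> nat) \<Rightarrow> real^'n \<Rightarrow> real" where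
  "monom_fun \<alpha> x = (\<Prod>i\<in>UNIV. (x $ i) ^ \<alpha> i)"

lemma finite_multi_indices: "finite {\<alpha> :: 'n::finite \<Rightarrow> nat. (\<Sum>i\<in>UNIV. \<alpha> i) \<le> k}"
proof (rule finite_subset)
  show "finite (PiE (UNIV::'n set) (\<lambda>_. {..k}))" by (intro finite_PiE) auto
  show "{\<alpha> :: 'n \<Rightarrow> nat. (\<Sum>i\<in>UNIV. \<alpha> i) \<le> k} \<subseteq> PiE UNIV (\<lambda>_. {..k})"
  proof
    fix \<alpha> :: "'n \<Rightarrow> nat" assume "\<alpha> \<in> {\<alpha>. (\<Sum>i\<in>UNIV. \<alpha> i) \<le> k}"
    then have "(\<Sum>i\<in>UNIV. \<alpha> i) \<le> k" by simp
    moreover have "\<alpha> i \<le> (\<Sum>i\<in>UNIV. \<alpha> i)" for i by (rule member_le_sum) auto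
    ultimately show "\<alpha> \<in> PiE UNIV (\<lambda>_. {..k})" by (force intro: order_trans)
  qed
qed

lemma poly_space_iff:
  "p \<in> poly_space k \<longleftrightarrow>
    (\<exists>c. p = (\<lambda>x::real^'n. \<Sum>\<alpha> | (\<Sum>i\<in>UNIV. \<alpha> i) \<le> k. c \<alpha> * monom_fun \<alpha> x))"
  by (simp add: poly_space_def monom_fun_def)

lemma poly_spaceI:
  "p = (\<lambda>x::real^'n. \<Sum>\<alpha> | (\<Sum>i\<in>UNIV. \<alpha> i) \<le> k. c \<alpha> * monom_fun \<alpha> x) \<Longrightarrow> p \<in> poly_space k"
  unfolding poly_space_iff by blast

section \<open>Algebra of polynomials of bounded degree\<close>

lemma poly_space_add:
  fixes p q :: "real^'n \<Rightarrow> real"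
  assumes "p \<in> poly_space k" "q \<in> poly_space k"
  shows "(\<lambda>x. p x + q x) \<in> poly_space k"
proof -
  from assms obtain c c' where
    "p = (\<lambda>x. \<Sum>\<alpha> | (\<Sum>i\<in>UNIV. \<alpha> i) \<le> k. c \<alpha> * monom_fun \<alpha> x)"
    "q = (\<lambda>x. \<Sum>\<alpha> | (\<Sum>i\<in>UNIV. \<alpha> i) \<le> k. c' \<alpha> * monom_fun \<alpha> x)"
    unfolding poly_space_iff by blast
  then have "(\<lambda>x. p x + q x) =
      (\<lambda>x. \<Sum>\<alpha> | (\<Sum>i\<in>UNIV. \<alpha> i) \<le> k. (c \<alpha> + c' \<alpha>) * monom_fun \<alpha> x)"
    by (simp add: sum.distrib distrib_right)
  then show ?thesis by (rule poly_spaceI)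
qed

lemma poly_space_scale:
  fixes p :: "real^'n \<Rightarrow> real"
  assumes "p \<in> poly_space k"
  shows "(\<lambda>x. a * p x) \<in> poly_space k"
proof -
  from assms obtain c where
    "p = (\<lambda>x. \<Sum>\<alpha> | (\<Sum>i\<in>UNIV. \<alpha> i) \<le> k. c \<alpha> * monom_fun \<alpha> x)"
    unfolding poly_space_iff by blast
  then have "(\<lambda>x. a * p x) = (\<lambda>x. \<Sum>\<alpha> | (\<Sum>i\<in>UNIV. \<alpha> i) \<le> k. (a * c \<alpha>) * monom_fun \<alpha> x)"
    by (simp add: sum_distrib_left mult.assoc)
  then show ?thesis by (rule poly_spaceI)
qed

lemma poly_space_scale_right:
  "p \<in> poly_space k \<Longrightarrow> (\<lambda>x::real^'n. p x * a) \<in> poly_space k"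
  using poly_space_scale[of p k a] by (simp add: mult.commute)

lemma poly_space_monom:
  assumes "(\<Sum>i\<in>UNIV. \<alpha> i) \<le> k"
  shows "(monom_fun \<alpha> :: real^'n \<Rightarrow> real) \<in> poly_space k"
proof -
  have "monom_fun \<alpha> = (\<lambda>x::real^'n. \<Sum>\<beta> | (\<Sum>i\<in>UNIV. \<beta> i) \<le>
      k. (if \<beta> = \<alpha> then 1 else 0) * monom_fun \<beta> x)"
  proof
    fix x :: "real^'n"
    have "(\<Sum>\<beta> | (\<Sum>i\<in>UNIV. \<beta> i) \<le> k. (if \<beta> = \<alpha> then 1 else 0) * monom_fun \<beta> x)
        = (\<Sum>\<beta> | (\<Sum>i\<in>UNIV. \<beta> i) \<le> k. if \<beta> = \<alpha> then monom_fun \<beta> x else 0)"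
      by (intro sum.cong) auto
    also have "\<dots> = monom_fun \<alpha> x"
      using assms by (subst sum.delta) (auto intro: finite_multi_indices)
    finally show "monom_fun \<alpha> x =
        (\<Sum>\<beta> | (\<Sum>i\<in>UNIV. \<beta> i) \<le> k. (if \<beta> = \<alpha> then 1 else 0) * monom_fun \<beta> x)" ..
  qed
  then show ?thesis by (rule poly_spaceI)
qed

lemma poly_space_const: "(\<lambda>x::real^'n. c) \<in> poly_space k"
proof -
  have "(monom_fun (\<lambda>_. 0) :: real^'n \<Rightarrow> real) = (\<lambda>x. 1)"
    by (auto simp: monom_fun_def)
  then show ?thesis
    using poly_space_scale[OF poly_space_monom[of "\<lambda>_. 0" k], of c] by (simp add: monom_fun_def)
qed

lemma poly_space_sum:
  assumes "\<And>i. i \<in> I \<Longrightarrow> p i \<in> poly_space k"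
  shows "(\<lambda>x::real^'n. \<Sum>i\<in>I. p i x) \<in> poly_space k"
proof (cases "finite I")
  case True
  then show ?thesis using assms
    by (induction I rule: finite_induct) (auto intro: poly_space_const poly_space_add)
qed (simp add: poly_space_const)

lemma poly_space_monomI:
  assumes "finite I" "\<And>i. i \<in> I \<Longrightarrow> (\<Sum>j\<in>UNIV. a i j) \<le> k"
  shows "(\<lambda>x::real^'n. \<Sum>i\<in>I. c i * monom_fun (a i) x) \<in> poly_space k"
  using assms by (intro poly_space_sum poly_space_scale poly_space_monom) auto

lemma poly_space_mono:
  assumes "p \<in> poly_space k" "k \<le> l"
  shows "(p :: real^'n \<Rightarrow> real) \<in> poly_space l"
proof -
  from assms obtain c where
    *: "p = (\<lambda>x. \<Sum>\<alpha> | (\<Sum>i\<in>UNIV. \<alpha> i) \<le> k. c \<alpha> * monom_fun \<alpha> x)"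
    unfolding poly_space_iff by blast
  show ?thesis unfolding *
    using assms(2) by (intro poly_space_monomI finite_multi_indices) auto
qed

lemma monom_fun_upd:
  "monom_fun (\<alpha>(i := Suc (\<alpha> i))) x = x $ i * monom_fun \<alpha> x"
proof -
  have "monom_fun (\<alpha>(i := Suc (\<alpha> i))) x =
      (x $ i) ^ Suc (\<alpha> i) * (\<Prod>j\<in>UNIV - {i}. (x $ j) ^ (\<alpha>(i := Suc (\<alpha> i))) j)"
    unfolding monom_fun_def by (subst prod.remove[of _ i]) auto
  also have "(\<Prod>j\<in>UNIV - {i}. (x $ j) ^ (\<alpha>(i := Suc (\<alpha> i))) j) = (\<Prod>j\<in>UNIV - {i}. (x $ j) ^ \<alpha> j)"
    by (intro prod.cong) auto
  also have "(x $ i) ^ Suc (\<alpha> i) * \<dots> = x $ i * ((x $ i) ^ \<alpha> i * \<dots>)" by simp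
  also have "(x $ i) ^ \<alpha> i * (\<Prod>j\<in>UNIV - {i}. (x $ j) ^ \<alpha> j) = monom_fun \<alpha> x"
    unfolding monom_fun_def by (subst (2) prod.remove[of _ i]) auto
  finally show ?thesis .
qed

lemma sum_fun_upd_Suc:
  "(\<Sum>j\<in>UNIV. (\<alpha>(i := Suc (\<alpha> i))) j) = Suc (\<Sum>j\<in>(UNIV::'n::finite set). \<alpha> j)"
proof -
  have "(\<Sum>j\<in>UNIV - {i}. (\<alpha>(i := Suc (\<alpha> i))) j) = (\<Sum>j\<in>UNIV - {i}. \<alpha> j)"
    by (intro sum.cong) auto
  then show ?thesis
    by (simp add: sum.remove[of UNIV i] del: fun_upd_apply) simp
qed

lemma poly_space_coord_mult:
  fixes p :: "real^'n \<Rightarrow> real"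
  assumes "p \<in> poly_space k"
  shows "(\<lambda>x. x $ i * p x) \<in> poly_space (Suc k)"
proof -
  from assms obtain c where
    *: "p = (\<lambda>x. \<Sum>\<alpha> | (\<Sum>i\<in>UNIV. \<alpha> i) \<le> k. c \<alpha> * monom_fun \<alpha> x)"
    unfolding poly_space_iff by blast
  have **: "(\<lambda>x. x $ i * p x) = 
      (\<lambda>x. \<Sum>\<alpha> | (\<Sum>i\<in>UNIV. \<alpha> i) \<le> k. c \<alpha> * monom_fun (\<alpha>(i := Suc (\<alpha> i))) x)"
    unfolding * by (simp add: sum_distrib_left monom_fun_upd mult_ac)
  show ?thesis unfolding **
    by (intro poly_space_monomI finite_multi_indices) (simp add: sum_fun_upd_Suc del: fun_upd_apply)
qed

text \<open>Multiplication by a coordinate is the only rule that raises the degree, so products,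
  substitutions and derivatives can be followed together with their degrees. The predicate takes the
  degree as an argument because that rule changes it.\<close>

lemma poly_space_induct [consumes 1, case_names const add coord]:
  fixes p :: "real^'n \<Rightarrow> real"
  assumes p: "p \<in> poly_space k"
    and const: "\<And>k c. P k (\<lambda>x. c)"
    and add: "\<And>k p q. P k p \<Longrightarrow> P k q \<Longrightarrow> P k (\<lambda>x. p x + q x)"
    and coord: "\<And>k i p. P k p \<Longrightarrow> P (Suc k) (\<lambda>x. x $ i * p x)"
  shows "P k p"
proof -
  \<comment> \<open>The slack \<open>j\<close> lets a monomial of low degree count towards any
    larger bound; it is available because \<open>const\<close> holds for every degree.\<close>
  have monom: "P (j + (\<Sum>i\<in>UNIV. \<alpha> i)) (\<lambda>x. c * monom_fun \<alpha> x)" for j c and \<alpha> :: "'n \<Rightarrow> nat"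
  proof (induction "\<Sum>i\<in>UNIV. \<alpha> i" arbitrary: \<alpha>)
    case 0
    then have "\<alpha> = (\<lambda>_. 0)" by auto
    then show ?case using const by (simp add: monom_fun_def)
  next
    case (Suc s)
    then obtain i where i: "\<alpha> i \<noteq> 0"
      by (metis sum.neutral nat.distinct(1))
    define \<beta> where "\<beta> = \<alpha>(i := \<alpha> i - 1)"
    have \<alpha>: "\<alpha> = \<beta>(i := Suc (\<beta> i))" using i by (auto simp: \<beta>_def)
    have s: "s = (\<Sum>i\<in>UNIV. \<beta> i)"
      using Suc(2) unfolding \<alpha> sum_fun_upd_Suc by simp
    have "P (Suc (j + (\<Sum>i\<in>UNIV. \<beta> i))) (\<lambda>x. x $ i * (c * monom_fun \<beta> x))"
      by (intro coord Suc(1) s)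
    then show ?case
      by (subst (1 2) \<alpha>) (simp add: sum_fun_upd_Suc monom_fun_upd mult_ac del: fun_upd_apply)
  qed
  have sums: "P k (\<lambda>x. \<Sum>\<alpha>\<in>I. c \<alpha> * monom_fun \<alpha> x)"
    if "finite I" "\<forall>\<alpha>\<in>I. (\<Sum>i\<in>UNIV. \<alpha> i) \<le> k" for I c
    using that
  proof (induction I rule: finite_induct)
    case empty
    then show ?case using const by simp
  next
    case (insert \<alpha> I)
    have "P k (\<lambda>x. c \<alpha> * monom_fun \<alpha> x)"
      using monom[of "k - (\<Sum>i\<in>UNIV. \<alpha> i)" \<alpha> "c \<alpha>"] insert.prems by simp
    then show ?case using insert add by simp
  qed
  from p obtain c where
    *: "p = (\<lambda>x. \<Sum>\<alpha> | (\<Sum>i\<in>UNIV. \<alpha> i) \<le> k. c \<alpha> * monom_fun \<alpha> x)"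
    unfolding poly_space_iff by blast
  show ?thesis unfolding * by (intro sums finite_multi_indices) auto
qed

lemma poly_space_mult:
  fixes p q :: "real^'n \<Rightarrow> real"
  assumes "p \<in> poly_space k" "q \<in> poly_space l"
  shows "(\<lambda>x. p x * q x) \<in> poly_space (k + l)"
  using assms
proof (induction rule: poly_space_induct)
  case (const k c)
  then show ?case by (intro poly_space_scale) (auto intro: poly_space_mono)
next
  case (add k p q)
  then show ?case by (auto simp: distrib_right intro: poly_space_add)
next
  case (coord k i p)
  then show ?case using poly_space_coord_mult[of "\<lambda>x. p x * q x" "k + l" i]
    by (simp add: mult.assoc)
qed

lemma poly_space_minus:
  "p \<in> poly_space k \<Longrightarrow> (\<lambda>x::real^'n. - p x) \<in> poly_space k"
  using poly_space_scale[of p k "-1"] by simp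

lemma poly_space_diff:
  "p \<in> poly_space k \<Longrightarrow> q \<in> poly_space k \<Longrightarrow> (\<lambda>x::real^'n. p x - q x) \<in> poly_space k"
  using poly_space_add[of p k "\<lambda>x. - q x"] poly_space_minus[of q k] by simp

lemma poly_space_coord: "(\<lambda>x::real^'n. x $ i) \<in> poly_space 1"
  using poly_space_coord_mult[OF poly_space_const[of 1 0], of i] by simp

lemma poly_space_inner: "(\<lambda>x::real^'n. x \<bullet> v) \<in> poly_space 1"
  unfolding inner_vec_def inner_real_def
  by (intro poly_space_sum poly_space_scale_right poly_space_coord)

section \<open>Affine substitution, restriction to lines, gradients\<close>

lemma poly_space_comp:
  fixes p :: "real^'n \<Rightarrow> real"
  assumes "p \<in> poly_space k" and A: "A \<in> vec_poly_space 1"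
  shows "(\<lambda>x::real^'n. p (A x)) \<in> poly_space k"
  using assms(1)
proof (induction rule: poly_space_induct)
  case (coord k i p)
  then show ?case
    using poly_space_mult[of "\<lambda>x. A x $ i" 1 "\<lambda>x. p (A x)" k] A by (auto simp: vec_poly_space_def)
qed (auto intro: poly_space_const poly_space_add)

lemma poly_space_continuous:
  fixes p :: "real^'n \<Rightarrow> real"
  assumes "p \<in> poly_space k"
  shows "continuous_on A p"
  using assms by (induction rule: poly_space_induct) (auto intro!: continuous_intros)

lemma poly_space_line:
  fixes p :: "real^'n \<Rightarrow> real"
  assumes "p \<in> poly_space k"
  shows "\<exists>q. \<forall>t. p (x + t *\<^sub>R v) = poly q t"
  using assms
proof (induction rule: poly_space_induct)
  case (const k c)
  show ?case by (rule exI[of _ "[:c:]"]) simp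
next
  case (add k p q)
  then obtain p' q' where "\<forall>t. p (x + t *\<^sub>R v) = poly p' t" "\<forall>t. q (x + t *\<^sub>R v) = poly q' t" by blast
  then show ?case by (intro exI[of _ "p' + q'"]) simp
next
  case (coord k i p)
  then obtain p' where "\<forall>t. p (x + t *\<^sub>R v) = poly p' t" by blast
  then show ?case by (intro exI[of _
    "[:x $ i, v $ i:] * p'"]) (simp add: mult_ac distrib_right distrib_left)
qed

text \<open>On the line from \<open>x0\<close> to \<open>x\<close> the polynomial becomes one in a
  single variable with infinitely many roots near 0. This makes the extension of a polynomial from
  an element to the whole space unique.\<close>

lemma poly_space_zero_if_zero_on_ball:
  fixes p :: "real^'n \<Rightarrow> real"
  assumes p: "p \<in> poly_space k" and "r > 0" and zero: "\<And>x. x \<in> ball x0 r \<Longrightarrow> p x = 0"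
  shows "p x = 0"
proof -
  define v where "v = x - x0"
  obtain q where q: "\<And>t. p (x0 + t *\<^sub>R v) = poly q t"
    using poly_space_line[OF p] by metis
  define e where "e = r / (norm v + 1)"
  have "e > 0" unfolding e_def using \<open>r > 0\<close> by (intro divide_pos_pos) (auto intro: add_nonneg_pos)
  have "poly q t = 0" if "t \<in> {0<..<e}" for t
  proof -
    have "norm (t *\<^sub>R v) \<le> t * (norm v + 1)" using that by (simp add: distrib_left)
    also have "\<dots> < e * (norm v + 1)"
      using that by (intro mult_strict_right_mono) (auto intro: add_nonneg_pos)
    also have "\<dots> = r" using norm_ge_zero[of v] unfolding e_def by (simp add: add_nonneg_eq_0_iff)
    finally have "x0 + t *\<^sub>R v \<in> ball x0 r" by (simp add: dist_norm)
    then show ?thesis using zero q by metis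
  qed
  then have "{0<..<e} \<subseteq> {t. poly q t = 0}" by auto
  moreover have "infinite {0<..<e}" using \<open>e > 0\<close> by (simp add: infinite_Ioo)
  ultimately have "infinite {t. poly q t = 0}" using finite_subset by blast
  then have "q = 0" using poly_roots_finite by blast
  then show ?thesis using q[of 1] by (simp add: v_def)
qed

lemma poly_space_gradient:
  fixes p :: "real^'n \<Rightarrow> real"
  assumes "p \<in> poly_space k"
  shows "\<exists>g \<in> vec_poly_space (k - 1). \<forall>x. GDERIV p x :> g x"
proof -
  \<comment> \<open>Two strengthenings for the induction: the product rule brings back
    \<open>p\<close> itself, and at degree 0 the gradient has to be exactly zero, since
    \<open>k - 1\<close> is truncated and \<open>x $ i * g x\<close> would otherwise be allowed
    degree 1.\<close>
  have "p \<in> poly_space k \<and> (\<exists>g. (\<forall>x. GDERIV p x :> g x) \<and>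
      (if k = 0 then g = (\<lambda>x. 0) else g \<in> vec_poly_space (k - 1)))"
    using assms
  proof (induction rule: poly_space_induct)
    case (const k c)
    show ?case
      by (intro conjI exI[of _ "\<lambda>x. 0"])
        (auto simp: vec_poly_space_def intro: poly_space_const GDERIV_const)
  next
    case (add k p q)
    then obtain g g' where
      "\<forall>x. GDERIV p x :> g x" "if k = 0 then g = (\<lambda>x. 0) else g \<in> vec_poly_space (k - 1)"
      "\<forall>x. GDERIV q x :> g' x" "if k = 0 then g' = (\<lambda>x. 0) else g' \<in> vec_poly_space (k - 1)"
      by blast
    then show ?case using add.IH
      by (intro conjI exI[of _ "\<lambda>x. g x + g' x"])
        (auto simp: vec_poly_space_def intro: poly_space_add GDERIV_add[of _ _ 0 _ 0, simplified]
          GDERIV_add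
          split: if_splits)
  next
    case (coord k i p)
    then obtain g where g: "\<forall>x. GDERIV p x :> g x"
      "if k = 0 then g = (\<lambda>x. 0) else g \<in> vec_poly_space (k - 1)" by blast
    have "GDERIV (\<lambda>x. x $ i) x :> axis i 1" for x :: "real^'n"
      unfolding gderiv_def
      by (auto simp: inner_axis intro: bounded_linear_imp_has_derivative bounded_linear_vec_nth)
    then have "GDERIV (\<lambda>x. x $ i * p x) x :> (x $ i) *\<^sub>R g x + p x *\<^sub>R axis i 1" for x
      using g(1) by (intro GDERIV_mult) auto
    moreover have "(\<lambda>x. ((x $ i) *\<^sub>R g x + p x *\<^sub>R axis i 1) $ j) \<in> poly_space k" for j
    proof -
      have "(\<lambda>x. x $ i * g x $ j) \<in> poly_space k"
      proof (cases "k = 0")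
        case False
        then show ?thesis
          using g(2) poly_space_coord_mult[of "\<lambda>x. g x $ j" "k - 1" i]
            by (auto simp: vec_poly_space_def)
      qed (use g(2) poly_space_const[of 0] in auto)
      then show ?thesis using coord.IH
        by (auto simp: axis_def intro: poly_space_add)
    qed
    ultimately show ?case using poly_space_coord_mult[of p k i] coord.IH
      by (intro conjI exI[of _ "\<lambda>x. (x $ i) *\<^sub>R g x +
          p x *\<^sub>R axis i 1"]) (auto simp: vec_poly_space_def)
  qed
  then obtain g where g: "\<forall>x. GDERIV p x :> g x" 
    "if k = 0 then g = (\<lambda>x. 0) else g \<in> vec_poly_space (k - 1)" by blast
  have "g \<in> vec_poly_space (k - 1)"
    using g(2) poly_space_const[of 0 0] by (cases "k = 0") (auto simp: vec_poly_space_def)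
  with g show ?thesis by blast
qed

section \<open>Reproducing bases and norm equivalence\<close>

text \<open>Gram-Schmidt for finitely many functions. Definiteness of \<open>B\<close> is demanded
  pointwise: a polynomial with vanishing square integral over a set vanishes everywhere, also off
  that set.\<close>

lemma orthonormal_expansion:
  fixes B :: "('x \<Rightarrow> real) \<Rightarrow> ('x \<Rightarrow> real) \<Rightarrow> real"
  assumes V_zero: "(\<lambda>x. 0) \<in> V"
    and V_add: "\<And>f g. f \<in> V \<Longrightarrow> g \<in> V \<Longrightarrow> (\<lambda>x. f x + g x) \<in> V"
    and V_scale: "\<And>f a. f \<in> V \<Longrightarrow> (\<lambda>x. a * f x) \<in> V"
    and B_add: "\<And>f g h. f \<in> V \<Longrightarrow> g \<in> V \<Longrightarrow> h \<in> V \<Longrightarrow> B (\<lambda>x. f x + g x) h = B f h + B g h"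
    and B_scale: "\<And>f h a. f \<in> V \<Longrightarrow> h \<in> V \<Longrightarrow> B (\<lambda>x. a * f x) h = a * B f h"
    and B_sym: "\<And>f g. B f g = B g f"
    and B_nonneg: "\<And>f. f \<in> V \<Longrightarrow> B f f \<ge> 0"
    and B_def: "\<And>f x. f \<in> V \<Longrightarrow> B f f = 0 \<Longrightarrow> f x = 0"
    and "finite I" "\<And>i. i \<in> I \<Longrightarrow> e i \<in> V"
  shows "\<exists>N \<phi>. (\<forall>i<N. \<phi> i \<in> V) \<and> (\<forall>i<N. \<forall>j<N. B (\<phi> i) (\<phi> j) = (if i = j then 1 else 0)) \<and>
    (\<forall>i\<in>I. \<forall>x. e i x = (\<Sum>j<(N::nat). B (e i) (\<phi> j) * \<phi> j x))"
  using \<open>finite I\<close> \<open>\<And>i. i \<in> I \<Longrightarrow> e i \<in> V\<close>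
proof (induction I rule: finite_induct)
  case empty
  show ?case by (rule exI[of _ 0]) simp
next
  case (insert k I)
  have "\<exists>N \<phi>. (\<forall>i<N. \<phi> i \<in> V) \<and> (\<forall>i<N. \<forall>j<N. B (\<phi> i) (\<phi> j) = (if i = j then 1 else 0)) \<and>
    (\<forall>i\<in>I. \<forall>x. e i x = (\<Sum>j<(N::nat). B (e i) (\<phi> j) * \<phi> j x))"
    by (rule insert.IH) (use insert.prems in auto)
  then obtain N :: nat and \<phi> where \<phi>V: "\<And>i. i < N \<Longrightarrow> \<phi> i \<in> V"
    and ortho: "\<And>i j. i < N \<Longrightarrow> j < N \<Longrightarrow> B (\<phi> i) (\<phi> j) = (if i = j then 1 else 0)"
    and expand: "\<And>i x. i \<in> I \<Longrightarrow> e i x = (\<Sum>j<N. B (e i) (\<phi> j) * \<phi> j x)"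
    by blast
  have V_sum: "(\<lambda>x. \<Sum>i<M. f i x) \<in> V" if "\<And>i. i < M \<Longrightarrow> f i \<in> V" for f and M :: nat
    using that by (induction M) (auto intro: V_zero V_add)
  have B_zero: "B (\<lambda>x. 0) h = 0" if "h \<in> V" for h
    using B_scale[OF V_zero that, of 0] by simp
  have B_sum: "B (\<lambda>x. \<Sum>i<M. f i x) h = (\<Sum>i<M. B (f i) h)"
    if "\<And>i. i < M \<Longrightarrow> f i \<in> V" "h \<in> V" for f h and M :: nat
    using that by (induction M) (auto simp: B_zero B_add V_sum)
  have ek: "e k \<in> V" using insert by simp
  \<comment> \<open>The residual of \<open>e k\<close> after projection. Either it vanishes
    identically and the system stays as it is, or its normalisation becomes the next basis
    function.\<close>
  define r where "r = (\<lambda>x. e k x - (\<Sum>j<N. B (e k) (\<phi> j) * \<phi> j x))"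
  have r_alt: "r = (\<lambda>x. e k x + (\<Sum>j<N. (- B (e k) (\<phi> j)) * \<phi> j x))"
    by (simp add: r_def sum_negf)
  have rV: "r \<in> V" unfolding r_alt by (intro V_add ek V_sum V_scale \<phi>V)
  have B_r: "B r h = B (e k) h - (\<Sum>j<N. B (e k) (\<phi> j) * B (\<phi> j) h)" if "h \<in> V" for h
  proof -
    have "B r h = B (e k) h + B (\<lambda>x. \<Sum>j<N. (- B (e k) (\<phi> j)) * \<phi> j x) h"
      unfolding r_alt using that by (intro B_add ek V_sum V_scale \<phi>V)
    also have "B (\<lambda>x. \<Sum>j<N. (- B (e k) (\<phi> j)) * \<phi> j x) h =
        (\<Sum>j<N. B (\<lambda>x. (- B (e k) (\<phi> j)) * \<phi> j x) h)"
      using that by (intro B_sum V_scale \<phi>V)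
    also have "\<dots> = (\<Sum>j<N. (- B (e k) (\<phi> j)) * B (\<phi> j) h)"
      using that by (intro sum.cong B_scale \<phi>V) auto
    finally show ?thesis by (simp add: sum_negf)
  qed
  have r_ortho: "B r (\<phi> i) = 0" if "i < N" for i
  proof -
    have "(\<Sum>j<N. B (e k) (\<phi> j) * B (\<phi> j) (\<phi> i)) = (\<Sum>j<N. if j = i then B (e k) (\<phi> i) else 0)"
      using that by (intro sum.cong) (auto simp: ortho)
    then show ?thesis using that by (simp add: B_r \<phi>V)
  qed
  have r_ortho_e: "B (e i) r = 0" if "i \<in> I" for i
  proof -
    have "B (e i) r = B (\<lambda>x. \<Sum>j<N. B (e i) (\<phi> j) * \<phi> j x) r"
      by (intro arg_cong[of _ _ "\<lambda>f. B f r"] ext expand that)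
    also have "\<dots> = (\<Sum>j<N. B (e i) (\<phi> j) * B (\<phi> j) r)"
      by (simp add: B_sum V_scale \<phi>V rV B_scale)
    also have "\<dots> = 0" by (intro sum.neutral) (metis B_sym lessThan_iff mult_zero_right r_ortho)
    finally show ?thesis .
  qed
  have B_ek_r: "B (e k) r = B r r"
  proof -
    have "(\<Sum>j<N. B (e k) (\<phi> j) * B (\<phi> j) r) = 0"
      by (intro sum.neutral) (metis B_sym lessThan_iff mult_zero_right r_ortho)
    then show ?thesis using B_r[OF rV] by simp
  qed
  show ?case
  proof (cases "B r r = 0")
    case True
    then have "r x = 0" for x using B_def[OF rV] by blast
    then have "e k x = (\<Sum>j<N. B (e k) (\<phi> j) * \<phi> j x)" for x
      unfolding r_def by (metis eq_iff_diff_eq_0)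
    then show ?thesis using \<phi>V ortho expand by (intro exI[of _ N] exI[of _ \<phi>]) auto
  next
    case False
    define s where "s = sqrt (B r r)"
    have s: "s > 0" "s * s = B r r" using False B_nonneg[OF rV] by (auto simp: s_def)
    define \<psi> where "\<psi> = \<phi>(N := (\<lambda>x. (1 / s) * r x))"
    have \<psi>_less: "\<psi> j = \<phi> j" if "j < N" for j using that by (simp add: \<psi>_def)
    have \<psi>_N: "\<psi> N = (\<lambda>x. (1 / s) * r x)" by (simp add: \<psi>_def)
    have \<psi>V: "\<psi> i \<in> V" if "i < Suc N" for i
      using that \<phi>V rV V_scale[OF rV, of "1 / s"] by (auto simp: \<psi>_def)
    have B_\<psi>N: "B (\<psi> N) h = B r h / s" if "h \<in> V" for h
      unfolding \<psi>_N using B_scale[OF rV that, of "1 / s"] by simp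
    have "B (\<psi> N) (\<psi> N) = 1"
    proof -
      have "B (\<psi> N) (\<psi> N) = B (\<psi> N) r / s" using B_\<psi>N[OF \<psi>V] by (simp add: B_sym[of r])
      also have "\<dots> = 1" using B_\<psi>N[OF rV] s(1) by (simp flip: s(2))
      finally show ?thesis .
    qed
    moreover have "B (\<psi> N) (\<phi> j) = 0" if "j < N" for j
      using B_\<psi>N[OF \<phi>V[OF that]] r_ortho[OF that] by simp
    ultimately have "\<forall>i<Suc N. \<forall>j<Suc N. B (\<psi> i) (\<psi> j) = (if i = j then 1 else 0)"
      using ortho \<psi>_less B_sym by (auto simp: less_Suc_eq)
    moreover have "e i x = (\<Sum>j<Suc N. B (e i) (\<psi> j) * \<psi> j x)" if "i \<in> insert k I" for i x
    proof -
      have *: "(\<Sum>j<Suc N. B (e i) (\<psi> j) * \<psi> j x) =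
          (\<Sum>j<N. B (e i) (\<phi> j) * \<phi> j x) + B (e i) r / s * (r x / s)"
        using B_\<psi>N[of "e i"] that insert.prems
          by (simp add: \<psi>_less B_sym[of "e i" "\<psi> N"] B_sym[of r]) (simp add: \<psi>_N)
      show ?thesis
      proof (cases "i = k")
        case True
        have "B (e k) r / s * (r x / s) = r x"
          using s(1) by (simp add: B_ek_r flip: s(2))
        then show ?thesis using True * by (simp add: r_def)
      next
        case False
        then show ?thesis using that * r_ortho_e expand by simp
      qed
    qed
    ultimately show ?thesis using \<psi>V by (intro exI[of _ "Suc N"] exI[of _ \<psi>]) blast
  qed
qed

section \<open>Integrals of continuous functions over compact sets\<close>

lemma set_integrable_continuous_finite:
  fixes f :: "'a::euclidean_space \<Rightarrow> 'b::{banach, second_countable_topology}"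
  assumes "sets M = sets borel" "compact A" "emeasure M A < \<infinity>" "continuous_on UNIV f"
  shows "set_integrable M A f"
proof -
  have "compact (f ` A)" using assms
    by (intro compact_continuous_image) (auto intro: continuous_on_subset)
  then obtain b where b: "\<And>x. x \<in> A \<Longrightarrow> norm (f x) \<le> b"
    by (meson bounded_iff compact_imp_bounded imageI)
  have "f \<in> borel_measurable borel" using assms(4) by (rule borel_measurable_continuous_onI)
  then have "f \<in> borel_measurable M" using assms(1) measurable_cong_sets by blast
  moreover have "A \<in> sets M" using assms(1,2) by (simp add: borel_compact)
  ultimately show ?thesis unfolding set_integrable_def using assms(3) b
    by (intro integrableI_bounded_set_indicator[where B = b]) auto
qed

lemma set_integrable_continuous_lborel:
  fixes f :: "'a::euclidean_space \<Rightarrow> 'b::{banach, second_countable_topology}"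
  assumes "compact A" "continuous_on UNIV f"
  shows "set_integrable lborel A f"
  using assms emeasure_compact_finite by (intro set_integrable_continuous_finite) auto

lemma set_integral_finite_sum:
  fixes f :: "'i \<Rightarrow> 'a \<Rightarrow> 'b::{banach, second_countable_topology}"
  assumes "\<And>i. i \<in> I \<Longrightarrow> set_integrable M A (f i)"
  shows "(LINT x:A|M. (\<Sum>i\<in>I. f i x)) = (\<Sum>i\<in>I. LINT x:A|M. f i x)"
  using assms unfolding set_lebesgue_integral_def set_integrable_def
  by (simp add: scaleR_sum_right Bochner_Integration.integral_sum)

text \<open>Around a point with nonzero value the square is positive on an open set, and nonempty
  open sets are not negligible.\<close>

lemma continuous_zero_if_square_integral_zero:
  fixes f :: "'a::euclidean_space \<Rightarrow> real"
  assumes "compact A" "ball x0 r \<subseteq> A" "continuous_on UNIV f"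
    and zero: "(LINT x:A|lborel. f x * f x) = 0" and "x \<in> ball x0 r"
  shows "f x = 0"
proof (rule ccontr)
  assume "f x \<noteq> 0"
  have cont: "continuous_on UNIV (\<lambda>x. f x * f x)" using assms by (intro continuous_intros)
  define U where "U = {y. f y * f y > 0} \<inter> ball x0 r"
  have "open {y. f y * f y > 0}" using cont by (intro open_Collect_less continuous_on_const)
  then have op: "open U" unfolding U_def by auto
  have int: "integrable lborel (\<lambda>x. indicator A x *\<^sub>R (f x * f x))"
    using set_integrable_continuous_lborel[OF assms(1) cont] by (simp add: set_integrable_def)
  have "AE x in lborel. indicator A x *\<^sub>R (f x * f x) = 0"
    using zero integral_nonneg_eq_0_iff_AE[OF int] unfolding set_lebesgue_integral_def by auto
  then have "AE x in lborel. x \<notin> U"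
    unfolding U_def by eventually_elim (use assms(2) in auto)
  then have "U \<in> null_sets lborel"
    using op by (subst AE_iff_null_sets) auto
  then have "negligible U"
    unfolding negligible_iff_null_sets by (rule null_sets_completionI)
  moreover have "x \<in> U"
    unfolding U_def using \<open>f x \<noteq> 0\<close> assms(5) by (auto simp: zero_less_mult_iff)
  ultimately show False using op open_not_negligible by blast
qed

text \<open>The ball inside \<open>S\<close> makes the inner product over \<open>S\<close> definite
  on polynomials. The expansion is valid at every point of space, which is what allows integrals
  over a small set to control values far from it.\<close>

lemma poly_space_reproducing_basis:
  fixes S :: "(real^'n) set"
  assumes "compact S" "ball x0 r \<subseteq> S" "r > 0"
  obtains N :: nat and \<phi> where "\<And>i. i < N \<Longrightarrow> \<phi> i \<in> poly_space m"
    "\<And>p x. p \<in> poly_space m \<Longrightarrow> p x = (\<Sum>i<N. (LINT y:S|lborel. p y * \<phi> i y) * \<phi> i x)"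
proof -
  define B where "B f g = (LINT y:S|lborel. f y * g y)" for f g :: "real^'n \<Rightarrow> real"
  have int: "set_integrable lborel S (\<lambda>y. f y * g y)"
    if "f \<in> poly_space m" "g \<in> poly_space m" for f g
    using that by (intro set_integrable_continuous_lborel assms(1) continuous_on_mult
      poly_space_continuous)
  have B_add: "B (\<lambda>x. f x + g x) h = B f h + B g h"
    if "f \<in> poly_space m" "g \<in> poly_space m" "h \<in> poly_space m" for f g h
    unfolding B_def using that by (simp add: distrib_right int)
  have B_scale: "B (\<lambda>x. a * f x) h = a * B f h" for f h a
    unfolding B_def by (simp add: mult.assoc)
  have "\<exists>N \<phi>. (\<forall>i<N. \<phi> i \<in> poly_space m) \<and> (\<forall>i<N. \<forall>j<N. B (\<phi> i) (\<phi> j) = (if i = j then 1 else 0)) \<and>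
    (\<forall>\<alpha>\<in>{\<alpha>. (\<Sum>i\<in>UNIV. \<alpha> i) \<le> m}. \<forall>x. monom_fun \<alpha> x = (\<Sum>j<(N::nat). B (monom_fun \<alpha>) (\<phi> j) * \<phi> j x))"
  proof (rule orthonormal_expansion)
    show "B f f \<ge> 0" for f unfolding B_def
      by (simp add: set_lebesgue_integral_def)
    show "f x = 0" if "f \<in> poly_space m" "B f f = 0" for f x
    proof (rule poly_space_zero_if_zero_on_ball[OF that(1) assms(3)])
      show "f x = 0" if "x \<in> ball x0 r" for x
        using that \<open>B f f = 0\<close> assms(1,2) poly_space_continuous[OF \<open>f \<in> poly_space m\<close>]
        by (intro continuous_zero_if_square_integral_zero[of S x0 r f]) (simp_all add: B_def)
    qed
    show "B f g = B g f" for f g unfolding B_def by (simp only: mult.commute)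
  qed (simp_all add: poly_space_const poly_space_add poly_space_scale finite_multi_indices
    poly_space_monom
      B_add B_scale)
  then obtain N \<phi> where \<phi>: "\<And>i. i < N \<Longrightarrow> \<phi> i \<in> poly_space m"
    and ex: "\<And>\<alpha> x. (\<Sum>i\<in>UNIV. \<alpha> i) \<le> m \<Longrightarrow> monom_fun \<alpha> x =
        (\<Sum>j<(N::nat). B (monom_fun \<alpha>) (\<phi> j) * \<phi> j x)"
    by blast
  have "p x = (\<Sum>i<N. (LINT y:S|lborel. p y * \<phi> i y) * \<phi> i x)" if "p \<in> poly_space m" for p x
  proof -
    let ?I = "{\<alpha> :: 'n \<Rightarrow> nat. (\<Sum>i\<in>UNIV. \<alpha> i) \<le> m}"
    from that obtain c where p: "p = (\<lambda>x. \<Sum>\<alpha>\<in>?I. c \<alpha> * monom_fun \<alpha> x)"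
      unfolding poly_space_iff by blast
    have "B p (\<phi> j) = (\<Sum>\<alpha>\<in>?I. c \<alpha> * B (monom_fun \<alpha>) (\<phi> j))" if "j < N" for j
    proof -
      have "B p (\<phi> j) = (LINT y:S|lborel. \<Sum>\<alpha>\<in>?I. c \<alpha> * (monom_fun \<alpha> y * \<phi> j y))"
        unfolding B_def p by (simp add: sum_distrib_right mult.assoc)
      also have "\<dots> = (\<Sum>\<alpha>\<in>?I. LINT y:S|lborel. c \<alpha> * (monom_fun \<alpha> y * \<phi> j y))"
        using that by (intro set_integral_finite_sum set_integrable_mult_right)
          (auto intro: int \<phi> poly_space_monom)
      finally show ?thesis by (simp add: B_def)
    qed
    then have "(\<Sum>j<N. B p (\<phi> j) * \<phi> j x) = (\<Sum>j<N. \<Sum>\<alpha>\<in>?I. c \<alpha> * (B (monom_fun \<alpha>) (\<phi> j) * \<phi> j x))"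
      by (simp add: sum_distrib_right mult.assoc)
    also have "\<dots> = (\<Sum>\<alpha>\<in>?I. c \<alpha> * (\<Sum>j<N. B (monom_fun \<alpha>) (\<phi> j) * \<phi> j x))"
      by (subst sum.swap) (simp add: sum_distrib_left)
    also have "\<dots> = p x" unfolding p by (intro sum.cong) (auto simp: ex[symmetric])
    finally show ?thesis by (simp add: B_def)
  qed
  with \<phi> show thesis by (rule that)
qed

text \<open>In finite dimension a linear functional is represented by the combination of basis
  functions weighted with its values on them; no continuity is involved. This produces the lifting
  on each element.\<close>

lemma poly_space_riesz:
  fixes S :: "(real^'n) set" and l :: "(real^'n \<Rightarrow> real) \<Rightarrow> real"
  assumes S: "compact S" "ball x0 r \<subseteq> S" "r > 0"
    and l_add: "\<And>p q. p \<in> poly_space m \<Longrightarrow> q \<in> poly_space m \<Longrightarrow> l (\<lambda>x. p x + q x) = l p + l q"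
    and l_scale: "\<And>p a. p \<in> poly_space m \<Longrightarrow> l (\<lambda>x. a * p x) = a * l p"
  shows "\<exists>g\<in>poly_space m. \<forall>q\<in>poly_space m. (LINT x:S|lborel. g x * q x) = l q"
proof -
  obtain N \<phi> where \<phi>: "\<And>i. i < N \<Longrightarrow> \<phi> i \<in> poly_space m"
    and ex: "\<And>p x. p \<in> poly_space m \<Longrightarrow> p x = (\<Sum>i<(N::nat). (LINT y:S|lborel. p y * \<phi> i y) * \<phi> i x)"
    by (rule poly_space_reproducing_basis[OF S, where m = m]) blast
  have l_zero: "l (\<lambda>x. 0) = 0" using l_scale[of "\<lambda>x. 0" 0] poly_space_const[where c = 0 and k = m]
    by simp
  have l_sum: "l (\<lambda>x. \<Sum>i<M. c i * \<phi> i x) = (\<Sum>i<M. c i * l (\<phi> i))" if "M \<le> N" for M c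
    using that
  proof (induction M)
    case (Suc M)
    have "(\<lambda>x. \<Sum>i<M. c i * \<phi> i x) \<in> poly_space m"
      using Suc.prems by (intro poly_space_sum poly_space_scale \<phi>) auto
    with Suc show ?case
      using l_add[of "\<lambda>x. \<Sum>i<M. c i * \<phi> i x" "\<lambda>x. c M * \<phi> M x"]
      by (simp add: l_scale \<phi> poly_space_scale poly_space_sum)
  qed (simp add: l_zero)
  define g where "g = (\<lambda>x. \<Sum>i<N. l (\<phi> i) * \<phi> i x)"
  have "g \<in> poly_space m" unfolding g_def by (intro poly_space_sum poly_space_scale \<phi>) auto
  moreover have "(LINT x:S|lborel. g x * q x) = l q" if q: "q \<in> poly_space m" for q
  proof -
    have "(LINT x:S|lborel. g x * q x) = (LINT x:S|lborel. \<Sum>i<N. l (\<phi> i) * (q x * \<phi> i x))"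
      by (simp add: g_def sum_distrib_right sum_distrib_left mult_ac)
    also have "\<dots> = (\<Sum>i<N. LINT x:S|lborel. l (\<phi> i) * (q x * \<phi> i x))"
      by (intro set_integral_finite_sum set_integrable_mult_right set_integrable_continuous_lborel
        S(1)
          continuous_on_mult poly_space_continuous[of _ m] q \<phi>) auto
    also have "\<dots> = (\<Sum>i<N. (LINT x:S|lborel. q x * \<phi> i x) * l (\<phi> i))" by (simp add: mult.commute)
    also have "\<dots> = l (\<lambda>x. \<Sum>i<N. (LINT y:S|lborel. q y * \<phi> i y) * \<phi> i x)"
      by (rule l_sum[symmetric]) simp
    also have "(\<lambda>x. \<Sum>i<N. (LINT y:S|lborel. q y * \<phi> i y) * \<phi> i x) = q"
      by (intro ext ex[OF q, symmetric])
    finally show ?thesis .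
  qed
  ultimately show ?thesis by blast
qed

lemma set_integral_mono_set:
  fixes f :: "'a::euclidean_space \<Rightarrow> real"
  assumes "set_integrable M B f" "A \<in> sets M" "A \<subseteq> B" "\<And>x. x \<in> B \<Longrightarrow> f x \<ge> 0"
  shows "(LINT x:A|M. f x) \<le> (LINT x:B|M. f x)"
proof -
  have "set_integrable M A f" using assms by (intro set_integrable_subset[OF assms(1)])
  then show ?thesis using assms(1) unfolding set_lebesgue_integral_def set_integrable_def
    by (rule integral_mono) (use assms in \<open>auto split: split_indicator\<close>)
qed

text \<open>Cauchy-Schwarz applied to the expansion of \<open>p\<close> at \<open>y\<close>: the
  constant is the maximum over \<open>cball 0 R\<close> of the reproducing kernel on the
  diagonal.\<close>

lemma poly_sup_unit:
  fixes R :: real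
  shows "\<exists>C>0. \<forall>p\<in>(poly_space m :: (real^'n \<Rightarrow> real) set). \<forall>y\<in>cball 0 R.
    (p y)\<^sup>2 \<le> C * (LINT x:cball 0 1|lborel. (p x)\<^sup>2)"
proof -
  let ?S = "cball 0 1 :: (real^'n) set"
  obtain N \<phi> where \<phi>: "\<And>i. i < N \<Longrightarrow> \<phi> i \<in> poly_space m"
    and ex: "\<And>p x. p \<in> poly_space m \<Longrightarrow> p x = (\<Sum>i<(N::nat). (LINT y:?S|lborel. p y * \<phi> i y) * \<phi> i x)"
    by (rule poly_space_reproducing_basis[of ?S 0 1, where m = m]) (auto intro: that)
  have "compact ((\<lambda>x. \<Sum>i<N. (\<phi> i x)\<^sup>2) ` cball 0 R)"
    by (intro compact_continuous_image continuous_intros poly_space_continuous[of _ m])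
      (auto simp: \<phi>)
  then obtain b where b: "\<And>x. x \<in> cball 0 R \<Longrightarrow> norm (\<Sum>i<N. (\<phi> i x)\<^sup>2) \<le> b"
    by (meson bounded_iff compact_imp_bounded imageI)
  have "(p y)\<^sup>2 \<le> (\<bar>b\<bar> + 1) * (LINT x:?S|lborel. (p x)\<^sup>2)" if p: "p \<in> poly_space m"
    and y: "y \<in> cball 0 R" for p y
  proof -
    define c where "c i = (LINT x:?S|lborel. p x * \<phi> i x)" for i
    \<comment> \<open>Parseval, obtained by inserting the expansion into only one of the two factors
      of the square and integrating term by term.\<close>
    have "(LINT x:?S|lborel. (p x)\<^sup>2) = (LINT x:?S|lborel. (\<Sum>i<N. c i * (p x * \<phi> i x)))"
    proof -
      have "(p x)\<^sup>2 = (\<Sum>i<N. c i * (p x * \<phi> i x))" for x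
        unfolding power2_eq_square
        by (subst (2) ex[OF p]) (simp add: sum_distrib_left c_def mult_ac)
      then show ?thesis by simp
    qed
    also have "\<dots> = (\<Sum>i<N. LINT x:?S|lborel. c i * (p x * \<phi> i x))"
      by (intro set_integral_finite_sum set_integrable_mult_right set_integrable_continuous_lborel
          continuous_on_mult poly_space_continuous[of _ m] p \<phi>) auto
    also have "\<dots> = (\<Sum>i<N. (c i)\<^sup>2)" by (simp add: c_def power2_eq_square)
    finally have c: "(LINT x:?S|lborel. (p x)\<^sup>2) = (\<Sum>i<N. (c i)\<^sup>2)" .
    have "(p y)\<^sup>2 = (\<Sum>i<N. c i * \<phi> i y)\<^sup>2" by (subst ex[OF p]) (simp add: c_def)
    also have "\<dots> \<le> (\<Sum>i<N. (c i)\<^sup>2) * (\<Sum>i<N. (\<phi> i y)\<^sup>2)" by (rule Cauchy_Schwarz_ineq_sum)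
    also have "\<dots> \<le> (\<Sum>i<N. (c i)\<^sup>2) * (\<bar>b\<bar> + 1)"
      using b[OF y] by (intro mult_left_mono sum_nonneg) auto
    finally show ?thesis by (simp add: c mult.commute)
  qed
  then show ?thesis by (intro exI[of _ "\<bar>b\<bar> + 1"]) auto
qed

lemma set_integral_cball_scale:
  fixes f :: "'a::euclidean_space \<Rightarrow> real"
  assumes "r > 0" "continuous_on UNIV f"
  shows "(LINT x:cball x0 r|lborel. f x) = r ^ DIM('a) * (LINT x:cball 0 1|lborel. f (x0 + r *\<^sub>R x))"
proof -
  have "integral\<^sup>L lborel (\<lambda>x. indicator (cball x0 r) x *\<^sub>R f x) =
    integral\<^sup>L (density (distr lborel borel (\<lambda>x. x0 + r *\<^sub>R x)) (\<lambda>_. ennreal (\<bar>r\<bar> ^ DIM('a)))) 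
      (\<lambda>x. indicator (cball x0 r) x *\<^sub>R f x)"
    using assms by (subst lborel_affine[of r x0]) auto
  also have "\<dots> = r ^ DIM('a) * (LINT x:cball 0 1|lborel. f (x0 + r *\<^sub>R x))" 
  proof -
    have fm [measurable]: "f \<in> borel_measurable borel" using assms(2)
      by (rule borel_measurable_continuous_onI)
    have "indicator (cball x0 r) (x0 + r *\<^sub>R x) = (indicator (cball 0 1) x :: real)" for x
      using assms(1) by (auto simp: dist_norm split: split_indicator)
    moreover have "integral\<^sup>L (distr lborel borel (\<lambda>x. x0 +
        r *\<^sub>R x)) (\<lambda>x. indicator (cball x0 r) x *\<^sub>R f x) =
        integral\<^sup>L lborel (\<lambda>x. indicator (cball x0 r) (x0 + r *\<^sub>R x) *\<^sub>R f (x0 + r *\<^sub>R x))"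
      by (intro integral_distr borel_measurable_scaleR borel_measurable_indicator fm) auto
    ultimately show ?thesis using assms(1)
      by (subst integral_density) (simp_all add: set_lebesgue_integral_def borel_measurable_times
        borel_measurable_indicator fm)
  qed
  finally show ?thesis by (simp add: set_lebesgue_integral_def)
qed

text \<open>Polynomials of given degree are invariant under \<open>x0 + r *\<^sub>R x\<close>, so
  the unit ball case transfers with the Jacobian as only change; the constant does not depend on
  centre or radius. It takes the place of a reference element.\<close>

lemma poly_sup_bound:
  fixes R :: real
  shows "\<exists>C>0. \<forall>p\<in>(poly_space m :: (real^'n \<Rightarrow> real) set). \<forall>x0 r. r > 0 \<longrightarrow> (\<forall>y\<in>cball x0 (R * r).
    (p y)\<^sup>2 \<le> C / r ^ CARD('n) * (LINT x:cball x0 r|lborel. (p x)\<^sup>2))"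
proof -
  obtain C where C: "C > 0" "\<And>p y. p\<in>(poly_space m :: (real^'n \<Rightarrow> real) set) \<Longrightarrow> y\<in>cball 0 R \<Longrightarrow>
    (p y)\<^sup>2 \<le> C * (LINT x:cball 0 1|lborel. (p x)\<^sup>2)" using poly_sup_unit[of m R] by blast
  have "(p y)\<^sup>2 \<le> C / r ^ CARD('n) * (LINT x:cball x0 r|lborel. (p x)\<^sup>2)"
    if p: "p \<in> poly_space m" and r: "r > 0" and y: "y \<in> cball x0 (R * r)" for p :: "real^'n \<Rightarrow> real"
      and x0 r y
  proof -
    define q where "q x = p (x0 + r *\<^sub>R x)" for x
    have "q \<in> poly_space m" unfolding q_def
    proof (intro poly_space_comp[OF p])
      have "(\<lambda>x::real^'n. x0 $ i + r * x $ i) \<in> poly_space 1" for i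
        by (intro poly_space_add poly_space_const poly_space_scale poly_space_coord)
      then show "(\<lambda>x. x0 + r *\<^sub>R x) \<in> vec_poly_space 1" by (simp add: vec_poly_space_def)
    qed
    moreover have "(1 / r) *\<^sub>R (y - x0) \<in> cball 0 R"
      using y r by (simp add: dist_norm norm_minus_commute divide_le_eq)
    ultimately have "(q ((1 / r) *\<^sub>R (y - x0)))\<^sup>2 \<le> C * (LINT x:cball 0 1|lborel. (q x)\<^sup>2)"
      by (rule C(2))
    then have "(p y)\<^sup>2 \<le> C * (LINT x:cball 0 1|lborel. (q x)\<^sup>2)" using r by (simp add: q_def)
    also have "\<dots> = C / r ^ CARD('n) * (LINT x:cball x0 r|lborel. (p x)\<^sup>2)"
      using r poly_space_continuous[OF p, of UNIV]
        by (simp add: set_integral_cball_scale[of r "\<lambda>x. (p x)\<^sup>2" x0] q_def continuous_on_power)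
    finally show ?thesis .
  qed
  with C(1) show ?thesis by blast
qed

section \<open>Hausdorff measure on hyperplanes\<close>

definition hyperplane_proj :: "'a::real_inner \<Rightarrow> 'a \<Rightarrow> 'a \<Rightarrow> 'a" where
  "hyperplane_proj \<nu> q x = x - ((x - q) \<bullet> \<nu>) *\<^sub>R \<nu>"

lemma exists_orthogonal_unit:
  fixes \<nu> :: "'a::euclidean_space"
  assumes "DIM('a) \<ge> 2"
  shows "\<exists>e. norm e = 1 \<and> e \<bullet> \<nu> = 0"
proof -
  obtain y where y: "y \<noteq> 0" "orthogonal \<nu> y"
    using orthogonal_to_vector_exists[of \<nu>] assms by metis
  show ?thesis
    by (rule exI[of _ "y /\<^sub>R norm y"]) (use y in \<open>auto simp: orthogonal_def inner_commute\<close>)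
qed

section \<open>Packing in hyperplanes and the upper bound for the Hausdorff measure\<close>

lemma sum_powers_disjoint_balls:
  fixes c :: "'i \<Rightarrow> 'a::euclidean_space"
  assumes "finite I" "disjoint_family_on (\<lambda>i. ball (c i) (\<rho> i)) I"
    and "\<And>i. i \<in> I \<Longrightarrow> \<rho> i \<ge> 0" "\<And>i. i \<in> I \<Longrightarrow> ball (c i) (\<rho> i) \<subseteq> cball x R" "R \<ge> 0"
  shows "(\<Sum>i\<in>I. \<rho> i ^ DIM('a)) \<le> R ^ DIM('a)"
proof -
  let ?w = "unit_ball_vol (real DIM('a))"
  have "ennreal (?w * (\<Sum>i\<in>I. \<rho> i ^ DIM('a))) = (\<Sum>i\<in>I. ennreal (?w * \<rho> i ^ DIM('a)))"
    using assms by (subst sum_ennreal) (auto simp: sum_distrib_left)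
  also have "\<dots> = (\<Sum>i\<in>I. emeasure lborel (ball (c i) (\<rho> i)))"
    using assms by (intro sum.cong) (auto simp: emeasure_ball)
  also have "\<dots> = emeasure lborel (\<Union>i\<in>I. ball (c i) (\<rho> i))"
    using assms by (intro sum_emeasure) auto
  also have "\<dots> \<le> emeasure lborel (cball x R)"
    using assms by (intro emeasure_mono) auto
  also have "\<dots> = ennreal (?w * R ^ DIM('a))" using assms by (simp add: emeasure_cball)
  finally have "?w * (\<Sum>i\<in>I. \<rho> i ^ DIM('a)) \<le> ?w * R ^ DIM('a)"
    using assms by (subst (asm) ennreal_le_iff) auto
  then show ?thesis using unit_ball_vol_pos[of "real DIM('a)"] by simp
qed

text \<open>A volume count in full dimension replaces one inside the hyperplane: \<open>M\<close>
  copies of \<open>Z\<close>, stacked along the normal at distance \<open>h / M\<close>, are again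
  separated, which gives \<open>card Z * M\<close> disjoint balls and hence the exponent
  \<open>DIM('a) - 1\<close>.\<close>

lemma separated_in_hyperplane_card:
  fixes x0 :: "'a::euclidean_space"
  assumes "h > 0" "M \<ge> 1" "norm \<nu> = 1" "finite Z" "Z \<subseteq> cball x0 h"
    and plane: "\<And>z. z \<in> Z \<Longrightarrow> (z - f) \<bullet> \<nu> = 0"
    and sep: "\<And>z w. z \<in> Z \<Longrightarrow> w \<in> Z \<Longrightarrow> z \<noteq> w \<Longrightarrow> dist z w \<ge> h / real M"
  shows "real (card Z) \<le> 6 ^ DIM('a) * real M ^ (DIM('a) - 1)"
proof -
  define \<delta> where "\<delta> = h / real M"
  have \<delta>: "\<delta> > 0" "\<delta> \<le> h" using assms by (auto simp: \<delta>_def divide_le_eq)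
  define c where "c = (\<lambda>(z, k). z + (real k * \<delta>) *\<^sub>R \<nu>)"
  have "dist (c (z, k)) (c (w, l)) \<ge> \<delta>"
    if "z \<in> Z" "w \<in> Z" "k < M" "l < M" "(z, k) \<noteq> (w, l)" for z w k l
  proof -
    have "(z - w) \<bullet> \<nu> = 0" using plane[OF that(1)] plane[OF that(2)] by (simp add: inner_diff_left)
    moreover have "c (z, k) - c (w, l) = (z - w) + ((real k - real l) * \<delta>) *\<^sub>R \<nu>"
      by (simp add: c_def algebra_simps)
    ultimately have "(dist (c (z, k)) (c (w, l)))\<^sup>2 = (norm (z - w))\<^sup>2 + ((real k - real l) * \<delta>)\<^sup>2"
      using norm_add_Pythagorean[of "z - w" "((real k - real l) * \<delta>) *\<^sub>R \<nu>"] assms(3)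
      by (simp add: dist_norm orthogonal_def)
    moreover have "\<delta>\<^sup>2 \<le> (norm (z - w))\<^sup>2 + ((real k - real l) * \<delta>)\<^sup>2"
    proof (cases "z = w")
      case True
      then have "1 \<le> \<bar>real k - real l\<bar>" using that by auto
      then have "1 * \<delta> \<le> \<bar>(real k - real l) * \<delta>\<bar>" using \<delta> by (simp add: abs_mult)
      then show ?thesis using \<delta> by (simp add: abs_le_square_iff[symmetric] add_increasing)
    next
      case False
      then have "\<delta> \<le> norm (z - w)" using sep that by (simp add: \<delta>_def dist_norm)
      then show ?thesis using \<delta> by (intro add_increasing2 power_mono) auto
    qed
    ultimately have "\<delta>\<^sup>2 \<le> (dist (c (z, k)) (c (w, l)))\<^sup>2" by simp
    then show ?thesis by (rule power2_le_imp_le) simp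
  qed
  then have far: "dist (c i) (c j) \<ge> \<delta>" if "i \<in> Z \<times> {..<M}" "j \<in> Z \<times> {..<M}" "i \<noteq> j" for i j
    using that by (cases i; cases j) auto
  have disj: "disjoint_family_on (\<lambda>i. ball (c i) (\<delta> / 2)) (Z \<times> {..<M})"
    unfolding disjoint_family_on_def
  proof (intro ballI impI)
    fix i j assume "i \<in> Z \<times> {..<M}" "j \<in> Z \<times> {..<M}" "i \<noteq> j"
    then have "dist (c i) (c j) \<ge> \<delta>" by (rule far)
    then show "ball (c i) (\<delta> / 2) \<inter> ball (c j) (\<delta> / 2) = {}"
      by (auto intro!: disjoint_ballI)
  qed
  \<comment> \<open>One \<open>h\<close> for the distance of \<open>z\<close> from
    \<open>x0\<close>, one for the height of the stack and one for the radius. The 6 in the bound is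
    the ratio of \<open>3 * h\<close> to \<open>\<delta> / 2\<close>, up to the factor
    \<open>M\<close>.\<close>
  have "ball (c i) (\<delta> / 2) \<subseteq> cball x0 (3 * h)" if i: "i \<in> Z \<times> {..<M}" for i
  proof
    fix y assume y: "y \<in> ball (c i) (\<delta> / 2)"
    obtain z k where zk: "i = (z, k)" "z \<in> Z" "k < M" using i by auto
    have "dist z (c i) = real k * \<delta>" using \<delta> assms(3) by (simp add: zk c_def dist_norm)
    also have "\<dots> \<le> real M * \<delta>" using zk \<delta> by (intro mult_right_mono) auto
    also have "\<dots> = h" using assms by (simp add: \<delta>_def)
    finally have "dist z (c i) \<le> h" .
    moreover have "dist x0 z \<le> h" using assms zk by auto
    moreover have "dist (c i) y < h" using y \<delta> by auto
    ultimately show "y \<in> cball x0 (3 * h)"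
      using dist_triangle[of x0 y z] dist_triangle[of z y "c i"] by auto
  qed
  then have "(\<Sum>i\<in>Z \<times> {..<M}. (\<delta> / 2) ^ DIM('a)) \<le> (3 * h) ^ DIM('a)"
    using assms \<delta> disj by (intro sum_powers_disjoint_balls[of _ c]) auto
  then have "real (card Z) * real M * (\<delta> / 2) ^ DIM('a) \<le>
      (6 * real M) ^ DIM('a) * (\<delta> / 2) ^ DIM('a)"
  proof -
    have "3 * h = (6 * real M) * (\<delta> / 2)" using assms(2) by (simp add: \<delta>_def)
    then have "(3 * h) ^ DIM('a) = (6 * real M) ^ DIM('a) * (\<delta> / 2) ^ DIM('a)"
      by (simp only: power_mult_distrib)
    moreover have "(\<Sum>i\<in>Z \<times> {..<M}. (\<delta> / 2) ^ DIM('a)) = real (card Z) * real M * (\<delta> / 2) ^ DIM('a)"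
      by (simp only: sum_constant card_cartesian_product card_lessThan of_nat_mult)
    ultimately show ?thesis using \<open>(\<Sum>i\<in>Z \<times> {..<M}. (\<delta> / 2) ^ DIM('a)) \<le> (3 * h) ^ DIM('a)\<close>
      by (simp only:)
  qed
  then have "real (card Z) * real M \<le> (6 * real M) ^ DIM('a)"
    using \<delta> by simp
  also have "\<dots> = 6 ^ DIM('a) * real M ^ (DIM('a) - 1) * real M"
    by (metis DIM_positive mult.assoc power_minus_mult power_mult_distrib)
  finally show ?thesis using assms(2) by simp
qed

text \<open>A separated set of largest cardinality is a net, because a point farther than
  \<open>\<delta>\<close> from all its members could be added.\<close>

lemma exists_maximal_separated:
  assumes "\<delta> \<ge> 0"
    and "\<And>Z. finite Z \<Longrightarrow> Z \<subseteq> F \<Longrightarrow> (\<forall>z\<in>Z. \<forall>w\<in>Z. z \<noteq> w \<longrightarrow> dist z w \<ge> \<delta>) \<Longrightarrow> real (card Z) \<le> N"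
  shows "\<exists>Z. finite Z \<and> Z \<subseteq> F \<and> (\<forall>z\<in>Z. \<forall>w\<in>Z. z \<noteq> w \<longrightarrow> dist z w \<ge> \<delta>) \<and> (\<forall>x\<in>F. \<exists>z\<in>Z. dist z x \<le> \<delta>)"
proof -
  define P where "P Z \<longleftrightarrow> finite Z \<and> Z \<subseteq> F \<and> (\<forall>z\<in>Z. \<forall>w\<in>Z. z \<noteq> w \<longrightarrow> dist z w \<ge> \<delta>)" for Z
  have "P {}" by (simp add: P_def)
  moreover have "\<forall>Z. P Z \<longrightarrow> card Z < Suc (nat \<lfloor>N\<rfloor>)"
    using assms(2) by (auto simp: P_def less_Suc_eq_le intro!: le_nat_floor)
  ultimately have "\<exists>Z. P Z \<and> (\<forall>Y. P Y \<longrightarrow> card Y \<le> card Z)"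
    by (rule Lattices_Big.ex_has_greatest_nat[of P "{}" card "Suc (nat \<lfloor>N\<rfloor>)"])
  then obtain Z where Z: "P Z" "\<And>Y. P Y \<Longrightarrow> card Y \<le> card Z" by blast
  have "\<exists>z\<in>Z. dist z x \<le> \<delta>" if "x \<in> F" for x
  proof (rule ccontr)
    assume *: "\<not> ?thesis"
    then have "x \<notin> Z" using assms(1) by force
    moreover have "P (insert x Z)" using Z(1) that * unfolding P_def
      by (auto simp: not_le dist_commute intro: less_imp_le)
    ultimately show False using Z(2)[of "insert x Z"] Z(1) by (simp add: P_def)
  qed
  with Z(1) show ?thesis unfolding P_def by (intro exI[of _ Z]) simp
qed

text \<open>The finite cover is padded to a sequence by empty sets, which have weight 0 even when
  \<open>s = 0\<close>.\<close>

lemma hausdorff_pre_finite_cover: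
  fixes A :: "'a::real_normed_vector set"
  assumes "finite Z" "A \<subseteq> (\<Union>z\<in>Z. cball z r)" "r \<ge> 0" "2 * r \<le> \<delta>"
  shows "hausdorff_pre s \<delta> A \<le> ennreal (real (card Z) * (unit_ball_vol (real s) * r ^ s))"
proof -
  obtain z where z: "bij_betw z {0..<card Z} Z" using ex_bij_betw_nat_finite[OF assms(1)] by blast
  define U where "U i = (if i < card Z then cball (z i) r else {})" for i
  have diam: "diameter (cball x r) \<le> 2 * r" for x :: 'a
  proof (rule diameter_le)
    fix y w assume "y \<in> cball x r" "w \<in> cball x r"
    then show "norm (y - w) \<le> 2 * r" using dist_triangle2[of y w x]
      by (auto simp: dist_norm norm_minus_commute)
  qed (use assms in auto)
  have "A \<subseteq> (\<Union>i. U i)"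
  proof
    fix a assume "a \<in> A"
    then obtain y where "y \<in> Z" "a \<in> cball y r" using assms by auto
    moreover obtain i where "i < card Z" "z i = y"
      using z \<open>y \<in> Z\<close> unfolding bij_betw_def by (metis atLeastLessThan_iff imageE)
    ultimately show "a \<in> (\<Union>i. U i)" by (auto simp: U_def intro!: exI[of _ i])
  qed
  moreover have "bounded (U i) \<and> diameter (U i) \<le> \<delta>" for i
    using assms order_trans[OF diam] by (auto simp: U_def)
  ultimately have "hausdorff_pre s \<delta> A \<le>
      (\<Sum>i. if U i = {} then 0 else ennreal (unit_ball_vol (real s) * (diameter (U i) / 2) ^ s))"
    unfolding hausdorff_pre_def by (intro INF_lower) auto
  also have "\<dots> = (\<Sum>i<card Z. if U i =
      {} then 0 else ennreal (unit_ball_vol (real s) * (diameter (U i) / 2) ^ s))"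
    by (intro suminf_finite) (auto simp: U_def)
  also have "\<dots> \<le> (\<Sum>i<card Z. ennreal (unit_ball_vol (real s) * r ^ s))"
  proof (intro sum_mono)
    fix i assume "i \<in> {..<card Z}"
    then have "diameter (U i) \<le> 2 * r" using diam by (simp add: U_def)
    then have "diameter (U i) / 2 \<le> r" by simp
    moreover have "diameter (U i) \<ge> 0" by (intro diameter_ge_0) (simp add: U_def)
    ultimately show "(if U i =
        {} then 0 else ennreal (unit_ball_vol (real s) * (diameter (U i) / 2) ^ s))
        \<le> ennreal (unit_ball_vol (real s) * r ^ s)"
      by (auto intro!: ennreal_leI mult_left_mono power_mono)
  qed
  also have "\<dots> = ennreal (real (card Z) * (unit_ball_vol (real s) * r ^ s))"
    using assms by (simp add: ennreal_mult flip: ennreal_of_nat_eq_real_of_nat)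
  finally show ?thesis .
qed

definition hausdorff_const :: "nat \<Rightarrow> real" where
  "hausdorff_const n = 6 ^ n * unit_ball_vol (real (n - 1))"

lemma hausdorff_const_pos: "hausdorff_const n > 0"
  by (simp add: hausdorff_const_def)

lemma hausdorff_outer_hyperplane_le:
  fixes F :: "'a::euclidean_space set"
  assumes "h > 0" "norm \<nu> = 1" "F \<subseteq> cball x0 h" and plane: "\<And>z. z \<in> F \<Longrightarrow> (z - f) \<bullet> \<nu> = 0"
  shows "hausdorff_outer (DIM('a) - 1) F \<le> ennreal (hausdorff_const DIM('a) * h ^ (DIM('a) - 1))"
  unfolding hausdorff_outer_def hausdorff_const_def
proof (rule SUP_least)
  let ?s = "DIM('a) - 1"
  fix \<delta> :: real assume "\<delta> \<in> {0<..}"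
  then have \<delta>: "\<delta> > 0" by simp
  \<comment> \<open>Balls of radius \<open>h / M\<close> are admissible at scale
    \<open>\<delta>\<close>. The powers of \<open>M\<close> from the number of balls and from their
    size cancel, so the bound is uniform in \<open>\<delta>\<close>.\<close>
  define M where "M = nat \<lceil>2 * h / \<delta>\<rceil>"
  have M: "real M \<ge> 2 * h / \<delta>" unfolding M_def by linarith
  moreover have "2 * h / \<delta> > 0" using assms \<delta> by simp
  ultimately have M1: "M \<ge> 1" by linarith
  have h2: "2 * (h / real M) \<le> \<delta>" using M M1 \<delta> by (simp add: field_simps)
  have "h / real M \<ge> 0" using assms(1) by simp
  moreover have card: "real (card Z) \<le> 6 ^ DIM('a) * real M ^ ?s"
    if "finite Z" "Z \<subseteq> F" "\<forall>z\<in>Z. \<forall>w\<in>Z. z \<noteq> w \<longrightarrow> dist z w \<ge> h / real M" for Z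
    using separated_in_hyperplane_card[OF assms(1) M1 assms(2), of Z x0 f] assms(3) plane that
      by blast
  ultimately obtain Z where Z: "finite Z" "Z \<subseteq> F" "\<forall>z\<in>Z. \<forall>w\<in>Z. z \<noteq> w \<longrightarrow> dist z w \<ge> h / real M"
      "\<forall>x\<in>F. \<exists>z\<in>Z. dist z x \<le> h / real M"
    using exists_maximal_separated[of "h / real M" F "6 ^ DIM('a) * real M ^ ?s"] by blast
  have "hausdorff_pre ?s \<delta> F \<le>
      ennreal (real (card Z) * (unit_ball_vol (real ?s) * (h / real M) ^ ?s))"
    using Z assms h2 by (intro hausdorff_pre_finite_cover) auto
  also have "\<dots> \<le> ennreal (6 ^ DIM('a) * real M ^ ?s * (unit_ball_vol (real ?s) * (h / real M) ^
      ?s))"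
    using assms by (intro ennreal_leI mult_right_mono card Z) auto
  also have "6 ^ DIM('a) * real M ^ ?s * (unit_ball_vol (real ?s) * (h / real M) ^ ?s) =
      6 ^ DIM('a) * unit_ball_vol (real ?s) * h ^ ?s"
    using M1 by (simp add: power_divide)
  finally show "hausdorff_pre ?s \<delta> F \<le> \<dots>" .
qed

section \<open>Volume over a set in a hyperplane against its Hausdorff measure\<close>

lemma slab_piece_cover:
  fixes U :: "'a::euclidean_space set"
  assumes "DIM('a) \<ge> 2" "r > 0" "norm \<nu> = 1" "bounded U" "diameter U \<le> r"
  shows "\<exists>W\<in>sets borel. {x \<in> cball q r. hyperplane_proj \<nu> q x \<in> U} \<subseteq> W \<and>
    emeasure lborel W \<le> ennreal (3 * r * unit_ball_vol (real DIM('a)) * 2 ^ DIM('a) * diameter U ^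
      (DIM('a) - 1))"
proof (cases "diameter U = 0")
  case True
  obtain e where e: "norm e = 1" "e \<bullet> \<nu> = 0" using exists_orthogonal_unit[OF assms(1)] by metis
  show ?thesis
  proof (cases "U = {}")
    case False
    then obtain u where "u \<in> U" by auto
    then have U: "U = {u}"
      using diameter_bounded_bound[OF assms(4)] True by fastforce
    \<comment> \<open>The points projecting to \<open>u\<close> lie on a line in direction
      \<open>\<nu>\<close>. As \<open>e\<close> is orthogonal to \<open>\<nu>\<close>, this line
      lies in a hyperplane, which is closed and null.\<close>
    define W where "W = {x. e \<bullet> x = e \<bullet> u}"
    have "closed W" unfolding W_def by (rule closed_hyperplane)
    moreover have "negligible W" unfolding W_def using e by (intro negligible_hyperplane) auto
    moreover have "{x \<in> cball q r. hyperplane_proj \<nu> q x \<in> U} \<subseteq> W"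
      using e by (auto simp: U W_def hyperplane_proj_def inner_diff_right)
    ultimately show ?thesis
      by (intro bexI[of _ W]) (auto simp: negligible_iff_null_sets null_sets_def)
  qed (auto intro!: bexI[of _ "{}"])
next
  case False
  define d where "d = diameter U"
  have d: "d > 0" "d \<le> r" using False assms diameter_ge_0[OF assms(4)] by (auto simp: d_def)
  \<comment> \<open>Index of the slice of thickness \<open>d\<close> containing \<open>x\<close>,
    counted from height \<open>- r\<close>. Inside a slice both the projection and the height vary
    by at most \<open>d\<close>, so a ball of radius \<open>2 * d\<close> covers it.\<close>
  define J where "J x = nat \<lfloor>((x - q) \<bullet> \<nu> + r) / d\<rfloor>" for x
  define S where "S = {x \<in> cball q r. hyperplane_proj \<nu> q x \<in> U}"
  have range: "0 \<le> (x - q) \<bullet> \<nu> + r \<and> (x - q) \<bullet> \<nu> \<le> r" if "x \<in> S" for x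
    using that Cauchy_Schwarz_ineq2[of "x - q" \<nu>] assms(3)
      by (auto simp: S_def dist_norm norm_minus_commute)
  define N where "N = nat \<lfloor>2 * r / d\<rfloor>"
  have J_le: "J x \<le> N" if "x \<in> S" for x
    unfolding J_def N_def using range[OF that] d
      by (intro nat_mono floor_mono divide_right_mono) auto
  have close: "dist x y \<le> 2 * d" if "x \<in> S" "y \<in> S" "J x = J y" for x y
  proof -
    have "\<bar>((x - q) \<bullet> \<nu> + r) / d - ((y - q) \<bullet> \<nu> + r) / d\<bar> \<le> 1"
    proof -
      have "((x - q) \<bullet> \<nu> + r) / d \<ge> 0" "((y - q) \<bullet> \<nu> + r) / d \<ge> 0" using range that d by auto
      then show ?thesis using that(3) unfolding J_def by linarith
    qed
    then have "\<bar>(x - q) \<bullet> \<nu> - (y - q) \<bullet> \<nu>\<bar> \<le> d"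
      using d by (simp add: abs_le_iff flip: diff_divide_distrib)
    then have "norm (((x - q) \<bullet> \<nu> - (y - q) \<bullet> \<nu>) *\<^sub>R \<nu>) \<le> d" using assms(3) by simp
    moreover have "norm (hyperplane_proj \<nu> q x - hyperplane_proj \<nu> q y) \<le> d"
      using diameter_bounded_bound[OF assms(4)] that by (auto simp: S_def d_def dist_norm)
    moreover have "x - y = (hyperplane_proj \<nu> q x - hyperplane_proj \<nu> q y) +
        ((x - q) \<bullet> \<nu> - (y - q) \<bullet> \<nu>) *\<^sub>R \<nu>" by (simp add: hyperplane_proj_def algebra_simps)
    ultimately show ?thesis unfolding dist_norm
      using norm_triangle_mono[of "hyperplane_proj \<nu> q x - hyperplane_proj \<nu> q y" d _ d] by simp
  qed
  \<comment> \<open>A representative of each nonempty slice; for an empty slice the choice is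
    arbitrary and only enlarges the cover.\<close>
  define z where "z j = (SOME x. x \<in> S \<and> J x = j)" for j
  have z: "z (J x) \<in> S \<and> J (z (J x)) = J x" if "x \<in> S" for x
    unfolding z_def by (rule someI[of _ x]) (use that in auto)
  define W where "W = (\<Union>j\<in>{..N}. cball (z j) (2 * d))"
  have "S \<subseteq> W"
  proof
    fix x assume "x \<in> S"
    then show "x \<in> W" unfolding W_def
      using J_le close[of "z (J x)" x] z by (intro UN_I[of "J x"]) auto
  qed
  moreover have "W \<in> sets borel" unfolding W_def by auto
  moreover have "emeasure lborel W \<le>
      ennreal (3 * r * unit_ball_vol (real DIM('a)) * 2 ^ DIM('a) * d ^ (DIM('a) - 1))"
  proof -
    have "emeasure lborel W \<le> (\<Sum>j\<in>{..N}. emeasure lborel (cball (z j) (2 * d)))"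
      unfolding W_def by (intro emeasure_subadditive_finite) auto
    also have "\<dots> = ennreal (real (Suc N) * (unit_ball_vol (real DIM('a)) * (2 * d) ^ DIM('a)))"
      using d by (simp add: emeasure_cball ennreal_mult del: of_nat_Suc flip:
        ennreal_of_nat_eq_real_of_nat)
    also have "\<dots> \<le> ennreal ((3 * r / d) * (unit_ball_vol (real DIM('a)) * (2 * d) ^ DIM('a)))"
    proof (intro ennreal_leI mult_right_mono)
      \<comment> \<open>There are at most \<open>2 * r / d + 1\<close> slices, and the 1 is absorbed
        because \<open>d \<le> r\<close>.\<close>
      have "real N \<le> 2 * r / d" unfolding N_def using d assms by (simp add: of_nat_nat)
      moreover have "1 \<le> r / d" using d by simp
      moreover have "3 * r / d = 2 * r / d + r / d" by (simp flip: add_divide_distrib)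
      ultimately show "real (Suc N) \<le> 3 * r / d" by linarith
    qed (use d in auto)
    also have "(3 * r / d) * (unit_ball_vol (real DIM('a)) * (2 * d) ^ DIM('a)) =
        3 * r * unit_ball_vol (real DIM('a)) * 2 ^ DIM('a) * d ^ (DIM('a) - 1)"
    proof -
      have "d ^ DIM('a) = d * d ^ (DIM('a) - 1)"
        by (metis DIM_positive mult.commute power_minus_mult)
      then show ?thesis using d by (simp add: power_mult_distrib)
    qed
    finally show ?thesis .
  qed
  ultimately show ?thesis unfolding S_def d_def by blast
qed

text \<open>The factor from \<open>slab_piece_cover\<close>, rewritten so that
  \<open>d ^ (n - 1)\<close> becomes the Hausdorff weight
  \<open>unit_ball_vol (n - 1) * (d / 2) ^ (n - 1)\<close>.\<close>

definition slab_const :: "nat \<Rightarrow> real" where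
  "slab_const n = 3 * unit_ball_vol (real n) * 2 ^ n * 2 ^ (n - 1) / unit_ball_vol (real (n - 1))"

lemma slab_const_pos: "slab_const n > 0"
  by (simp add: slab_const_def)

text \<open>Each cover of \<open>A\<close> at scale \<open>r\<close> lifts, piece by piece, to a
  measurable cover of the slab, and the premeasure at scale \<open>r\<close> is below the supremum
  over all scales. This one-sided form of Fubini avoids identifying Hausdorff with Lebesgue measure
  on the hyperplane.\<close>

lemma emeasure_slab_le_hausdorff_outer:
  fixes A :: "'a::euclidean_space set"
  assumes "DIM('a) \<ge> 2" "r > 0" "norm \<nu> = 1"
  shows "emeasure lborel {x \<in> cball q r. hyperplane_proj \<nu> q x \<in> A} \<le>
    ennreal (slab_const DIM('a) * r) * hausdorff_outer (DIM('a) - 1) A"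
proof -
  let ?s = "DIM('a) - 1" and ?c = "slab_const DIM('a) * r"
  let ?S = "\<lambda>A. {x \<in> cball q r. hyperplane_proj \<nu> q x \<in> A}"
  let ?w = "\<lambda>U::'a set. if U =
      {} then 0 else ennreal (unit_ball_vol (real ?s) * (diameter U / 2) ^ ?s)"
  have c: "?c > 0" using slab_const_pos[of "DIM('a)"] assms by simp
  have inv: "ennreal (1 / a) * ennreal a = 1" if "a > 0" for a :: real
    using that by (simp flip: ennreal_mult)
  define u where "u = unit_ball_vol (real ?s)"
  have u: "u > 0" unfolding u_def by (rule unit_ball_vol_pos) simp
  \<comment> \<open>The constant is moved to the left so that the infimum over covers stands alone
    on the right; it is moved back at the end.\<close>
  have "ennreal (1 / ?c) * emeasure lborel (?S A) \<le> hausdorff_pre ?s r A"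
    unfolding hausdorff_pre_def
  proof (rule INF_greatest)
    fix U :: "nat \<Rightarrow> 'a set"
    assume "U \<in> {U. A \<subseteq> (\<Union>i. U i) \<and> (\<forall>i. bounded (U i) \<and> diameter (U i) \<le> r)}"
    then have cover: "A \<subseteq> (\<Union>i. U i)" and U: "\<And>i. bounded (U i)" "\<And>i. diameter (U i) \<le> r" by auto
    have "\<exists>W\<in>sets borel. ?S (U i) \<subseteq> W \<and> emeasure lborel W \<le> ennreal ?c * ?w (U i)" for i
    proof (cases "U i = {}")
      case False
      have dim: "3 * r * unit_ball_vol (real DIM('a)) * 2 ^ DIM('a) * diameter (U i) ^ (DIM('a) -
          1) =
          ?c * (unit_ball_vol (real ?s) * (diameter (U i) / 2) ^ ?s)"
        unfolding slab_const_def u_def[symmetric] using u by (simp add: power_divide)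
      show ?thesis
        using slab_piece_cover[OF assms U(1)[of i] U(2)[of i], of q] c False diameter_ge_0[OF
          U(1)[of i]]
        unfolding dim by (simp add: ennreal_mult)
    qed (auto intro!: bexI[of _ "{}"])
    then have "\<forall>i. \<exists>W. W \<in> sets borel \<and> ?S (U i) \<subseteq> W \<and> emeasure lborel W \<le> ennreal ?c * ?w (U i)"
      by blast
    from choice[OF this] obtain W where W: "\<And>i. W i \<in> sets borel" "\<And>i. ?S (U i) \<subseteq> W i"
      "\<And>i. emeasure lborel (W i) \<le> ennreal ?c * ?w (U i)" by blast
    have "?S A \<subseteq> (\<Union>i. W i)"
    proof
      fix x assume x: "x \<in> ?S A"
      then obtain i where "hyperplane_proj \<nu> q x \<in> U i" using cover by blast
      then have "x \<in> ?S (U i)" using x by simp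
      then show "x \<in> (\<Union>i. W i)" using W(2)[of i] by blast
    qed
    then have "emeasure lborel (?S A) \<le> emeasure lborel (\<Union>i. W i)"
      using W(1) by (intro emeasure_mono) auto
    also have "\<dots> \<le> (\<Sum>i. emeasure lborel (W i))"
      using W by (intro emeasure_subadditive_countably) auto
    also have "\<dots> \<le> (\<Sum>i. ennreal ?c * ?w (U i))"
      using W by (intro suminf_le) auto
    also have "\<dots> = ennreal ?c * (\<Sum>i. ?w (U i))" by (rule ennreal_suminf_cmult)
    finally have "ennreal (1 / ?c) * emeasure lborel (?S A) \<le>
        ennreal (1 / ?c) * (ennreal ?c * (\<Sum>i. ?w (U i)))"
      by (rule mult_left_mono) simp
    also have "\<dots> = (\<Sum>i. ?w (U i))"
      by (simp only: mult.assoc[symmetric] inv[OF c] mult_1)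
    finally show "ennreal (1 / ?c) * emeasure lborel (?S A) \<le> (\<Sum>i. ?w (U i))" .
  qed
  also have "\<dots> \<le> hausdorff_outer ?s A"
    unfolding hausdorff_outer_def using assms by (intro SUP_upper) auto
  finally have "ennreal ?c * (ennreal (1 / ?c) * emeasure lborel (?S A)) \<le>
      ennreal ?c * hausdorff_outer ?s A"
    by (rule mult_left_mono) simp
  moreover have "ennreal ?c * ennreal (1 / ?c) = 1" using inv[OF c] by (simp only: mult.commute)
  ultimately show ?thesis by (simp only: mult.assoc[symmetric] mult_1)
qed

section \<open>Surface measure and integrals over a slab\<close>

lemma sets_surface_measure: "sets (surface_measure :: (real^'n) measure) = sets borel"
  using sets.sigma_sets_eq[of "borel :: (real^'n) measure"]
  by (simp add: surface_measure_def hausdorff_measure_def sets_measure_of_conv)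

text \<open>A set of positive measure shows that \<open>measure_of\<close> has not taken its degenerate branch, which
  makes Caratheodory's criterion unnecessary.\<close>

lemma emeasure_surface_measure:
  fixes F A :: "(real^'n) set"
  assumes "emeasure surface_measure F > 0" "A \<in> sets borel"
  shows "emeasure surface_measure A = hausdorff_outer (CARD('n) - 1) A"
proof -
  have sig: "sigma_sets UNIV (sets (borel :: (real^'n) measure)) = sets borel"
    using sets.sigma_sets_eq[of "borel :: (real^'n) measure"] by simp
  have "measure_space UNIV (sets borel) (hausdorff_outer (CARD('n) - 1) :: (real^'n) set \<Rightarrow> ennreal)"
    using assms(1) unfolding surface_measure_def hausdorff_measure_def emeasure_measure_of_conv sig
    by (auto split: if_splits)
  then show ?thesis
    using assms(2) unfolding surface_measure_def hausdorff_measure_def emeasure_measure_of_conv sig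
      by simp
qed

text \<open>The image under the projection of Lebesgue measure on the ball is dominated, on every
  Borel set, by a multiple of surface measure on \<open>F\<close>; domination of measures passes to
  integrals of nonnegative functions.\<close>

lemma slab_integral_le:
  fixes F :: "(real^'n) set" and g :: "real^'n \<Rightarrow> real"
  assumes "CARD('n) \<ge> 2" "r > 0" "norm \<nu> = 1"
    and F: "compact F" "emeasure surface_measure F > 0" "emeasure surface_measure F < \<infinity>"
    and slab: "\<And>x. x \<in> cball q r \<Longrightarrow> hyperplane_proj \<nu> q x \<in> F"
    and g: "continuous_on UNIV g"
  shows "(LINT x:cball q r|lborel. (g (hyperplane_proj \<nu> q x))\<^sup>2) \<le>
    slab_const CARD('n) * r * (LINT x:F|surface_measure. (g x)\<^sup>2)"
proof -
  let ?P = "hyperplane_proj \<nu> q" and ?c = "slab_const CARD('n) * r"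
  have c: "?c > 0" using slab_const_pos[of "CARD('n)"] assms(2) by simp
  have [measurable_cong]: "sets surface_measure = sets (borel :: (real^'n) measure)"
    by (rule sets_surface_measure)
  have F_sets [measurable]: "F \<in> sets borel" using F by (simp add: borel_compact)
  have P_cont: "continuous_on UNIV ?P" unfolding hyperplane_proj_def by (intro continuous_intros)
  then have [measurable]: "?P \<in> borel_measurable borel" by (rule borel_measurable_continuous_onI)
  have gm [measurable]: "g \<in> borel_measurable borel" using g
    by (rule borel_measurable_continuous_onI)
  define M1 where "M1 = distr (density lborel (indicator (cball q r))) borel ?P"
  define M2 where "M2 = density surface_measure (\<lambda>x. ennreal ?c * indicator F x)"
  have sets12: "sets M1 = sets M2" by (simp add: M1_def M2_def sets_surface_measure)
  have "emeasure M1 A \<le> emeasure M2 A" if "A \<in> sets M1" for A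
  proof -
    have [measurable]: "A \<in> sets borel" using that by (simp add: M1_def)
    have "emeasure M1 A = emeasure lborel {x \<in> cball q r. ?P x \<in> A \<inter> F}"
    proof -
      have "emeasure M1 A = emeasure (density lborel (indicator (cball q r))) (?P -` A)"
        unfolding M1_def by (subst emeasure_distr) auto
      also have "\<dots> = emeasure lborel (?P -` A \<inter> cball q r)"
      proof -
        have "?P -` A \<in> sets borel"
          using measurable_sets[of ?P borel borel A] by simp
        then show ?thesis
          by (subst emeasure_density)
            (auto simp: mult_ac Int_commute borel_measurable_indicator simp flip:
              indicator_inter_arith)
      qed
      also have "?P -` A \<inter> cball q r = {x \<in> cball q r. ?P x \<in> A \<inter> F}" using slab by auto
      finally show ?thesis .
    qed
    also have "\<dots> \<le> ennreal ?c * hausdorff_outer (CARD('n) - 1) (A \<inter> F)"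
      using emeasure_slab_le_hausdorff_outer[of r \<nu> q "A \<inter> F"] assms(1-3) by simp
    also have "\<dots> = ennreal ?c * emeasure surface_measure (A \<inter> F)"
      by (subst emeasure_surface_measure[OF F(2)]) auto
    also have "\<dots> = emeasure M2 A"
    proof -
      have "emeasure M2 A = (\<integral>\<^sup>+x. ennreal ?c * indicator (A \<inter> F) x \<partial>surface_measure)"
        unfolding M2_def by (subst emeasure_density)
          (auto intro!: nn_integral_cong split: split_indicator simp: sets_surface_measure)
      then show ?thesis by (simp add: nn_integral_cmult_indicator sets_surface_measure)
    qed
    finally show ?thesis .
  qed
  then have "M1 \<le> M2" using le_measure[OF sets12] by blast
  then have le: "nn_integral M1 (\<lambda>x. ennreal ((g x)\<^sup>2)) \<le> nn_integral M2 (\<lambda>x. ennreal ((g x)\<^sup>2))"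
    using sets12 by (intro nn_integral_mono_measure)
  have "nn_integral M1 (\<lambda>x. ennreal ((g x)\<^sup>2)) =
      (\<integral>\<^sup>+x. ennreal (indicator (cball q r) x *\<^sub>R (g (?P x))\<^sup>2) \<partial>lborel)"
    unfolding M1_def
    by (subst nn_integral_distr, simp, simp, subst nn_integral_density)
      (auto intro!: nn_integral_cong borel_measurable_indicator split: split_indicator)
  also have "\<dots> = ennreal (LINT x:cball q r|lborel. (g (?P x))\<^sup>2)"
    unfolding set_lebesgue_integral_def
  proof (rule nn_integral_eq_integral)
    have "continuous_on UNIV (\<lambda>x. (g (?P x))\<^sup>2)"
      using continuous_on_compose2[OF g P_cont] by (intro continuous_on_power) auto
    then show "integrable lborel (\<lambda>x. indicator (cball q r) x *\<^sub>R (g (?P x))\<^sup>2)"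
      by (rule set_integrable_continuous_lborel[OF compact_cball, unfolded set_integrable_def])
  qed auto
  finally have 1: "nn_integral M1 (\<lambda>x. ennreal ((g x)\<^sup>2)) =
      ennreal (LINT x:cball q r|lborel. (g (?P x))\<^sup>2)" .
  have "nn_integral M2 (\<lambda>x. ennreal ((g x)\<^sup>2)) =
      (\<integral>\<^sup>+x. ennreal ?c * ennreal (indicator F x *\<^sub>R (g x)\<^sup>2) \<partial>surface_measure)"
    unfolding M2_def
    by (subst nn_integral_density)
      (auto intro!: nn_integral_cong split: split_indicator simp: mult_ac)
  also have "\<dots> = ennreal ?c * (\<integral>\<^sup>+x. ennreal (indicator F x *\<^sub>R (g x)\<^sup>2) \<partial>surface_measure)"
    by (rule nn_integral_cmult) measurable
  also have "(\<integral>\<^sup>+x. ennreal (indicator F x *\<^sub>R (g x)\<^sup>2) \<partial>surface_measure) =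
      ennreal (LINT x:F|surface_measure. (g x)\<^sup>2)"
    unfolding set_lebesgue_integral_def
  proof (rule nn_integral_eq_integral)
    have "set_integrable surface_measure F (\<lambda>x. (g x)\<^sup>2)"
      using F g by (intro set_integrable_continuous_finite continuous_on_power)
        (auto simp: sets_surface_measure)
    then show "integrable surface_measure (\<lambda>x. indicator F x *\<^sub>R (g x)\<^sup>2)"
      unfolding set_integrable_def .
  qed auto
  finally have 2: "nn_integral M2 (\<lambda>x. ennreal ((g x)\<^sup>2)) =
      ennreal (?c * (LINT x:F|surface_measure. (g x)\<^sup>2))"
    using c by (simp add: ennreal_mult set_lebesgue_integral_def)
  show ?thesis using le c unfolding 1 2
    by (subst (asm) ennreal_le_iff) (auto simp: set_lebesgue_integral_def)
qed

section \<open>Simplices\<close>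

lemma simplex_vertices:
  fixes K :: "'a::euclidean_space set"
  assumes "int DIM('a) simplex K"
  shows "\<not> affine_dependent (vertices K)" "finite (vertices K)" "card (vertices K) = Suc DIM('a)"
    "K = convex hull (vertices K)" "vertices K \<subseteq> K"
proof -
  obtain C where C: "\<not> affine_dependent C" "int (card C) = int DIM('a) + 1" "K = convex hull C"
    using assms unfolding simplex_def by blast
  have V: "vertices K = C"
    using C by (auto simp: vertices_def extreme_point_of_convex_hull_affine_independent)
  show "\<not> affine_dependent (vertices K)" "finite (vertices K)" "card (vertices K) = Suc DIM('a)"
    "K = convex hull (vertices K)" "vertices K \<subseteq> K"
    unfolding V using C aff_independent_finite[OF C(1)] hull_subset[of C convex] by auto
qed

text \<open>Taken as an affine function on the whole space rather than as a coefficient of a point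
  of \<open>K\<close>, so that it can serve as a polynomial factor of degree 1.\<close>

definition barycentric :: "'a::euclidean_space set \<Rightarrow> 'a \<Rightarrow> 'a \<Rightarrow> real" where
  "barycentric K a = (SOME l. (\<exists>n b. l = (\<lambda>x. x \<bullet> n + b)) \<and>
      (\<forall>v\<in>vertices K. l v = (if v = a then 1 else 0)))"

text \<open>The remaining vertices span a hyperplane that misses \<open>a\<close>; its equation is
  scaled to take the value 1 at \<open>a\<close>.\<close>

lemma barycentric_exists:
  fixes K :: "'a::euclidean_space set"
  assumes K: "int DIM('a) simplex K" and a: "a \<in> vertices K"
  shows "\<exists>l. (\<exists>n b. l = (\<lambda>x. x \<bullet> n + b)) \<and> (\<forall>v\<in>vertices K. l v = (if v = a then 1 else 0))"
proof -
  note V = simplex_vertices[OF K]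
  have indep: "\<not> affine_dependent (vertices K - {a})"
    using V(1) affine_independent_Diff by blast
  have "card (vertices K - {a}) = DIM('a)" using V a by simp
  then have "aff_dim (vertices K - {a}) = int DIM('a) - 1"
    using aff_dim_affine_independent[OF indep] by simp
  then obtain n b where nb: "n \<noteq> 0" "affine hull (vertices K - {a}) = {x. n \<bullet> x = b}"
    using aff_dim_eq_hyperplane[of "vertices K - {a}"] by auto
  have "a \<notin> affine hull (vertices K - {a})" using V(1) a unfolding affine_dependent_def by blast
  then have ne: "n \<bullet> a - b \<noteq> 0" using nb by auto
  have zero: "n \<bullet> v = b" if "v \<in> vertices K - {a}" for v
    using hull_inc[OF that, of affine] nb by auto
  define l where "l = (\<lambda>x. x \<bullet> (n /\<^sub>R (n \<bullet> a - b)) + (- b / (n \<bullet> a - b)))"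
  have l: "l x = (n \<bullet> x - b) / (n \<bullet> a - b)" for x
    by (simp add: l_def inner_commute divide_inverse algebra_simps)
  have "\<forall>v\<in>vertices K. l v = (if v = a then 1 else 0)" using ne zero by (auto simp: l)
  then show ?thesis unfolding l_def by blast
qed

context
  fixes K :: "'a::euclidean_space set"
  assumes K: "int DIM('a) simplex K"
begin

lemma
  assumes "a \<in> vertices K"
  shows barycentric_affine: "\<exists>n b. barycentric K a = (\<lambda>x. x \<bullet> n + b)"
    and barycentric_vertex: "v \<in> vertices K \<Longrightarrow> barycentric K a v = (if v = a then 1 else 0)"
  using someI_ex[OF barycentric_exists[OF K assms], folded barycentric_def] by auto

lemma barycentric_combination:
  assumes "a \<in> vertices K" "(\<Sum>v\<in>vertices K. u v) = 1"
  shows "barycentric K a (\<Sum>v\<in>vertices K. u v *\<^sub>R v) = u a"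
proof -
  obtain n b where nb: "barycentric K a = (\<lambda>x. x \<bullet> n + b)" using barycentric_affine assms by blast
  have "barycentric K a (\<Sum>v\<in>vertices K. u v *\<^sub>R v) = (\<Sum>v\<in>vertices K. u v * (v \<bullet> n)) +
      b * (\<Sum>v\<in>vertices K. u v)"
    using assms(2) by (simp add: nb inner_sum_left)
  also have "\<dots> = (\<Sum>v\<in>vertices K. u v * barycentric K a v)"
    by (simp add: nb sum_distrib_left sum.distrib distrib_left mult.commute)
  also have "\<dots> = (\<Sum>v\<in>vertices K. if v = a then u v else 0)"
    using assms barycentric_vertex by (intro sum.cong) auto
  also have "\<dots> = u a" using assms simplex_vertices[OF K] by simp
  finally show ?thesis .
qed

lemma barycentric_expansion:
  assumes "x \<in> K"
  shows "\<And>a. a \<in> vertices K \<Longrightarrow> barycentric K a x \<ge> 0"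
    "(\<Sum>v\<in>vertices K. barycentric K v x) = 1"
    "x = (\<Sum>v\<in>vertices K. barycentric K v x *\<^sub>R v)"
proof -
  note V = simplex_vertices[OF K]
  have "x \<in> convex hull (vertices K)" using assms V(4) by simp
  then obtain u where u: "\<forall>v\<in>vertices K. 0 \<le> u v" "sum u (vertices K) =
      1" "(\<Sum>v\<in>vertices K. u v *\<^sub>R v) = x"
    unfolding convex_hull_finite[OF V(2)] by blast
  have eq: "barycentric K a x = u a" if "a \<in> vertices K" for a
    using barycentric_combination[OF that u(2)] u(3) by simp
  show "\<And>a. a \<in> vertices K \<Longrightarrow> barycentric K a x \<ge> 0"
    "(\<Sum>v\<in>vertices K. barycentric K v x) = 1"
    "x = (\<Sum>v\<in>vertices K. barycentric K v x *\<^sub>R v)"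
    using u eq by auto
qed

lemma barycentric_le_1:
  assumes "x \<in> K" "a \<in> vertices K"
  shows "barycentric K a x \<le> 1"
  using barycentric_expansion(2)[OF assms(1)] barycentric_expansion(1)[OF assms(1)]
    member_le_sum[of a "vertices K" "\<lambda>v. barycentric K v x"] assms(2) simplex_vertices(2)[OF K]
      by auto

text \<open>Moving from \<open>y\<close> directly away from \<open>a\<close> by
  \<open>\<rho> / 2\<close> times their difference stays in \<open>K\<close>, because
  \<open>y\<close> has distance \<open>r / 2\<close> to spare. The affine coordinate of
  \<open>a\<close> drops on the way and is still nonnegative at the end.\<close>

lemma barycentric_lower_bound:
  assumes a: "a \<in> vertices K" and "0 < \<rho>" "\<rho> \<le> 1" "\<rho> * diameter K \<le> r" "cball x0 r \<subseteq> K"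
    and y: "y \<in> cball x0 (r / 2)" and "r > 0"
  shows "barycentric K a y \<ge> \<rho> / 4"
proof -
  note V = simplex_vertices[OF K]
  have bnd: "bounded K" using compact_simplex[OF K] by (rule compact_imp_bounded)
  obtain n b where nb: "barycentric K a = (\<lambda>x. x \<bullet> n + b)" using barycentric_affine a by blast
  have yK: "y \<in> K" using assms by auto
  define w where "w = y + (\<rho> / 2) *\<^sub>R (y - a)"
  have "norm ((\<rho> / 2) *\<^sub>R (y - a)) \<le> (\<rho> / 2) * diameter K"
    using diameter_bounded_bound[OF bnd yK, of a] a V \<open>0 < \<rho>\<close> by (auto simp: dist_norm)
  also have "\<dots> \<le> r / 2" using assms by simp
  finally have "w \<in> cball x0 r"
    using y norm_triangle_mono[of "y - x0" "r / 2" "(\<rho> / 2) *\<^sub>R (y - a)" "r / 2"]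
    by (simp add: w_def dist_norm norm_minus_commute algebra_simps)
  then have "0 \<le> barycentric K a w" using assms barycentric_expansion(1) by blast
  also have "barycentric K a w = barycentric K a y +
      (\<rho> / 2) * (barycentric K a y - barycentric K a a)"
    by (simp add: nb w_def inner_add_left inner_diff_left)
  also have "barycentric K a a = 1" using barycentric_vertex a by auto
  finally have "\<rho> / 2 \<le> barycentric K a y * (1 + \<rho> / 2)" by (simp add: algebra_simps)
  also have "\<dots> \<le> barycentric K a y * 2"
    using assms barycentric_expansion(1)[OF yK a] by (intro mult_left_mono) auto
  finally show ?thesis by simp
qed

text \<open>The inscribed ball gives \<open>K\<close> width at least \<open>2 * r\<close> in the
  direction of \<open>v\<close>, and a linear functional attains its extremes over a simplex at
  vertices.\<close>

lemma exists_long_edge: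
  assumes "cball x0 r \<subseteq> K" "r > 0"
  shows "\<exists>a\<in>vertices K. \<exists>b\<in>vertices K. (a - b) \<bullet> v \<ge> 2 * r * norm v"
proof (cases "v = 0")
  case True
  have "vertices K \<noteq> {}" using simplex_vertices(3)[OF K] by auto
  then show ?thesis using True by auto
next
  case False
  define e where "e = (r / norm v) *\<^sub>R v"
  have "norm e = r" using assms False by (simp add: e_def)
  then have pm: "x0 + e \<in> K" "x0 - e \<in> K" using assms(1) by (auto simp: dist_norm subset_iff)
  have ev: "e \<bullet> v = r * norm v" using False by (simp add: e_def dot_square_norm power2_eq_square)
  have "\<exists>a\<in>vertices K. a \<bullet> w \<ge> p \<bullet> w" if "p \<in> K" for p w
  proof (rule ccontr)
    assume "\<not> ?thesis"
    then have "vertices K \<subseteq> {x. w \<bullet> x < p \<bullet> w}" by (auto simp: inner_commute not_le)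
    then have "convex hull vertices K \<subseteq> {x. w \<bullet> x < p \<bullet> w}"
      by (intro hull_minimal convex_halfspace_lt)
    then show False using that simplex_vertices(4)[OF K] by (auto simp: inner_commute)
  qed
  note * = this
  obtain a where a: "a \<in> vertices K" "a \<bullet> v \<ge> (x0 + e) \<bullet> v" using *[OF pm(1)] by blast
  obtain b where b: "b \<in> vertices K" "b \<bullet> (- v) \<ge> (x0 - e) \<bullet> (- v)" using *[OF pm(2)] by blast
  have "(a - b) \<bullet> v \<ge> 2 * r * norm v" using a b ev by (simp add: inner_diff_left inner_add_left)
  then show ?thesis using a b by blast
qed

section \<open>Faces of a simplex and their opposite vertices\<close>

lemma element_face_opposite_vertex:
  assumes "F \<in> element_faces K"
  shows "\<exists>a\<in>vertices K. F = convex hull (vertices K - {a})"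
proof -
  note V = simplex_vertices[OF K]
  obtain A where A: "F = convex hull A" "A \<subseteq> vertices K" "card A = DIM('a)"
    using assms by (auto simp: element_faces_def)
  have "card (vertices K - A) = 1" using A V by (simp add: card_Diff_subset finite_subset[OF A(2)])
  then obtain a where "vertices K - A = {a}" by (auto simp: card_1_singleton_iff)
  then have "a \<in> vertices K" "A = vertices K - {a}" using A by auto
  then show ?thesis using A by auto
qed

text \<open>The vertex opposite to \<open>F\<close> is not on \<open>F\<close> but belongs to every
  other face of \<open>K\<close>.\<close>

lemma element_face_subset_eq:
  assumes "F \<in> element_faces K" "F' \<in> element_faces K" "F' \<subseteq> F"
  shows "F' = F"
proof -
  note V = simplex_vertices[OF K]
  obtain a where a: "a \<in> vertices K" "F = convex hull (vertices K - {a})"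
    using element_face_opposite_vertex[OF assms(1)] by blast
  obtain b where b: "b \<in> vertices K" "F' = convex hull (vertices K - {b})"
    using element_face_opposite_vertex[OF assms(2)] by blast
  have "a \<notin> F"
  proof
    assume "a \<in> F"
    moreover have "F \<subseteq> affine hull (vertices K - {a})" using a convex_hull_subset_affine_hull
      by blast
    ultimately show False using V(1) a(1) unfolding affine_dependent_def by blast
  qed
  moreover have "vertices K - {b} \<subseteq> F'" using hull_subset[of "vertices K - {b}" convex] b(2) by simp
  ultimately have "a = b" using assms(3) a(1) by auto
  then show ?thesis using a b by simp
qed

lemma element_face_subset: "F \<in> element_faces K \<Longrightarrow> F \<subseteq> K"
  using element_face_opposite_vertex[of F] simplex_vertices(4)[OF K]
  by (metis Diff_subset hull_mono)

text \<open>All subsets of the vertices are counted, since only dependence on the dimension matters.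
  The same factor \<open>2 ^ Suc n\<close> recurs in \<open>trace_const\<close> and
  \<open>reg_const\<close>.\<close>

lemma finite_element_faces: "finite (element_faces K)"
  and card_element_faces_le: "card (element_faces K) \<le> 2 ^ Suc DIM('a)"
proof -
  note V = simplex_vertices[OF K]
  have sub: "element_faces K \<subseteq> (\<lambda>A. convex hull A) ` Pow (vertices K)"
    by (auto simp: element_faces_def)
  then show "finite (element_faces K)" using V finite_subset by blast
  have "card (element_faces K) \<le> card ((\<lambda>A. convex hull A) ` Pow (vertices K))"
    using V sub by (intro card_mono) auto
  also have "\<dots> \<le> card (Pow (vertices K))" using V by (intro card_image_le) auto
  finally show "card (element_faces K) \<le> 2 ^ Suc DIM('a)" using V by (simp add: card_Pow)
qed

lemma convex_element_face:
  assumes "F \<in> element_faces K" shows "convex F" "compact F"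
  using element_face_opposite_vertex[OF assms] simplex_vertices(2)[OF K]
  by (auto intro!: finite_imp_compact_convex_hull)

text \<open>Central projection from the opposite vertex does not shrink discs parallel to the face.\<close>

lemma element_face_contains_disc:
  assumes F: "F \<in> element_faces K" and ball: "cball x0 r \<subseteq> K" "r > 0"
  shows "\<exists>q \<nu>. norm \<nu> = 1 \<and> q \<in> F \<and> (\<forall>x\<in>F. (x - q) \<bullet> \<nu> = 0) \<and>
    (\<forall>z. z \<bullet> \<nu> = 0 \<longrightarrow> norm z \<le> r \<longrightarrow> q + z \<in> F)"
proof -
  note V = simplex_vertices[OF K]
  obtain a where a: "a \<in> vertices K" "F = convex hull (vertices K - {a})"
    using element_face_opposite_vertex[OF F] by blast
  obtain n b where nb: "barycentric K a = (\<lambda>x. x \<bullet> n + b)" using barycentric_affine a by blast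
  have n: "n \<noteq> 0"
  proof
    assume "n = 0"
    then have "barycentric K a x = b" for x by (simp add: nb)
    then have "\<And>v. v \<in> vertices K \<Longrightarrow> v = a" using barycentric_vertex a(1) by (metis zero_neq_one)
    then have "vertices K = {a}" using a(1) by blast
    then have "card (vertices K) = 1" by simp
    then show False using V(3) by simp
  qed
  define \<nu> where "\<nu> = n /\<^sub>R norm n"
  have \<nu>: "norm \<nu> = 1" "n = norm n *\<^sub>R \<nu>" using n by (auto simp: \<nu>_def)
  have \<nu>n: "\<nu> \<bullet> n = norm n" using n by (simp add: \<nu>_def dot_square_norm power2_eq_square)
  define u where "u = barycentric K a x0"
  \<comment> \<open>Along \<open>\<nu>\<close> the coordinate of \<open>a\<close> grows strictly and
    never exceeds 1 in \<open>K\<close>, so it is below 1 at the centre and division by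
    \<open>1 - u\<close> is legitimate.\<close>
  have "x0 + r *\<^sub>R \<nu> \<in> K" using ball \<nu> by (auto simp: dist_norm subset_iff)
  then have "barycentric K a (x0 + r *\<^sub>R \<nu>) \<le> 1" using a(1) by (rule barycentric_le_1)
  moreover have "barycentric K a (x0 + r *\<^sub>R \<nu>) = u + r * norm n"
    by (simp add: u_def nb inner_add_left \<nu>n)
  ultimately have u1: "u < 1" using mult_pos_pos[OF ball(2), of "norm n"] n by simp
  have x0K: "x0 \<in> K" using ball by auto
  have u0: "u \<ge> 0" unfolding u_def using barycentric_expansion(1)[OF x0K a(1)] .
  \<comment> \<open>The image of the centre under the central projection from
    \<open>a\<close>.\<close>
  define q where "q = (1 / (1 - u)) *\<^sub>R (x0 - u *\<^sub>R a)"
  have disc: "q + z \<in> F" if z: "z \<bullet> \<nu> = 0" "norm z \<le> r" for z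
  proof -
    \<comment> \<open>The preimage of \<open>q + z\<close> at the level of \<open>x0\<close>. The
      factor \<open>1 - u\<close> is at most 1, which keeps \<open>y\<close> in the ball.\<close>
    define y where "y = x0 + (1 - u) *\<^sub>R z"
    have "norm ((1 - u) *\<^sub>R z) \<le> r"
      using z(2) u0 u1 mult_left_le_one_le[of "norm z" "1 - u"] by simp
    then have "y \<in> K" using ball(1) by (auto simp: y_def dist_norm subset_iff)
    note ex = barycentric_expansion[OF this]
    have "z \<bullet> n = 0" using z(1) \<nu>(2) by (metis inner_scaleR_right mult_zero_right)
    then have yu: "barycentric K a y = u" by (simp add: nb y_def u_def inner_add_left)
    define w where "w v = barycentric K v y / (1 - u)" for v
    have sum1: "(\<Sum>v\<in>vertices K - {a}. barycentric K v y) = 1 - u"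
      using ex(2) yu a(1) V(2) by (simp add: sum_diff1)
    have "y - u *\<^sub>R a = (\<Sum>v\<in>vertices K - {a}. barycentric K v y *\<^sub>R v)"
    proof -
      have "(\<Sum>v\<in>vertices K - {a}. barycentric K v y *\<^sub>R v) =
          (\<Sum>v\<in>vertices K. barycentric K v y *\<^sub>R v) - barycentric K a y *\<^sub>R a"
        using a(1) V(2) by (simp add: sum_diff1)
      then show ?thesis unfolding ex(3)[symmetric] yu ..
    qed
    moreover have "q + z = (1 / (1 - u)) *\<^sub>R (y - u *\<^sub>R a)"
    proof -
      have "y - u *\<^sub>R a = (x0 - u *\<^sub>R a) + (1 - u) *\<^sub>R z" by (simp add: y_def)
      then show ?thesis using u1 by (simp only: scaleR_add_right q_def) simp
    qed
    ultimately have "q + z = (\<Sum>v\<in>vertices K - {a}. w v *\<^sub>R v)"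
      by (simp add: w_def scaleR_sum_right divide_inverse mult.commute)
    moreover have "(\<Sum>v\<in>vertices K - {a}. w v) = 1"
      using sum1 u1 by (simp add: w_def flip: sum_divide_distrib)
    moreover have "\<forall>v\<in>vertices K - {a}. w v \<ge> 0" using ex(1) u1 by (auto simp: w_def)
    ultimately show ?thesis unfolding a(2) using V(2)
      by (subst convex_hull_finite) (auto intro!: exI[of _ w])
  qed
  have "q \<in> F" using disc[of 0] ball(2) by simp
  have zero: "barycentric K a x = 0" if "x \<in> F" for x
  proof -
    have "vertices K - {a} \<subseteq> {x. n \<bullet> x = - b}"
    proof
      fix v assume "v \<in> vertices K - {a}"
      then have "barycentric K a v = 0" using barycentric_vertex[OF a(1)] by auto
      then show "v \<in> {x. n \<bullet> x = - b}" by (simp add: nb inner_commute)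
    qed
    then have "F \<subseteq> {x. n \<bullet> x = - b}" unfolding a(2) by (intro hull_minimal convex_hyperplane)
    then show ?thesis using that by (auto simp: nb inner_commute)
  qed
  have "(x - q) \<bullet> \<nu> = 0" if "x \<in> F" for x
    using zero[OF that] zero[OF \<open>q \<in> F\<close>] by (simp add: nb \<nu>_def inner_diff_left)
  then show ?thesis using \<nu>(1) \<open>q \<in> F\<close> disc by blast
qed

text \<open>\<open>K\<close> lies between the parallel hyperplanes through \<open>a\<close> and
  through the opposite face, and so does the inscribed ball. This bounds the normal component of
  \<open>x - a\<close> on the face from below.\<close>

lemma inscribed_radius_le_height:
  assumes ball: "cball x0 r \<subseteq> K" "r > 0" and a: "a \<in> vertices K"
    and f: "f \<in> convex hull (vertices K - {a})"
    and out: "outward_unit_normal \<nu> K (convex hull (vertices K - {a}))"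
  shows "r \<le> (f - a) \<bullet> \<nu>"
proof -
  let ?F = "convex hull (vertices K - {a})"
  note V = simplex_vertices[OF K]
  have \<nu>: "norm \<nu> = 1" "\<And>x y. x \<in> ?F \<Longrightarrow> y \<in> K \<Longrightarrow> (y - x) \<bullet> \<nu> \<le> 0"
    using out by (auto simp: outward_unit_normal_def)
  have FK: "?F \<subseteq> K" using V(4) hull_mono[of "vertices K - {a}" "vertices K" convex] by auto
  have "(f - a) \<bullet> \<nu> \<ge> 0" using \<nu>(2)[OF f, of a] a V by (auto simp: inner_diff_left)
  have "(v - a) \<bullet> \<nu> \<ge> 0" if "v \<in> vertices K" for v
  proof (cases "v = a")
    case False
    then have "v \<in> ?F" using that hull_inc by (metis Diff_iff empty_iff insert_iff)
    then have "(f - v) \<bullet> \<nu> \<le> 0" using \<nu>(2)[of v f] f FK by auto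
    then show ?thesis using \<open>(f - a) \<bullet> \<nu> \<ge> 0\<close> by (simp add: inner_diff_left)
  qed simp
  then have "vertices K \<subseteq> {x. \<nu> \<bullet> x \<ge> a \<bullet> \<nu>}" by (auto simp: inner_diff_right inner_commute)
  then have "convex hull vertices K \<subseteq> {x. \<nu> \<bullet> x \<ge> a \<bullet> \<nu>}"
    by (intro hull_minimal convex_halfspace_ge)
  moreover have "x0 - r *\<^sub>R \<nu> \<in> K" using ball \<nu>(1) by (auto simp: dist_norm subset_iff)
  ultimately have "\<nu> \<bullet> (x0 - r *\<^sub>R \<nu>) \<ge> a \<bullet> \<nu>" using V(4) by auto
  then have 1: "x0 \<bullet> \<nu> - r \<ge> a \<bullet> \<nu>" using \<nu>(1)
    by (simp add: inner_diff_right inner_commute dot_square_norm)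
  have "x0 \<in> K" using ball by auto
  then have "x0 \<bullet> \<nu> \<le> f \<bullet> \<nu>" using \<nu>(2)[OF f, of x0] by (simp add: inner_diff_left)
  then show ?thesis using 1 ball(2) by (simp add: inner_diff_left)
qed

text \<open>\<open>x\<close> maximises the functional given by \<open>\<nu>\<close> over
  \<open>K\<close>, and it is a convex combination of vertices; hence every vertex with positive
  weight attains the same maximum. Nothing forces \<open>F\<close> to be a full face of
  \<open>K\<close>, so faces at hanging nodes are covered.\<close>

lemma outward_normal_orthogonal_edge:
  assumes out: "outward_unit_normal \<nu> K F" and x: "x \<in> F" "x \<in> K" and a: "a \<in> vertices K"
    and pos: "barycentric K a x \<noteq> 0"
  shows "(x - a) \<bullet> \<nu> = 0"
proof -
  note V = simplex_vertices[OF K]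
  note ex = barycentric_expansion[OF x(2)]
  have le: "(v - x) \<bullet> \<nu> \<le> 0" if "v \<in> vertices K" for v
    using out x V that by (auto simp: outward_unit_normal_def)
  have "(\<Sum>v\<in>vertices K. barycentric K v x * ((x - v) \<bullet> \<nu>)) =
      (\<Sum>v\<in>vertices K. barycentric K v x) * (x \<bullet> \<nu>) - (\<Sum>v\<in>vertices K. barycentric K v x *\<^sub>R v) \<bullet> \<nu>"
    by (simp add: inner_diff_left algebra_simps sum_subtractf inner_sum_left sum_distrib_left
      sum_distrib_right)
  also have "\<dots> = 0" using ex(2) ex(3)[symmetric] by simp
  finally have "(\<Sum>v\<in>vertices K. barycentric K v x * ((x - v) \<bullet> \<nu>)) = 0" .
  moreover have "barycentric K v x * ((x - v) \<bullet> \<nu>) \<ge> 0" if "v \<in> vertices K" for v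
    using ex(1)[OF that] le[OF that] by (auto simp: inner_diff_left)
  ultimately have "barycentric K a x * ((x - a) \<bullet> \<nu>) = 0"
    using a V(2) by (subst (asm) sum_nonneg_eq_0_iff) auto
  then show ?thesis using pos by simp
qed

lemma barycentric_zero_imp_opposite_face:
  assumes "x \<in> K" "a \<in> vertices K" "barycentric K a x = 0"
  shows "x \<in> convex hull (vertices K - {a})"
proof -
  note V = simplex_vertices[OF K]
  note ex = barycentric_expansion[OF assms(1)]
  have "(\<Sum>v\<in>vertices K - {a}. barycentric K v x) = 1"
    using ex(2) assms V(2) by (simp add: sum_diff1)
  moreover have "(\<Sum>v\<in>vertices K - {a}. barycentric K v x *\<^sub>R v) = x"
    using ex(3) assms V(2) by (simp add: sum_diff1)
  ultimately show ?thesis using V(2) ex(1)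
    by (subst convex_hull_finite) (auto intro!: exI[of _ "\<lambda>v. barycentric K v x"])
qed

end

section \<open>Half balls over a disc, and their overlap\<close>

lemma half_ball_subset:
  fixes K :: "'a::euclidean_space set"
  assumes "convex K" and disc: "\<And>z. z \<bullet> \<nu> = 0 \<Longrightarrow> norm z \<le> \<rho> \<Longrightarrow> q + z \<in> K" and "\<rho> > 0" "norm \<nu> = 1"
    and p: "p \<in> K" "(p - q) \<bullet> \<nu> > 0"
  shows "\<exists>\<epsilon>>0. \<forall>x. norm (x - q) < \<epsilon> \<longrightarrow> (x - q) \<bullet> \<nu> \<ge> 0 \<longrightarrow> x \<in> K"
proof -
  define m where "m = (p - q) \<bullet> \<nu>"
  \<comment> \<open>Chosen so that \<open>\<epsilon> * L\<close> bounds the part of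
    \<open>x - q\<close> left after subtracting a multiple of \<open>p - q\<close>; the bound
    \<open>\<epsilon> \<le> m / 2\<close> keeps \<open>s\<close> below 1 / 2 and costs another
    factor 2.\<close>
  define L where "L = 1 + norm (p - q) / m"
  have m: "m > 0" using p by (simp add: m_def)
  have L: "L > 0" using m by (auto simp: L_def intro: add_pos_nonneg)
  define \<epsilon> where "\<epsilon> = min (m / 2) (\<rho> / (2 * L))"
  have \<epsilon>: "\<epsilon> > 0" "\<epsilon> \<le> m / 2" "\<epsilon> * (2 * L) \<le> \<rho>"
    using m L \<open>\<rho> > 0\<close> by (auto simp: \<epsilon>_def min_def field_simps)
  have "x \<in> K" if x: "norm (x - q) < \<epsilon>" "(x - q) \<bullet> \<nu> \<ge> 0" for x
  proof -
    \<comment> \<open>The share of \<open>p\<close> is fixed by the height of \<open>x\<close> over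
      the disc; the remaining share then goes to a point \<open>q + z\<close> of the disc
      itself.\<close>
    define s where "s = (x - q) \<bullet> \<nu> / m"
    have "(x - q) \<bullet> \<nu> \<le> norm (x - q)" using Cauchy_Schwarz_ineq2[of "x - q" \<nu>] \<open>norm \<nu> = 1\<close> by auto
    then have xe: "(x - q) \<bullet> \<nu> \<le> \<epsilon>" using x by simp
    have s: "0 \<le> s" "s \<le> 1 / 2" "s \<le> \<epsilon> / m" using m x xe \<epsilon> by (auto simp: s_def field_simps)
    define z where "z = (1 / (1 - s)) *\<^sub>R ((x - q) - s *\<^sub>R (p - q))"
    have "z \<bullet> \<nu> = 0" using m by (simp add: z_def inner_diff_left[of "x - q"] s_def flip: m_def)
    moreover have "norm z \<le> \<rho>"
    proof -
      have "norm ((x - q) - s *\<^sub>R (p - q)) \<le> norm (x - q) + s * norm (p - q)"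
        using norm_triangle_ineq4[of "x - q" "s *\<^sub>R (p - q)"] s by simp
      also have "\<dots> \<le> \<epsilon> + \<epsilon> / m * norm (p - q)" using x s by (intro add_mono mult_right_mono) auto
      also have "\<dots> = \<epsilon> * L" by (simp add: L_def algebra_simps)
      finally have *: "norm ((x - q) - s *\<^sub>R (p - q)) \<le> \<epsilon> * L" .
      have "norm z = norm ((x - q) - s *\<^sub>R (p - q)) / (1 - s)" using s by (simp add: z_def)
      also have "\<dots> \<le> \<epsilon> * L / (1 / 2)"
        using * s \<epsilon>(1) L by (intro frac_le) auto
      also have "\<dots> \<le> \<rho>" using \<epsilon>(3) by simp
      finally show ?thesis .
    qed
    ultimately have "q + z \<in> K" by (rule disc)
    moreover have "x = s *\<^sub>R p + (1 - s) *\<^sub>R (q + z)"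
    proof -
      have "(1 - s) *\<^sub>R z = (x - q) - s *\<^sub>R (p - q)" using s by (simp add: z_def)
      then show ?thesis by (simp add: algebra_simps)
    qed
    ultimately show ?thesis using convexD[OF \<open>convex K\<close> p(1), of "q + z" s "1 - s"] s by simp
  qed
  then show ?thesis using \<epsilon>(1) by blast
qed

section \<open>Meshes\<close>

lemma exists_norm_eq:
  assumes "c \<ge> 0" shows "\<exists>x::'a::euclidean_space. norm x = c"
proof -
  obtain b :: 'a where "b \<in> Basis" using nonempty_Basis by blast
  then show ?thesis using assms by (intro exI[of _ "c *\<^sub>R b"]) simp
qed

lemma exists_point_off_hyperplane:
  fixes K :: "'a::euclidean_space set"
  assumes "cball x0 r \<subseteq> K" "r > 0" "norm \<nu> = 1"
  shows "\<exists>p\<in>K. (p - q) \<bullet> \<nu> \<noteq> 0"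
proof -
  have "x0 \<in> K" "x0 + r *\<^sub>R \<nu> \<in> K" using assms by (auto simp: dist_norm subset_iff)
  moreover have "(x0 + r *\<^sub>R \<nu> - q) \<bullet> \<nu> = (x0 - q) \<bullet> \<nu> + r"
    using assms(3) by (simp add: inner_add_left inner_diff_left dot_square_norm)
  ultimately show ?thesis using assms(2) by (metis add.left_neutral less_irrefl)
qed

text \<open>Both sets contain a half ball over the common disc on the same side. For elements with
  disjoint interiors this leaves at most one element on each side of a face.\<close>

lemma same_side_overlap:
  fixes K1 K2 :: "'a::euclidean_space set"
  assumes "convex K1" "convex K2" "\<epsilon> > 0" "norm \<nu> = 1"
    and "\<And>z. z \<bullet> \<nu> = 0 \<Longrightarrow> norm z \<le> \<epsilon> \<Longrightarrow> q + z \<in> K1 \<inter> K2"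
    and "p1 \<in> K1" "(p1 - q) \<bullet> \<nu> > 0" "p2 \<in> K2" "(p2 - q) \<bullet> \<nu> > 0"
  shows "interior K1 \<inter> interior K2 \<noteq> {}"
proof -
  obtain e1 where e1: "e1 > 0" "\<And>x. norm (x - q) < e1 \<Longrightarrow> (x - q) \<bullet> \<nu> \<ge> 0 \<Longrightarrow> x \<in> K1"
    using half_ball_subset[of K1 \<nu> \<epsilon> q p1] assms by blast
  obtain e2 where e2: "e2 > 0" "\<And>x. norm (x - q) < e2 \<Longrightarrow> (x - q) \<bullet> \<nu> \<ge> 0 \<Longrightarrow> x \<in> K2"
    using half_ball_subset[of K2 \<nu> \<epsilon> q p2] assms by blast
  define e where "e = min e1 e2"
  define U where "U = ball q e \<inter> {x. \<nu> \<bullet> x > \<nu> \<bullet> q}"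
  have "open U" unfolding U_def by (intro open_Int open_ball open_halfspace_gt)
  moreover have "U \<subseteq> K1 \<inter> K2"
  proof
    fix x assume "x \<in> U"
    then have "norm (x - q) < e1" "norm (x - q) < e2" "(x - q) \<bullet> \<nu> \<ge> 0"
      by (auto simp: U_def e_def dist_norm norm_minus_commute inner_diff_right inner_commute)
    then show "x \<in> K1 \<inter> K2" using e1(2) e2(2) by blast
  qed
  ultimately have "U \<subseteq> interior K1 \<inter> interior K2" by (simp add: interior_maximal)
  moreover have "q + (e / 2) *\<^sub>R \<nu> \<in> U"
    using e1(1) e2(1) assms(4) by (auto simp: U_def e_def dist_norm inner_add_right dot_square_norm)
  ultimately show ?thesis by blast
qed

text \<open>The two half balls over the common disc fill a whole ball. A face with elements on both
  sides therefore meets the interior of their union.\<close>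

lemma opposite_sides_interior:
  fixes K1 K2 :: "'a::euclidean_space set"
  assumes "convex K1" "convex K2" "\<epsilon> > 0" "norm \<nu> = 1"
    and "\<And>z. z \<bullet> \<nu> = 0 \<Longrightarrow> norm z \<le> \<epsilon> \<Longrightarrow> q + z \<in> K1 \<inter> K2"
    and "p1 \<in> K1" "(p1 - q) \<bullet> \<nu> > 0" "p2 \<in> K2" "(p2 - q) \<bullet> \<nu> < 0"
  shows "q \<in> interior (K1 \<union> K2)"
proof -
  obtain e1 where e1: "e1 > 0" "\<And>x. norm (x - q) < e1 \<Longrightarrow> (x - q) \<bullet> \<nu> \<ge> 0 \<Longrightarrow> x \<in> K1"
    using half_ball_subset[of K1 \<nu> \<epsilon> q p1] assms by blast
  obtain e2 where e2: "e2 > 0" "\<And>x. norm (x - q) < e2 \<Longrightarrow> (x - q) \<bullet> (- \<nu>) \<ge> 0 \<Longrightarrow> x \<in> K2"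
    using half_ball_subset[of K2 "- \<nu>" \<epsilon> q p2] assms by auto
  have "ball q (min e1 e2) \<subseteq> K1 \<union> K2"
  proof
    fix x assume "x \<in> ball q (min e1 e2)"
    then have "norm (x - q) < e1" "norm (x - q) < e2" by (auto simp: dist_norm norm_minus_commute)
    then show "x \<in> K1 \<union> K2" using e1(2)[of x] e2(2)[of x] by (cases "(x - q) \<bullet> \<nu> \<ge> 0") auto
  qed
  then show ?thesis using e1(1) e2(1)
    by (meson centre_in_ball interior_maximal min_less_iff_conj open_ball subsetD)
qed

text \<open>Arbitrarily close to a boundary point there are points strictly below the graph, and
  these form an open set that misses \<open>\<Omega>\<close>; so the boundary point is not interior
  to the closure. This fails for domains with slits.\<close>

lemma lipschitz_boundary_interior_closure:
  fixes \<Omega> :: "'a::euclidean_space set"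
  assumes "open \<Omega>" "lipschitz_boundary \<Omega>"
  shows "interior (closure \<Omega>) = \<Omega>"
proof -
  have "x \<notin> interior (closure \<Omega>)" if x: "x \<in> frontier \<Omega>" for x
  proof
    assume xi: "x \<in> interior (closure \<Omega>)"
    from bspec[OF assms(2)[unfolded lipschitz_boundary_def] x] obtain U e L and \<gamma> :: "'a \<Rightarrow> real"
      where
      U: "open U" "x \<in> U" and e: "norm e = 1" and lip: "L-lipschitz_on {y. y \<bullet> e = 0} \<gamma>"
      and epi: "\<Omega> \<inter> U = {y \<in> U. \<gamma> (y - (y \<bullet> e) *\<^sub>R e) < y \<bullet> e}"
      by blast
    define P where "P y = y - (y \<bullet> e) *\<^sub>R e" for y
    have epi': "y \<in> \<Omega> \<longleftrightarrow> \<gamma> (P y) < y \<bullet> e" if "y \<in> U" for y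
    proof -
      have "y \<in> \<Omega> \<inter> U \<longleftrightarrow> y \<in> U \<and> \<gamma> (P y) < y \<bullet> e" unfolding epi P_def by simp
      then show ?thesis using that by simp
    qed
    have P0: "P y \<bullet> e = 0" for y using e by (simp add: P_def inner_diff_left dot_square_norm)
    have "continuous_on UNIV P" unfolding P_def by (intro continuous_intros)
    then have \<gamma>P: "continuous_on UNIV (\<lambda>y. \<gamma> (P y))"
      using lipschitz_on_continuous_on[OF lip] P0 by (auto intro: continuous_on_compose2)
    have "open (U \<inter> interior (closure \<Omega>))" using U by auto
    then obtain \<delta> where \<delta>: "\<delta> > 0" "ball x \<delta> \<subseteq> U \<inter> interior (closure \<Omega>)"
      using U xi by (meson IntI open_contains_ball)
    \<comment> \<open>Moving against \<open>e\<close> leaves the foot point \<open>P\<close>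
      unchanged, so the height drops strictly below the graph.\<close>
    define y where "y = x - (\<delta> / 2) *\<^sub>R e"
    have yb: "y \<in> ball x \<delta>" using \<delta> e by (simp add: y_def dist_norm)
    have "x \<notin> \<Omega>" using x assms(1) by (simp add: frontier_def interior_open)
    then have "x \<bullet> e \<le> \<gamma> (P x)" using epi'[OF U(2)] by simp
    moreover have "P y = P x" using e
      by (simp add: P_def y_def inner_diff_left dot_square_norm algebra_simps)
    moreover have "y \<bullet> e = x \<bullet> e - \<delta> / 2" using e
      by (simp add: y_def inner_diff_left dot_square_norm)
    ultimately have lt: "y \<bullet> e < \<gamma> (P y)" using \<delta>(1) by simp
    define W where "W = U \<inter> {z. z \<bullet> e < \<gamma> (P z)}"
    have "open {z. z \<bullet> e < \<gamma> (P z)}" using \<gamma>P by (intro open_Collect_less continuous_intros)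
    then have "open W" unfolding W_def using U(1) by auto
    moreover have "W \<inter> \<Omega> = {}" using epi' by (fastforce simp: W_def)
    ultimately have "W \<inter> closure \<Omega> = {}" by (simp add: open_Int_closure_eq_empty)
    moreover have "y \<in> W" using lt yb \<delta>(2) by (auto simp: W_def)
    moreover have "y \<in> closure \<Omega>" using yb \<delta>(2) interior_subset by blast
    ultimately show False by blast
  qed
  then have "interior (closure \<Omega>) \<inter> frontier \<Omega> = {}" by blast
  then have "interior (closure \<Omega>) \<subseteq> \<Omega>"
    using assms(1) interior_subset[of "closure \<Omega>"] by (auto simp: frontier_def interior_open)
  moreover have "\<Omega> \<subseteq> interior (closure \<Omega>)" using interior_maximal[OF closure_subset assms(1)] .
  ultimately show ?thesis by blast
qed

lemma simplex_interior:
  fixes K :: "'a::euclidean_space set"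
  assumes "int DIM('a) simplex K"
  shows "interior K \<noteq> {}" "closure (interior K) = K"
proof -
  have conv: "convex K" using assms by (rule convex_simplex)
  have "aff_dim K = int DIM('a)" using aff_dim_simplex[OF assms] .
  then have "affine hull K = UNIV" by (simp add: aff_dim_eq_full)
  then have "rel_interior K = interior K" by (rule rel_interior_interior)
  moreover have "K \<noteq> {}" using \<open>aff_dim K = int DIM('a)\<close> by auto
  ultimately show ne: "interior K \<noteq> {}" using rel_interior_eq_empty[OF conv] by simp
  show "closure (interior K) = K"
    using convex_closure_interior[OF conv ne] closed_simplex[OF assms] by simp
qed

lemma open_disjoint_element:
  fixes K :: "'a::euclidean_space set"
  assumes "int DIM('a) simplex K" "open U" "U \<inter> interior K = {}"
  shows "U \<inter> K = {}"
  using open_Int_closure_eq_empty[OF assms(2), of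
    "interior K", unfolded simplex_interior(2)[OF assms(1)]]
    assms(3) by simp

text \<open>A submesh element through an interior point of \<open>K\<close> lies in some mesh
  element, which can only be \<open>K\<close>. Its own inscribed ball then has a radius comparable
  to its diameter by shape regularity, and to that of \<open>K\<close> by contact regularity. All
  later estimates use mesh regularity through this ball.\<close>

lemma shape_contact_regular_inscribed_ball:
  fixes K :: "(real^'n) set"
  assumes mesh: "simplicial_mesh \<Omega> T" and reg: "shape_contact_regular \<rho>\<^sub>1 \<rho>\<^sub>2 \<Omega> T"
    and "\<rho>\<^sub>1 > 0" "\<rho>\<^sub>2 > 0" and K: "K \<in> T"
  shows "\<exists>x r. r > 0 \<and> cball x r \<subseteq> K \<and> \<rho>\<^sub>1 * \<rho>\<^sub>2 / 2 * diameter K \<le> r"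
proof -
  obtain S where "matching_submesh \<Omega> T S \<and> (\<forall>K'\<in>S. \<rho>\<^sub>1 * diameter K' \<le> inradius K') \<and>
      (\<forall>K\<in>T. \<forall>K'\<in>S. K' \<subseteq> K \<longrightarrow> \<rho>\<^sub>2 * diameter K \<le> diameter K')"
    using reg unfolding shape_contact_regular_def by (rule exE)
  then have S: "matching_submesh \<Omega> T S" "\<And>K'. K' \<in> S \<Longrightarrow> \<rho>\<^sub>1 * diameter K' \<le> inradius K'"
    "\<And>K K'. K \<in> T \<Longrightarrow> K' \<in> S \<Longrightarrow> K' \<subseteq> K \<Longrightarrow> \<rho>\<^sub>2 * diameter K \<le> diameter K'" by simp_all
  have S_mesh: "simplicial_mesh \<Omega> S" and "\<forall>K'\<in>S. \<exists>!K. K \<in> T \<and> K' \<subseteq> K"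
    using S(1) by (simp_all add: matching_submesh_def)
  then have sub: "\<exists>K. K \<in> T \<and> K' \<subseteq> K" if "K' \<in> S" for K' using that by (meson ex1_implies_ex)
  have simp: "int DIM(real^'n) simplex L" if "L \<in> T \<or> L \<in> S" for L
    using that mesh S_mesh unfolding simplicial_mesh_def by blast
  obtain x where x: "x \<in> interior K" using simplex_interior(1)[OF simp[of K]] K by auto
  then have "x \<in> \<Union>S" using K mesh S_mesh interior_subset[of K] unfolding simplicial_mesh_def
    by blast
  then obtain K' where K': "K' \<in> S" "x \<in> K'" by blast
  obtain L where L: "L \<in> T" "K' \<subseteq> L" using sub K' by blast
  have "L = K"
  proof (rule ccontr)
    assume "L \<noteq> K"
    then have "interior K \<inter> interior L = {}"
      using mesh K L unfolding simplicial_mesh_def pairwise_def by metis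
    then have "interior K \<inter> L = {}" using open_disjoint_element[OF simp[of L]] L by blast
    then show False using x K' L by blast
  qed
  obtain y where y: "y \<in> interior K'" using simplex_interior(1)[OF simp[of K']] K' by auto
  then obtain e where e: "e > 0" "cball y e \<subseteq> K'"
    by (meson interior_subset mem_interior_cball subset_trans)
  have bnd: "bounded K'" using compact_simplex[OF simp[of K']] K' compact_imp_bounded by blast
  have "diameter K' > 0"
  proof -
    obtain v :: "real^'n" where "norm v = e" using exists_norm_eq[of e] e(1) by auto
    then have "y + v \<in> K'" "y \<in> K'" using e by (auto simp: dist_norm subset_iff)
    then have "dist (y + v) y \<le> diameter K'" using bnd by (intro diameter_bounded_bound)
    then show ?thesis using e(1) \<open>norm v = e\<close> by (simp add: dist_norm)
  qed
  \<comment> \<open>\<open>inradius\<close> is a supremum; halving gives a number strictly below it,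
    hence an actual ball of at least that radius.\<close>
  then have "\<rho>\<^sub>1 * diameter K' / 2 < inradius K'"
    using S(2)[OF K'(1)] \<open>\<rho>\<^sub>1 > 0\<close> mult_pos_pos[of \<rho>\<^sub>1 "diameter K'"] by linarith
  moreover have "{r. 0 \<le> r \<and> (\<exists>x. cball x r \<subseteq> K')} \<noteq> {}" using e by (auto intro!: exI[of _ e])
  ultimately obtain r z where r: "\<rho>\<^sub>1 * diameter K' / 2 < r" "cball z r \<subseteq> K'"
    unfolding inradius_def using less_cSupD[of "{r. 0 \<le> r \<and> (\<exists>x. cball x r \<subseteq> K')}"] by blast
  have "\<rho>\<^sub>1 * \<rho>\<^sub>2 / 2 * diameter K \<le> \<rho>\<^sub>1 * diameter K' / 2"
    using mult_left_mono[OF S(3)[OF K K'(1)], of \<rho>\<^sub>1] L \<open>L = K\<close> \<open>\<rho>\<^sub>1 > 0\<close> by (simp add: mult_ac)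
  moreover have "0 < r"
  proof -
    have "0 < \<rho>\<^sub>1 * diameter K' / 2" using \<open>\<rho>\<^sub>1 > 0\<close> \<open>diameter K' > 0\<close> by simp
    then show ?thesis using r by simp
  qed
  ultimately show ?thesis using r L \<open>L = K\<close> by (intro exI[of _ z] exI[of _ r]) auto
qed

text \<open>
  \<open>A\<close> stands for the constant of \<open>poly_sup_bound\<close>. As a parameter it makes all bounds explicit in
  \<open>A\<close> and \<open>\<rho>\<close>, hence uniform in the mesh.
\<close>

locale dg_mesh =
  fixes \<Omega> :: "(real^'n) set" and T :: "(real^'n) set set" and D :: "(real^'n) face_data"
    and k :: nat and \<rho> A :: real
    and centre :: "(real^'n) set \<Rightarrow> real^'n" and rad :: "(real^'n) set \<Rightarrow> real"
    and reg :: "(real^'n) set \<Rightarrow> (real^'n) set"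
  assumes dim: "CARD('n) \<ge> 2"
    and domain: "polytopal_lipschitz_domain \<Omega>"
    and mesh: "simplicial_mesh \<Omega> T"
    and valid: "valid_face_data \<Omega> T D"
    and k: "k \<ge> 1"
    and \<rho>: "0 < \<rho>" "\<rho> \<le> 1"
    and rad: "\<And>K. K \<in> T \<Longrightarrow> rad K > 0" "\<And>K. K \<in> T \<Longrightarrow> cball (centre K) (rad K) \<subseteq> K"
      "\<And>K. K \<in> T \<Longrightarrow> \<rho> * diameter K \<le> rad K"
    and reg: "\<And>F. F \<in> mesh_faces \<Omega> T \<Longrightarrow> reg F \<in> T" "\<And>F. F \<in> mesh_faces \<Omega> T \<Longrightarrow>
        F \<in> element_faces (reg F)"
    and A_pos: "A > 0"
    and A: "\<And>p x0 r y. p \<in> (poly_space (k + 1) :: (real^'n \<Rightarrow> real) set) \<Longrightarrow> r > 0 \<Longrightarrow>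
        y \<in> cball x0 (2 / \<rho> * r) \<Longrightarrow>
      (p y)\<^sup>2 \<le> A / r ^ CARD('n) * (LINT x:cball x0 r|lborel. (p x)\<^sup>2)"
begin

section \<open>Size relations between elements and faces\<close>

abbreviation "faces \<equiv> mesh_faces \<Omega> T"

lemma finite_T: "finite T"
  and simplex_T: "K \<in> T \<Longrightarrow> int DIM(real^'n) simplex K"
  and Union_T: "\<Union>T = closure \<Omega>"
  and disjoint_T: "K \<in> T \<Longrightarrow> K' \<in> T \<Longrightarrow> K \<noteq> K' \<Longrightarrow> interior K \<inter> interior K' = {}"
  using mesh by (simp_all add: simplicial_mesh_def pairwise_def)

lemma interior_closure_\<Omega>: "interior (closure \<Omega>) = \<Omega>"
  using lipschitz_boundary_interior_closure domain unfolding polytopal_lipschitz_domain_def by blast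

lemma convex_T: "K \<in> T \<Longrightarrow> convex K"
  and compact_T: "K \<in> T \<Longrightarrow> compact K"
  and bounded_T: "K \<in> T \<Longrightarrow> bounded K"
  using simplex_T[of K] convex_simplex[of _ K] compact_simplex[of _ K] compact_imp_bounded[of K]
    by simp_all

lemma interior_T_subset: "K \<in> T \<Longrightarrow> interior K \<subseteq> \<Omega>"
  using interior_mono[of K "closure \<Omega>"] Union_T interior_closure_\<Omega> by blast

lemma rad_le_diameter: "K \<in> T \<Longrightarrow> rad K \<le> diameter K"
proof -
  assume K: "K \<in> T"
  obtain v :: "real^'n" where v: "norm v = rad K" using exists_norm_eq[of "rad K"] rad(1)[OF K]
    by auto
  then have "centre K + v \<in> K" "centre K \<in> K" using rad[OF K] by (auto simp: dist_norm subset_iff)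
  then have "dist (centre K + v) (centre K) \<le> diameter K" using bounded_T[OF K]
    by (intro diameter_bounded_bound)
  then show ?thesis using v by (simp add: dist_norm)
qed

lemma diameter_T_pos: "K \<in> T \<Longrightarrow> diameter K > 0"
  using rad_le_diameter[of K] rad(1)[of K] by simp

lemma diameter_le_rad: "K \<in> T \<Longrightarrow> diameter K \<le> rad K / \<rho>"
  using rad(3) \<rho> by (simp add: field_simps)

lemma subset_cball_T: "K \<in> T \<Longrightarrow> x \<in> K \<Longrightarrow> K \<subseteq> cball x (diameter K)"
  using diameter_bounded_bound[OF bounded_T] by auto

lemma finite_faces: "finite faces"
proof (rule finite_subset)
  show "faces \<subseteq> (\<Union>K\<in>T. element_faces K)" using reg by blast
  show "finite (\<Union>K\<in>T. element_faces K)" using finite_T finite_element_faces simplex_T by blast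
qed

lemma face_measure_pos: "F \<in> faces \<Longrightarrow> emeasure surface_measure F > 0"
  by (auto simp: mesh_faces_def interior_faces_def boundary_faces_def)

lemma face_subset_reg: "F \<in> faces \<Longrightarrow> F \<subseteq> reg F"
  and compact_face: "F \<in> faces \<Longrightarrow> compact F"
  using element_face_subset[OF simplex_T[OF reg(1)] reg(2)]
    convex_element_face(2)[OF simplex_T[OF reg(1)] reg(2)] by simp_all

lemma face_disc:
  assumes F: "F \<in> faces"
  shows "\<exists>q \<nu>. norm \<nu> = 1 \<and> q \<in> F \<and> (\<forall>x\<in>F. (x - q) \<bullet> \<nu> = 0) \<and>
    (\<forall>z. z \<bullet> \<nu> = 0 \<longrightarrow> norm z \<le> rad (reg F) \<longrightarrow> q + z \<in> F)"
  by (rule element_face_contains_disc[OF simplex_T[OF reg(1)[OF F]] reg(2)[OF F] rad(2)[OF reg(1)[OF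
    F]]
      rad(1)[OF reg(1)[OF F]]])

text \<open>The face contains a disc of radius \<open>rad (reg F)\<close>, and in dimension at least
  2 the disc has a direction to measure its radius in. With \<open>diameter_face_le_rad\<close>, a
  face and its regular element are of comparable size.\<close>

lemma rad_le_diameter_face:
  assumes F: "F \<in> faces" shows "rad (reg F) \<le> diameter F"
proof -
  obtain q \<nu> where q: "q \<in> F" "\<And>z. z \<bullet> \<nu> = 0 \<Longrightarrow> norm z \<le> rad (reg F) \<Longrightarrow> q + z \<in> F"
    using face_disc[OF F] by blast
  obtain e where e: "norm e = 1" "e \<bullet> \<nu> = 0" using exists_orthogonal_unit[of \<nu>] dim by auto
  have pos: "rad (reg F) > 0" using rad(1) reg(1) F by blast
  have "q + rad (reg F) *\<^sub>R e \<in> F" using e pos by (intro q(2)) auto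
  then have "dist (q + rad (reg F) *\<^sub>R e) q \<le> diameter F"
    using q(1) compact_imp_bounded[OF compact_face[OF F]] by (intro diameter_bounded_bound)
  then show ?thesis using e pos by (simp add: dist_norm)
qed

lemma diameter_face_pos: "F \<in> faces \<Longrightarrow> diameter F > 0"
  using rad_le_diameter_face[of F] rad(1)[OF reg(1), of F] by simp

lemma diameter_face_le: "K \<in> T \<Longrightarrow> F \<subseteq> K \<Longrightarrow> diameter F \<le> diameter K"
  using diameter_subset bounded_T by blast

lemma diameter_face_le_rad: "F \<in> faces \<Longrightarrow> diameter F \<le> rad (reg F) / \<rho>"
  using diameter_face_le[OF reg(1) face_subset_reg] diameter_le_rad[OF reg(1)] order_trans by blast

subsection \<open>Elements adjacent to a face\<close>

text \<open>Containment rather than membership in \<open>element_faces K\<close>: at a hanging node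
  \<open>F\<close> can be a proper part of a face of its second neighbour.\<close>

definition adj :: "(real^'n) set \<Rightarrow> (real^'n) set set" where
  "adj F = {K \<in> T. F \<subseteq> K}"

lemma finite_adj: "finite (adj F)"
  using finite_T by (simp add: adj_def)

lemma reg_adj: "F \<in> faces \<Longrightarrow> reg F \<in> adj F"
  using reg face_subset_reg by (auto simp: adj_def)

text \<open>At the centre of the disc in \<open>F\<close> every adjacent element has a point off the
  plane of \<open>F\<close>, hence a half ball on that side; two on the same side would overlap.
  With both sides occupied, the centre lies in \<open>interior (closure \<Omega>)\<close>, which is
  \<open>\<Omega>\<close>.\<close>

lemma adj_at_most_two:
  assumes F: "F \<in> faces" and K: "K1 \<in> adj F" "K2 \<in> adj F" "K1 \<noteq> K2"
  shows "adj F = {K1, K2}" and "\<not> F \<subseteq> frontier \<Omega>"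
proof -
  obtain q \<nu> where q: "norm \<nu> = 1" "q \<in> F" "\<And>z. z \<bullet> \<nu> = 0 \<Longrightarrow> norm z \<le> rad (reg F) \<Longrightarrow> q + z \<in> F"
    using face_disc[OF F] by blast
  have pos: "rad (reg F) > 0" using rad(1) reg(1) F by blast
  have side: "\<exists>p\<in>K. (p - q) \<bullet> \<nu> > 0 \<or> (p - q) \<bullet> \<nu> < 0" if "K \<in> adj F" for K
    using exists_point_off_hyperplane[of "centre K" "rad K" K \<nu> q] rad that q(1)
    by (auto simp: adj_def neq_iff)
  define pos where "pos K \<longleftrightarrow> (\<exists>p\<in>K. (p - q) \<bullet> \<nu> > 0)" for K
  define neg where "neg K \<longleftrightarrow> (\<exists>p\<in>K. (p - q) \<bullet> \<nu> < 0)" for K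
  have pn: "pos K \<or> neg K" if "K \<in> adj F" for K using side[OF that] by (auto simp: pos_def neg_def)
  have not_pos: "\<not> (pos K \<and> pos K')" if "K \<in> adj F" "K' \<in> adj F" "K \<noteq> K'" for K K'
  proof
    assume "pos K \<and> pos K'"
    then obtain p p' where "p \<in> K" "(p - q) \<bullet> \<nu> > 0" "p' \<in> K'" "(p' - q) \<bullet> \<nu> > 0"
      by (auto simp: pos_def)
    then have "interior K \<inter> interior K' \<noteq> {}"
      using that q \<open>rad (reg F) > 0\<close> convex_T
      by (intro same_side_overlap[of K K' "rad (reg F)" \<nu> q p p']) (auto simp: adj_def)
    then show False using disjoint_T that by (auto simp: adj_def)
  qed
  have not_neg: "\<not> (neg K \<and> neg K')" if "K \<in> adj F" "K' \<in> adj F" "K \<noteq> K'" for K K'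
  proof
    assume "neg K \<and> neg K'"
    then obtain p p' where "p \<in> K" "(p - q) \<bullet> (- \<nu>) > 0" "p' \<in> K'" "(p' - q) \<bullet> (- \<nu>) > 0"
      by (auto simp: neg_def)
    then have "interior K \<inter> interior K' \<noteq> {}"
      using that q \<open>rad (reg F) > 0\<close> convex_T
      by (intro same_side_overlap[of K K' "rad (reg F)" "- \<nu>" q p p']) (auto simp: adj_def)
    then show False using disjoint_T that by (auto simp: adj_def)
  qed
  have "K3 \<in> {K1, K2}" if "K3 \<in> adj F" for K3
    using pn[OF K(1)] pn[OF K(2)] pn[OF that] not_pos[OF K] not_neg[OF K]
      not_pos[OF K(1) that] not_pos[OF K(2) that] not_neg[OF K(1) that] not_neg[OF K(2) that]
        by blast
  then show "adj F = {K1, K2}" using K by blast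
  have "(pos K1 \<and> neg K2) \<or> (pos K2 \<and> neg K1)"
    using pn[OF K(1)] pn[OF K(2)] not_pos[OF K] not_neg[OF K] by blast
  then have "q \<in> interior (K1 \<union> K2)"
  proof
    assume "pos K1 \<and> neg K2"
    then obtain p p' where "p \<in> K1" "(p - q) \<bullet> \<nu> > 0" "p' \<in> K2" "(p' - q) \<bullet> \<nu> < 0"
      by (auto simp: pos_def neg_def)
    then show ?thesis using K q \<open>rad (reg F) > 0\<close> convex_T
      by (intro opposite_sides_interior[of K1 K2 "rad (reg F)" \<nu> q p p']) (auto simp: adj_def)
  next
    assume "pos K2 \<and> neg K1"
    then obtain p p' where "p \<in> K2" "(p - q) \<bullet> \<nu> > 0" "p' \<in> K1" "(p' - q) \<bullet> \<nu> < 0"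
      by (auto simp: pos_def neg_def)
    then have "q \<in> interior (K2 \<union> K1)" using K q \<open>rad (reg F) > 0\<close> convex_T
      by (intro opposite_sides_interior[of K2 K1 "rad (reg F)" \<nu> q p p']) (auto simp: adj_def)
    then show ?thesis by (simp add: Un_commute)
  qed
  moreover have "interior (K1 \<union> K2) \<subseteq> interior (closure \<Omega>)"
    using K Union_T by (intro interior_mono) (auto simp: adj_def)
  ultimately have "q \<in> \<Omega>" using interior_closure_\<Omega> by blast
  moreover have "open \<Omega>" using domain by (simp add: polytopal_lipschitz_domain_def)
  ultimately have "q \<notin> frontier \<Omega>" by (simp add: frontier_def interior_open)
  then show "\<not> F \<subseteq> frontier \<Omega>" using q(2) by blast
qed

text \<open>The two elements named by the face data contain \<open>F\<close>, and there is no room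
  for a third. Hence jumps and averages become sums over \<open>adj F\<close>.\<close>

lemma adj_interior:
  assumes "F \<in> interior_faces T"
  shows "adj F = {K_ext D F, K_int D F}" "K_ext D F \<noteq> K_int D F"
    "F = frontier (K_ext D F) \<inter> frontier (K_int D F)"
    "outward_unit_normal (face_normal D F) (K_ext D F) F"
    "outward_unit_normal (- face_normal D F) (K_int D F) F"
proof -
  have *: "K_ext D F \<in> T" "K_int D F \<in> T" "K_ext D F \<noteq> K_int D F"
    "F = frontier (K_ext D F) \<inter> frontier (K_int D F)"
    "outward_unit_normal (face_normal D F) (K_ext D F) F"
    "outward_unit_normal (- face_normal D F) (K_int D F) F"
    using valid assms unfolding valid_face_data_def by blast+
  have "frontier K \<subseteq> K" if "K \<in> T" for K
    using compact_T[OF that] compact_imp_closed frontier_subset_closed by blast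
  then have "F \<subseteq> K_ext D F" "F \<subseteq> K_int D F" using * by blast+
  then show "adj F = {K_ext D F, K_int D F}"
    using * assms by (intro adj_at_most_two) (auto simp: adj_def mesh_faces_def)
  show "K_ext D F \<noteq> K_int D F"
    "F = frontier (K_ext D F) \<inter> frontier (K_int D F)"
    "outward_unit_normal (face_normal D F) (K_ext D F) F"
    "outward_unit_normal (- face_normal D F) (K_int D F) F" using * by blast+
qed

text \<open>A second adjacent element would put a point of \<open>F\<close> into the open set
  \<open>\<Omega>\<close>.\<close>

lemma adj_boundary:
  assumes "F \<in> faces" "F \<notin> interior_faces T"
  shows "adj F = {K_ext D F}" "F \<subseteq> frontier \<Omega>" "outward_unit_normal (face_normal D F) (K_ext D F) F"
proof -
  have "F \<in> boundary_faces \<Omega> T" using assms by (auto simp: mesh_faces_def)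
  then have *: "K_ext D F \<in> T" "outward_unit_normal (face_normal D F) (K_ext D F) F"
    and "\<exists>E\<in>element_faces (K_ext D F). F = E \<inter> frontier \<Omega>"
    using valid unfolding valid_face_data_def by blast+
  then have sub: "F \<subseteq> K_ext D F" "F \<subseteq> frontier \<Omega>" using element_face_subset[OF simplex_T[OF *(1)]]
    by blast+
  then have "K_ext D F \<in> adj F" using * by (simp add: adj_def)
  then show "adj F = {K_ext D F}" using adj_at_most_two[OF assms(1)] sub(2) by blast
  show "F \<subseteq> frontier \<Omega>" "outward_unit_normal (face_normal D F) (K_ext D F) F" using sub * by blast+
qed

definition outer_normal :: "(real^'n) set \<Rightarrow> (real^'n) set \<Rightarrow> real^'n" where
  "outer_normal F K = (if K = K_ext D F then face_normal D F else - face_normal D F)"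

lemma outer_normal:
  assumes "F \<in> faces" "K \<in> adj F"
  shows "outward_unit_normal (outer_normal F K) K F"
  using assms adj_interior[of F] adj_boundary[of F]
  by (cases "F \<in> interior_faces T") (auto simp: outer_normal_def)

lemma norm_face_normal: "F \<in> faces \<Longrightarrow> norm (face_normal D F) = 1"
  using outer_normal[OF _ reg_adj, of F]
    by (auto simp: outer_normal_def outward_unit_normal_def split: if_splits)

lemma outer_normal_orthogonal:
  assumes "F \<in> faces" "K \<in> adj F" "x \<in> F" "y \<in> F"
  shows "(y - x) \<bullet> outer_normal F K = 0"
proof -
  have "(y - x) \<bullet> outer_normal F K \<le> 0" "(x - y) \<bullet> outer_normal F K \<le> 0"
    using outer_normal[OF assms(1,2)] assms(2-4) unfolding outward_unit_normal_def adj_def by blast+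
  then show ?thesis by (simp add: inner_diff_left)
qed

text \<open>A mesh face inside another one would force a third element next to it, or a pair of elements
  on both sides of the boundary.\<close>

lemma adjacent_face_subset_eq:
  assumes F: "F \<in> faces" and F': "F' \<in> faces" and sub: "F' \<subseteq> F" and K: "reg F = K"
  shows "F' = F"
proof (cases "reg F' = K")
  case True
  then show ?thesis using element_face_subset_eq[OF simplex_T[OF reg(1)[OF F]]] reg F F' sub K
    by metis
next
  case False
  have adjs: "K \<in> adj F'" "reg F' \<in> adj F'" "adj F \<subseteq> adj F'"
    using reg_adj[OF F] reg_adj[OF F'] sub K by (auto simp: adj_def)
  have two: "adj F' = {K, reg F'}" and nf: "\<not> F' \<subseteq> frontier \<Omega>"
    using adj_at_most_two[OF F' adjs(1,2)] False by auto
  have "F' \<in> interior_faces T" using adj_boundary(2)[OF F'] nf by blast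
  note i' = adj_interior[OF this]
  have "F \<in> interior_faces T" using adj_boundary(2)[OF F] nf sub by blast
  note i = adj_interior[OF this]
  \<comment> \<open>Both faces have the same pair of neighbours and are both the intersection of the
    two frontiers, so they coincide.\<close>
  have "{K_ext D F, K_int D F} = {K_ext D F', K_int D F'}"
    using adjs(3) i(2) unfolding i(1) i'(1) by auto
  then show ?thesis using i(3) i'(3) by (metis Int_commute doubleton_eq_iff)
qed

text \<open>The normal component of \<open>x - a\<close> is constant along \<open>F'\<close>. If it
  were nonzero, the coordinate of \<open>a\<close> would vanish on all of \<open>F'\<close>, which
  puts \<open>F'\<close> inside \<open>F\<close> and, by \<open>adjacent_face_subset_eq\<close>,
  makes them equal.\<close>

lemma other_face_normal_orthogonal:
  assumes F: "F \<in> faces" and F': "F' \<in> faces" "F' \<noteq> F" and K: "reg F = K" "K \<in> adj F'"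
    and a: "a \<in> vertices K" "F = convex hull (vertices K - {a})" and x: "x \<in> F'"
  shows "(x - a) \<bullet> outer_normal F' K = 0"
proof (rule ccontr)
  assume ne: "(x - a) \<bullet> outer_normal F' K \<noteq> 0"
  have KT: "K \<in> T" using K by (simp add: adj_def)
  note out = outer_normal[OF F'(1) K(2)]
  have "F' \<subseteq> F"
  proof
    fix y assume y: "y \<in> F'"
    then have yK: "y \<in> K" using K(2) by (auto simp: adj_def)
    have "(y - x) \<bullet> outer_normal F' K = 0" using outer_normal_orthogonal[OF F'(1) K(2) x y] .
    then have "(y - a) \<bullet> outer_normal F' K \<noteq> 0" using ne by (simp add: inner_diff_left)
    then have "barycentric K a y = 0"
      using outward_normal_orthogonal_edge[OF simplex_T[OF KT] out y yK a(1)] by blast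
    then show "y \<in> F"
      unfolding a(2) using barycentric_zero_imp_opposite_face[OF simplex_T[OF KT] yK a(1)] by blast
  qed
  then show False using adjacent_face_subset_eq[OF F F'(1) _ K(1)] F'(2) by blast
qed

text \<open>The elements \<open>reg F\<close> are comparable in size to the faces \<open>F\<close>, have disjoint interiors and stay
  close to \<open>K\<close>, which bounds their total volume.\<close>

lemma sum_diameter_faces_le:
  assumes K: "K \<in> T"
  shows "(\<Sum>F | F \<in> faces \<and> F \<subseteq> K. diameter F ^ CARD('n)) \<le>
    2 ^ Suc CARD('n) * (2 / \<rho>\<^sup>2) ^ CARD('n) * diameter K ^ CARD('n)"
proof -
  let ?n = "CARD('n)" and ?S = "{F. F \<in> faces \<and> F \<subseteq> K}"
  have fin: "finite ?S" using finite_faces by simp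
  \<comment> \<open>From the centre of \<open>K\<close> to a point of \<open>F\<close>, and from
    there to any point of \<open>reg F\<close>: each distance is at most
    \<open>diameter K / \<rho>\<close>.\<close>
  define R where "R = 2 / \<rho> * diameter K"
  have dK: "diameter K > 0" using diameter_T_pos[OF K] .
  have "(\<Sum>F\<in>?S. diameter F ^ ?n) \<le> (\<Sum>F\<in>?S. (rad (reg F) / \<rho>) ^ ?n)"
    using diameter_face_pos diameter_face_le_rad
      by (intro sum_mono power_mono) (auto intro: less_imp_le)
  \<comment> \<open>Grouped by the regular element, because several faces may share it; each
    contributes at most \<open>2 ^ Suc ?n\<close> faces, and distinct ones have disjoint
    balls.\<close>
  also have "\<dots> = (\<Sum>L\<in>reg ` ?S. \<Sum>F | F \<in> ?S \<and> reg F = L. (rad (reg F) / \<rho>) ^ ?n)"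
    using fin by (intro sum.group[symmetric]) auto
  also have "\<dots> \<le> (\<Sum>L\<in>reg ` ?S. 2 ^ Suc ?n * (rad L / \<rho>) ^ ?n)"
  proof (intro sum_mono)
    fix L assume "L \<in> reg ` ?S"
    then have L: "L \<in> T" using reg by auto
    have "{F. F \<in> ?S \<and> reg F = L} \<subseteq> element_faces L" using reg by auto
    then have "card {F. F \<in> ?S \<and> reg F = L} \<le> card (element_faces L)"
      by (rule card_mono[OF finite_element_faces[OF simplex_T[OF L]]])
    also have "\<dots> \<le> 2 ^ Suc ?n" using card_element_faces_le[OF simplex_T[OF L]] by simp
    finally have "card {F. F \<in> ?S \<and> reg F = L} \<le> 2 ^ Suc ?n" .
    then have "real (card {F. F \<in> ?S \<and> reg F = L}) \<le> 2 ^ Suc ?n"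
      using of_nat_mono[where ?'a = real] by fastforce
    then have "real (card {F. F \<in> ?S \<and> reg F = L}) * (rad L / \<rho>) ^ ?n \<le>
        2 ^ Suc ?n * (rad L / \<rho>) ^ ?n"
      using rad(1)[OF L] \<rho> by (intro mult_right_mono) auto
    moreover have "(\<Sum>F | F \<in> ?S \<and> reg F = L. (rad (reg F) / \<rho>) ^ ?n) =
        real (card {F. F \<in> ?S \<and> reg F = L}) * (rad L / \<rho>) ^ ?n" by simp
    ultimately show "(\<Sum>F | F \<in> ?S \<and> reg F = L. (rad (reg F) / \<rho>) ^ ?n) \<le>
        2 ^ Suc ?n * (rad L / \<rho>) ^ ?n"
      by simp
  qed
  also have "\<dots> = 2 ^ Suc ?n / \<rho> ^ ?n * (\<Sum>L\<in>reg ` ?S. rad L ^ DIM(real^'n))"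
    by (simp add: sum_distrib_left power_divide)
  also have "\<dots> \<le> 2 ^ Suc ?n / \<rho> ^ ?n * R ^ DIM(real^'n)"
  proof (intro mult_left_mono sum_powers_disjoint_balls)
    show "finite (reg ` ?S)" using fin by simp
    show "disjoint_family_on (\<lambda>L. ball (centre L) (rad L)) (reg ` ?S)"
      unfolding disjoint_family_on_def
    proof (intro ballI impI)
      fix L L' assume L: "L \<in> reg ` ?S" "L' \<in> reg ` ?S" "L \<noteq> L'"
      have "ball (centre M) (rad M) \<subseteq> interior M" if "M \<in> T" for M
        using rad(2)[OF that] ball_subset_cball by (meson interior_maximal open_ball order_trans)
      moreover have "L \<in> T" "L' \<in> T" using L reg by auto
      ultimately show "ball (centre L) (rad L) \<inter> ball (centre L') (rad L') = {}"
        using disjoint_T[of L L'] L(3) by blast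
    qed
    fix L assume "L \<in> reg ` ?S"
    then obtain F where F: "F \<in> faces" "F \<subseteq> K" "L = reg F" by auto
    have L: "L \<in> T" using F reg by auto
    show "0 \<le> rad L" using rad(1)[OF L] by simp
    obtain f where f: "f \<in> F" using face_disc[OF F(1)] by blast
    have "diameter L \<le> rad L / \<rho>" by (rule diameter_le_rad[OF L])
    also have "\<dots> \<le> diameter F / \<rho>" using rad_le_diameter_face[OF F(1)] F \<rho>
      by (simp add: divide_right_mono)
    also have "\<dots> \<le> diameter K / \<rho>" using diameter_face_le[OF K F(2)] \<rho>
      by (simp add: divide_right_mono)
    finally have dL: "diameter L \<le> diameter K / \<rho>" .
    have dK': "diameter K \<le> diameter K / \<rho>" using dK \<rho> by (simp add: field_simps)
    show "ball (centre L) (rad L) \<subseteq> cball (centre K) R"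
    proof
      fix x assume "x \<in> ball (centre L) (rad L)"
      then have xL: "x \<in> L" using rad(2)[OF L] by auto
      have "f \<in> L" "f \<in> K" "centre K \<in> K" using f F face_subset_reg[OF F(1)] rad[OF K] by auto
      then have "dist (centre K) f \<le> diameter K" "dist f x \<le> diameter L"
        using diameter_bounded_bound bounded_T K L xL by blast+
      then show "x \<in> cball (centre K) R"
        using dL dK' dist_triangle[of "centre K" x f] by (simp add: R_def)
    qed
  qed (use dK \<rho> in \<open>auto simp: R_def\<close>)
  also have "\<dots> = 2 ^ Suc ?n * (2 / \<rho>\<^sup>2) ^ ?n * diameter K ^ ?n"
    by (simp add: R_def power_mult_distrib power_divide power2_eq_square)
  finally show ?thesis .
qed

lemma emeasure_face_le:
  assumes F: "F \<in> faces"
  shows "emeasure surface_measure F \<le>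
      ennreal (hausdorff_const CARD('n) * diameter F ^ (CARD('n) - 1))"
proof -
  obtain q \<nu> where q: "norm \<nu> = 1" "q \<in> F" "\<And>x. x \<in> F \<Longrightarrow> (x - q) \<bullet> \<nu> = 0"
    using face_disc[OF F] by blast
  have "F \<subseteq> cball q (diameter F)"
    using diameter_bounded_bound[OF compact_imp_bounded[OF compact_face[OF F]]] q(2) by auto
  then have "hausdorff_outer (CARD('n) - 1) F \<le>
      ennreal (hausdorff_const CARD('n) * diameter F ^ (CARD('n) - 1))"
    using hausdorff_outer_hyperplane_le[OF diameter_face_pos[OF F] q(1) _ q(3)] by simp
  then show ?thesis
    using emeasure_surface_measure[OF face_measure_pos[OF F]] compact_face[OF F]
      by (simp add: borel_compact)
qed

lemma emeasure_face_finite: "F \<in> faces \<Longrightarrow> emeasure surface_measure F < \<infinity>"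
  using le_less_trans[OF emeasure_face_le ennreal_less_top] by simp

lemma measure_face_le:
  "F \<in> faces \<Longrightarrow> measure surface_measure F \<le> hausdorff_const CARD('n) * diameter F ^ (CARD('n) - 1)"
  using emeasure_face_le[of F] hausdorff_const_pos[of "CARD('n)"] diameter_face_pos[of F]
  by (auto simp: measure_def intro!: enn2real_leI)

end

section \<open>The lifting operator\<close>

lemma vec_poly_space_continuous:
  assumes "\<sigma> \<in> (vec_poly_space m :: (real^'n \<Rightarrow> real^'n) set)"
  shows "continuous_on A \<sigma>"
proof -
  have "continuous_on A (\<lambda>x. \<chi> i. \<sigma> x $ i)"
    using assms by (intro continuous_on_vec_lambda poly_space_continuous[of _ m])
      (simp add: vec_poly_space_def)
  then show ?thesis by simp
qed

lemma vec_poly_space_add: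
  "\<sigma> \<in> vec_poly_space m \<Longrightarrow> \<tau> \<in> vec_poly_space m \<Longrightarrow> (\<lambda>x::real^'n. \<sigma> x + \<tau> x) \<in> vec_poly_space m"
  by (simp add: vec_poly_space_def poly_space_add)

lemma vec_poly_space_scale:
  "\<sigma> \<in> vec_poly_space m \<Longrightarrow> (\<lambda>x::real^'n. a *\<^sub>R \<sigma> x) \<in> vec_poly_space m"
  by (simp add: vec_poly_space_def poly_space_scale)

lemma vec_poly_space_diff:
  "\<sigma> \<in> vec_poly_space m \<Longrightarrow> \<tau> \<in> vec_poly_space m \<Longrightarrow> (\<lambda>x::real^'n. \<sigma> x - \<tau> x) \<in> vec_poly_space m"
  by (simp add: vec_poly_space_def poly_space_diff)

lemma vec_poly_space_sum:
  "(\<And>i. i \<in> I \<Longrightarrow> \<sigma> i \<in> vec_poly_space m) \<Longrightarrow> (\<lambda>x::real^'n. \<Sum>i\<in>I. \<sigma> i x) \<in> vec_poly_space m"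
  by (simp add: vec_poly_space_def poly_space_sum)

lemma vec_poly_space_mult:
  "p \<in> poly_space l \<Longrightarrow> \<sigma> \<in> vec_poly_space m \<Longrightarrow> (\<lambda>x::real^'n. p x *\<^sub>R \<sigma> x) \<in> vec_poly_space (l + m)"
  by (simp add: vec_poly_space_def poly_space_mult)

lemma vec_poly_space_const: "(\<lambda>x::real^'n. v) \<in> vec_poly_space m"
  by (simp add: vec_poly_space_def poly_space_const)

lemma vec_poly_space_mono: "\<sigma> \<in> vec_poly_space l \<Longrightarrow> l \<le> m \<Longrightarrow>
    (\<sigma> :: real^'n \<Rightarrow> real^'n) \<in> vec_poly_space m"
  using poly_space_mono by (auto simp: vec_poly_space_def)

lemma vec_poly_space_id: "(\<lambda>x::real^'n. x) \<in> vec_poly_space 1"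
  unfolding vec_poly_space_def using poly_space_coord by blast

lemma poly_space_inner_vec:
  "\<sigma> \<in> vec_poly_space m \<Longrightarrow> (\<lambda>x::real^'n. \<sigma> x \<bullet> v) \<in> poly_space m"
  unfolding inner_vec_def inner_real_def vec_poly_space_def
  by (intro poly_space_sum poly_space_scale_right) simp

lemma gradient_eq:
  fixes f :: "'a::real_inner \<Rightarrow> real"
  assumes "GDERIV f x :> d"
  shows "gradient f x = d"
  unfolding gradient_def
proof (rule the_equality)
  show "GDERIV f x :> d" by (rule assms)
  fix d' assume "GDERIV f x :> d'"
  then have "(\<lambda>h. h \<bullet> d') = (\<lambda>h. h \<bullet> d)"
    using assms unfolding gderiv_def by (rule has_derivative_unique)
  then have "(d' - d) \<bullet> d' = (d' - d) \<bullet> d" by meson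
  then have "(d' - d) \<bullet> (d' - d) = 0" by (simp add: inner_diff_right)
  then show "d' = d" by simp
qed

lemma gradient_poly_space:
  fixes p :: "real^'n \<Rightarrow> real"
  assumes "p \<in> poly_space k"
  shows "gradient p \<in> vec_poly_space (k - 1)"
proof -
  obtain g where g: "g \<in> vec_poly_space (k - 1)" "\<forall>x. GDERIV p x :> g x"
    using poly_space_gradient[OF assms] by blast
  then have "gradient p = g" using gradient_eq by blast
  with g show ?thesis by simp
qed

section \<open>Integrals over elements and faces\<close>

lemma set_integral_nonneg_real:
  fixes f :: "'a \<Rightarrow> real"
  assumes "\<And>x. x \<in> A \<Longrightarrow> f x \<ge> 0"
  shows "(LINT x:A|M. f x) \<ge> 0"
  unfolding set_lebesgue_integral_def using assms
  by (intro integral_nonneg_AE) (auto split: split_indicator)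

lemma set_integral_le_measure:
  fixes f :: "'a::euclidean_space \<Rightarrow> real"
  assumes "sets M = sets borel" "compact A" "emeasure M A < \<infinity>" "continuous_on UNIV f"
    and "\<And>x. x \<in> A \<Longrightarrow> f x \<le> b"
  shows "(LINT x:A|M. f x) \<le> measure M A * b"
proof -
  have "set_integrable M A f" using assms by (intro set_integrable_continuous_finite)
  moreover have "set_integrable M A (\<lambda>x. b)" using assms
    by (intro set_integrable_continuous_finite) auto
  ultimately have "(LINT x:A|M. f x) \<le> (LINT x:A|M. b)" using assms
    by (intro set_integral_mono) auto
  also have "\<dots> = measure M A * b"
    using assms by (simp add: set_lebesgue_integral_def borel_compact less_top)
  finally show ?thesis .
qed

lemma interior_integral_convex:
  fixes f :: "'a::euclidean_space \<Rightarrow> real"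
  assumes "convex K" "compact K" "continuous_on UNIV f"
  shows "(\<integral>x. indicator (interior K) x * f x \<partial>lborel) = (LINT x:K|lborel. f x)"
  unfolding set_lebesgue_integral_def
proof (rule integral_cong_AE)
  have fm: "f \<in> borel_measurable borel" using assms(3) by (rule borel_measurable_continuous_onI)
  then show "(\<lambda>x. indicator (interior K) x * f x) \<in> borel_measurable lborel"
    by (intro borel_measurable_times borel_measurable_indicator) auto
  show "(\<lambda>x. indicator K x *\<^sub>R f x) \<in> borel_measurable lborel"
    using fm assms(2) by (intro borel_measurable_scaleR borel_measurable_indicator)
      (auto simp: borel_compact)
  have "frontier K \<in> null_sets lborel"
  proof -
    have "negligible (frontier K)" using assms(1) by (rule negligible_convex_frontier)
    then have "emeasure lebesgue (frontier K) = 0"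
      by (simp add: negligible_iff_null_sets null_sets_def)
    moreover have "frontier K \<in> sets lborel" by simp
    ultimately show ?thesis by (simp add: null_sets_def emeasure_completion)
  qed
  then have "AE x in lborel. x \<notin> frontier K" by (rule AE_not_in)
  then show "AE x in lborel. indicator (interior K) x * f x = indicator K x *\<^sub>R f x"
  proof eventually_elim
    case (elim x)
    then show ?case using interior_subset[of K] closure_subset[of K]
      by (auto simp: frontier_def split: split_indicator)
  qed
qed

context dg_mesh
begin

lemma set_integrable_face:
  fixes f :: "real^'n \<Rightarrow> real"
  shows "F \<in> faces \<Longrightarrow> continuous_on UNIV f \<Longrightarrow> set_integrable surface_measure F f"
  by (intro set_integrable_continuous_finite sets_surface_measure compact_face emeasure_face_finite)

lemma set_integrable_T:
  fixes f :: "real^'n \<Rightarrow> real"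
  shows "K \<in> T \<Longrightarrow> continuous_on UNIV f \<Longrightarrow> set_integrable lborel K f"
  by (intro set_integrable_continuous_lborel compact_T)

text \<open>Every point lies in the interior of at most one element, so of the product of the two
  sums only the diagonal survives; the skeleton has measure zero because frontiers of convex sets
  are null.\<close>

lemma assemble_inner_integral:
  assumes "\<And>K. K \<in> T \<Longrightarrow> continuous_on UNIV (w K)" "\<And>K. K \<in> T \<Longrightarrow> continuous_on UNIV (v K)"
  shows "(LINT x:\<Omega>|lborel. assemble T w x \<bullet> (assemble T v x :: real^'n)) =
      (\<Sum>K\<in>T. LINT x:K|lborel. w K x \<bullet> v K x)"
proof -
  have point: "indicator \<Omega> x *\<^sub>R (assemble T w x \<bullet> assemble T v x) =
      (\<Sum>K\<in>T. indicator (interior K) x * (w K x \<bullet> v K x))" for x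
  proof (cases "\<exists>K\<in>T. x \<in> interior K")
    case True
    then obtain K where K: "K \<in> T" "x \<in> interior K" by blast
    have ind: "indicator (interior L) x = (if L = K then 1 else 0 :: real)" if "L \<in> T" for L
      using disjoint_T[OF that K(1)] K(2) by (auto split: split_indicator)
    have *: "assemble T f x = f K x" for f :: "(real^'n) set \<Rightarrow> real^'n \<Rightarrow> real^'n"
    proof -
      have "assemble T f x = (\<Sum>L\<in>T. if L = K then f L x else 0)"
        unfolding assemble_def by (intro sum.cong) (auto simp: ind)
      then show ?thesis using K(1) finite_T by simp
    qed
    have "(\<Sum>L\<in>T. indicator (interior L) x * (w L x \<bullet> v L x)) =
        (\<Sum>L\<in>T. if L = K then w L x \<bullet> v L x else 0)"
      by (intro sum.cong) (auto simp: ind)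
    also have "\<dots> = w K x \<bullet> v K x" using K(1) finite_T by simp
    finally show ?thesis using K interior_T_subset[OF K(1)] by (auto simp: *)
  next
    case False
    then have "assemble T w x = 0" unfolding assemble_def by (intro sum.neutral) auto
    then show ?thesis using False by (auto intro!: sum.neutral[symmetric])
  qed
  have cont: "continuous_on UNIV (\<lambda>x. w K x \<bullet> v K x)" if "K \<in> T" for K
    using assms that by (intro continuous_on_inner)
  have int: "integrable lborel (\<lambda>x. indicator (interior K) x * (w K x \<bullet> v K x))" if "K \<in> T" for K
  proof -
    have "set_integrable lborel K (\<lambda>x. w K x \<bullet> v K x)"
      using set_integrable_T[OF that cont[OF that]] .
    then have "set_integrable lborel (interior K) (\<lambda>x. w K x \<bullet> v K x)"
      by (rule set_integrable_subset) (auto simp: interior_subset)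
    then show ?thesis by (simp add: set_integrable_def)
  qed
  have "(LINT x:\<Omega>|lborel. assemble T w x \<bullet> assemble T v x) =
      (\<integral>x. (\<Sum>K\<in>T. indicator (interior K) x * (w K x \<bullet> v K x)) \<partial>lborel)"
    unfolding set_lebesgue_integral_def point ..
  also have "\<dots> = (\<Sum>K\<in>T. \<integral>x. indicator (interior K) x * (w K x \<bullet> v K x) \<partial>lborel)"
    using int by (intro Bochner_Integration.integral_sum)
  also have "\<dots> = (\<Sum>K\<in>T. LINT x:K|lborel. w K x \<bullet> v K x)"
    using convex_T compact_T cont by (intro sum.cong interior_integral_convex) auto
  finally show ?thesis .
qed

lemma L2_norm_assemble:
  assumes "\<And>K. K \<in> T \<Longrightarrow> continuous_on UNIV (w K)"
  shows "L2_norm_on lborel \<Omega> (assemble T w :: real^'n \<Rightarrow> real^'n) =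
    sqrt (\<Sum>K\<in>T. LINT x:K|lborel. (norm (w K x))\<^sup>2)"
  using assemble_inner_integral[of w w] assms by (simp add: L2_norm_on_def power2_norm_eq_inner)

lemma dg_vec_space_poly: "\<sigma> \<in> dg_vec_space T m \<Longrightarrow> K \<in> T \<Longrightarrow> \<sigma> K \<in> vec_poly_space m"
  unfolding dg_vec_space_def by (rule PiE_mem)

lemma dg_vec_space_continuous: "\<sigma> \<in> dg_vec_space T m \<Longrightarrow> K \<in> T \<Longrightarrow> continuous_on UNIV (\<sigma> K)"
  using dg_vec_space_poly vec_poly_space_continuous by blast

section \<open>The face form and its localisation to elements\<close>

definition weight :: "(real^'n) set \<Rightarrow> real" where
  "weight F = (if F \<in> interior_faces T then 1 / 2 else 1)"

text \<open>Treats interior and boundary faces alike: the number of neighbours is in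
  \<open>adj F\<close> and the averaging factor in \<open>weight F\<close>, which is never below 1 /
  2.\<close>

lemma average_normal:
  assumes "F \<in> faces"
  shows "average T D (\<lambda>K y. \<sigma> K y \<bullet> face_normal D F) F x =
    weight F * (\<Sum>K\<in>adj F. \<sigma> K x \<bullet> face_normal D F)"
  using adj_interior(1,2)[of F] adj_boundary(1)[OF assms]
  by (cases "F \<in> interior_faces T") (auto simp: average_def weight_def)

definition face_form where
  "face_form \<phi> \<sigma> = (\<Sum>F\<in>faces. LINT x:F|surface_measure.
     \<phi> F x * average T D (\<lambda>K y. \<sigma> K y \<bullet> face_normal D F) F x)"

lemma sum_faces_adj:
  "(\<Sum>F\<in>faces. \<Sum>K\<in>adj F. f F K) = (\<Sum>K\<in>T. \<Sum>F | F \<in> faces \<and> F \<subseteq> K. f F K :: real)"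
  unfolding adj_def using finite_faces finite_T by (rule sum.swap_restrict)

text \<open>The form becomes a sum of functionals, each seeing the test field on one element only,
  so the lifting can be built element by element.\<close>

lemma face_form_eq:
  assumes \<phi>: "\<And>F. F \<in> faces \<Longrightarrow> continuous_on UNIV (\<phi> F)"
    and \<sigma>: "\<And>K. K \<in> T \<Longrightarrow> continuous_on UNIV (\<sigma> K)"
  shows "face_form \<phi> \<sigma> = (\<Sum>K\<in>T. \<Sum>F | F \<in> faces \<and> F \<subseteq> K.
    weight F * (LINT x:F|surface_measure. \<phi> F x * (\<sigma> K x \<bullet> face_normal D F)))"
proof -
  have "face_form \<phi> \<sigma> = (\<Sum>F\<in>faces. \<Sum>K\<in>adj F.
      weight F * (LINT x:F|surface_measure. \<phi> F x * (\<sigma> K x \<bullet> face_normal D F)))"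
    unfolding face_form_def
  proof (intro sum.cong refl)
    fix F assume F: "F \<in> faces"
    have "(LINT x:F|surface_measure. \<phi> F x * average T D (\<lambda>K y. \<sigma> K y \<bullet> face_normal D F) F x) =
        (LINT x:F|surface_measure. \<Sum>K\<in>adj F. weight F * (\<phi> F x * (\<sigma> K x \<bullet> face_normal D F)))"
      by (simp add: average_normal[OF F] sum_distrib_left mult_ac)
    also have "\<dots> = (\<Sum>K\<in>adj F. LINT x:F|surface_measure. weight F *
        (\<phi> F x * (\<sigma> K x \<bullet> face_normal D F)))"
    proof (intro set_integral_finite_sum set_integrable_face F)
      fix K assume "K \<in> adj F"
      then show "continuous_on UNIV (\<lambda>x. weight F * (\<phi> F x * (\<sigma> K x \<bullet> face_normal D F)))"
        using \<phi>[OF F] \<sigma>[of K] by (intro continuous_intros) (auto simp: adj_def)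
    qed
    finally show "(LINT x:F|surface_measure. \<phi> F x * average T D (\<lambda>K y. \<sigma> K y \<bullet> face_normal D F) F
        x) =
        (\<Sum>K\<in>adj F. weight F * (LINT x:F|surface_measure. \<phi> F x * (\<sigma> K x \<bullet> face_normal D F)))"
      by simp
  qed
  then show ?thesis unfolding sum_faces_adj .
qed

lemma ball_rad_subset: "K \<in> T \<Longrightarrow> ball (centre K) (rad K) \<subseteq> K"
  using rad(2) ball_subset_cball by blast

lemma inner_integral_components:
  assumes "K \<in> T" "continuous_on UNIV \<sigma>" "continuous_on UNIV \<tau>"
  shows "(LINT x:K|lborel. \<sigma> x \<bullet> \<tau> x) = (\<Sum>i\<in>UNIV. LINT x:K|lborel. \<sigma> x $ i * (\<tau> x :: real^'n) $ i)"
  unfolding inner_vec_def inner_real_def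
  using assms by (intro set_integral_finite_sum set_integrable_T continuous_intros)

text \<open>On each element and for each component the face form is a linear functional of a scalar
  polynomial, represented by \<open>poly_space_riesz\<close>.\<close>

lemma lifting_exists:
  assumes \<phi>: "\<And>F. F \<in> faces \<Longrightarrow> continuous_on UNIV (\<phi> F)"
  shows "\<exists>r\<in>dg_vec_space T m. \<forall>\<sigma>\<in>dg_vec_space T m. (\<Sum>K\<in>T. LINT x:K|lborel. r K x \<bullet> \<sigma> K x) =
      face_form \<phi> \<sigma>"
proof -
  \<comment> \<open>The contribution to the face form of a test field with the single component
    \<open>q\<close> in direction \<open>i\<close> on \<open>K\<close>.\<close>
  define l where "l K i q = (\<Sum>F | F \<in> faces \<and> F \<subseteq> K. weight F *
    (LINT x:F|surface_measure. \<phi> F x *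
      (q x * face_normal D F $ i)))" for K i and q :: "real^'n \<Rightarrow> real"
  have int: "set_integrable surface_measure F (\<lambda>x. \<phi> F x * (q x * c))"
    if "F \<in> faces" "continuous_on UNIV q" for F q c
    using that \<phi>[OF that(1)] by (intro set_integrable_face continuous_intros)
  have "\<exists>g\<in>poly_space m. \<forall>q\<in>poly_space m. (LINT x:K|lborel. g x * q x) = l K i q" if K: "K \<in> T"
    for K i
  proof (rule poly_space_riesz[OF compact_T[OF K] ball_rad_subset[OF K] rad(1)[OF K]])
    fix p q :: "real^'n \<Rightarrow> real" assume pq: "p \<in> poly_space m" "q \<in> poly_space m"
    have "(LINT x:F|surface_measure. \<phi> F x * ((p x + q x) * face_normal D F $ i)) =
        (LINT x:F|surface_measure. \<phi> F x * (p x * face_normal D F $ i)) +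
        (LINT x:F|surface_measure. \<phi> F x * (q x * face_normal D F $ i))" if "F \<in> faces" for F
      using int[OF that poly_space_continuous[OF pq(1)]] int[OF that poly_space_continuous[OF
        pq(2)]]
      by (simp add: distrib_right distrib_left)
    then show "l K i (\<lambda>x. p x + q x) = l K i p + l K i q"
      unfolding l_def by (simp add: sum.distrib[symmetric] distrib_left)
  next
    fix p :: "real^'n \<Rightarrow> real" and a
    have "(LINT x:F|surface_measure. \<phi> F x * (a * p x * face_normal D F $ i)) =
        a * (LINT x:F|surface_measure. \<phi> F x * (p x * face_normal D F $ i))" for F
      by (subst set_integral_mult_right[symmetric]) (simp add: mult_ac)
    then show "l K i (\<lambda>x. a * p x) = a * l K i p"
      unfolding l_def by (simp add: sum_distrib_left mult_ac)
  qed
  then obtain g where g: "\<And>K i. K \<in> T \<Longrightarrow> g K i \<in> poly_space m"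
    "\<And>K i q. K \<in> T \<Longrightarrow> q \<in> poly_space m \<Longrightarrow> (LINT x:K|lborel. g K i x * q x) = l K i q"
    by metis
  define r where "r = (\<lambda>K\<in>T. \<lambda>x. \<chi> i. g K i x)"
  have r: "r \<in> dg_vec_space T m" unfolding r_def dg_vec_space_def vec_poly_space_def using g(1)
    by auto
  moreover have "(\<Sum>K\<in>T. LINT x:K|lborel. r K x \<bullet> \<sigma> K x) = face_form \<phi> \<sigma>"
    if \<sigma>: "\<sigma> \<in> dg_vec_space T m" for \<sigma>
  proof -
    have "face_form \<phi> \<sigma> = (\<Sum>K\<in>T. \<Sum>F | F \<in> faces \<and> F \<subseteq> K.
        weight F * (LINT x:F|surface_measure. \<phi> F x * (\<sigma> K x \<bullet> face_normal D F)))"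
      using \<phi> dg_vec_space_continuous[OF \<sigma>] by (rule face_form_eq)
    also have "\<dots> = (\<Sum>K\<in>T. LINT x:K|lborel. r K x \<bullet> \<sigma> K x)"
    proof (intro sum.cong refl)
      fix K assume K: "K \<in> T"
      have \<sigma>K: "(\<lambda>x. \<sigma> K x $ i) \<in> poly_space m" for i
        using dg_vec_space_poly[OF \<sigma> K] by (simp add: vec_poly_space_def)
      have "(LINT x:K|lborel. r K x \<bullet> \<sigma> K x) = (\<Sum>i\<in>UNIV. LINT x:K|lborel. r K x $ i * \<sigma> K x $ i)"
        using K dg_vec_space_continuous[OF r K] dg_vec_space_continuous[OF \<sigma> K]
          by (rule inner_integral_components)
      also have "\<dots> = (\<Sum>i\<in>UNIV. l K i (\<lambda>x. \<sigma> K x $ i))"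
        using K g(2)[OF K \<sigma>K] by (simp add: r_def)
      also have "\<dots> = (\<Sum>F | F \<in> faces \<and> F \<subseteq> K. weight F *
          (\<Sum>i\<in>UNIV. LINT x:F|surface_measure. \<phi> F x * (\<sigma> K x $ i * face_normal D F $ i)))"
        unfolding l_def by (subst sum.swap) (simp add: sum_distrib_left)
      also have "\<dots> = (\<Sum>F | F \<in> faces \<and> F \<subseteq> K. weight F *
          (LINT x:F|surface_measure. \<phi> F x * (\<sigma> K x \<bullet> face_normal D F)))"
      proof (intro sum.cong refl arg_cong2[where f = "(*)"])
        fix F assume F: "F \<in> {F \<in> faces. F \<subseteq> K}"
        have "(LINT x:F|surface_measure. \<phi> F x * (\<sigma> K x \<bullet> face_normal D F)) =
            (LINT x:F|surface_measure. \<Sum>i\<in>UNIV. \<phi> F x * (\<sigma> K x $ i * face_normal D F $ i))"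
          by (simp add: inner_vec_def sum_distrib_left)
        also have "\<dots> = (\<Sum>i\<in>UNIV. LINT x:F|surface_measure. \<phi> F x * (\<sigma> K x $ i * face_normal D F $
            i))"
          using F poly_space_continuous[OF \<sigma>K] by (intro set_integral_finite_sum int) auto
        finally show "(\<Sum>i\<in>UNIV. LINT x:F|surface_measure. \<phi> F x * (\<sigma> K x $ i * face_normal D F $ i))
            =
            (LINT x:F|surface_measure. \<phi> F x * (\<sigma> K x \<bullet> face_normal D F))" ..
      qed
      finally show "(\<Sum>F | F \<in> faces \<and> F \<subseteq> K. weight F *
          (LINT x:F|surface_measure. \<phi> F x * (\<sigma> K x \<bullet> face_normal D F))) =
            (LINT x:K|lborel. r K x \<bullet> \<sigma> K x)" ..
    qed
    finally show ?thesis ..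
  qed
  ultimately show ?thesis by blast
qed

text \<open>Testing with the difference gives a vanishing square integral on each element. The
  identity theorem turns this into equality of the polynomials on the whole space, and
  \<open>PiE_ext\<close> adds the extensional values outside \<open>T\<close>.\<close>

lemma lifting_unique:
  assumes r: "r \<in> dg_vec_space T m" "r' \<in> dg_vec_space T m"
    and eq: "\<And>\<sigma>. \<sigma> \<in> dg_vec_space T m \<Longrightarrow>
      (\<Sum>K\<in>T. LINT x:K|lborel. r K x \<bullet> \<sigma> K x) = (\<Sum>K\<in>T. LINT x:K|lborel. r' K x \<bullet> \<sigma> K x)"
  shows "r = r'"
proof -
  define \<delta> where "\<delta> = (\<lambda>K\<in>T. \<lambda>x. r K x - r' K x)"
  have \<delta>: "\<delta> \<in> dg_vec_space T m"
    using dg_vec_space_poly[OF r(1)] dg_vec_space_poly[OF r(2)]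
    unfolding \<delta>_def dg_vec_space_def by (auto intro!: vec_poly_space_diff)
  note cont = dg_vec_space_continuous[OF r(1)] dg_vec_space_continuous[OF r(2)]
    dg_vec_space_continuous[OF \<delta>]
  have "(\<Sum>K\<in>T. LINT x:K|lborel. \<delta> K x \<bullet> \<delta> K x) =
      (\<Sum>K\<in>T. (LINT x:K|lborel. r K x \<bullet> \<delta> K x) - (LINT x:K|lborel. r' K x \<bullet> \<delta> K x))"
  proof (intro sum.cong refl)
    fix K assume K: "K \<in> T"
    have "(LINT x:K|lborel. \<delta> K x \<bullet> \<delta> K x) = (LINT x:K|lborel. r K x \<bullet> \<delta> K x - r' K x \<bullet> \<delta> K x)"
    proof -
      have "\<delta> K x \<bullet> \<delta> K x = r K x \<bullet> \<delta> K x - r' K x \<bullet> \<delta> K x" for x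
        using K by (simp add: \<delta>_def flip: inner_diff_left)
      then show ?thesis by simp
    qed
    also have "\<dots> = (LINT x:K|lborel. r K x \<bullet> \<delta> K x) - (LINT x:K|lborel. r' K x \<bullet> \<delta> K x)"
      using K cont by (intro set_integral_diff set_integrable_T continuous_on_inner) auto
    finally show "(LINT x:K|lborel. \<delta> K x \<bullet> \<delta> K x) = \<dots>" .
  qed
  also have "\<dots> = 0" using eq[OF \<delta>] by (simp add: sum_subtractf)
  finally have "(\<Sum>K\<in>T. LINT x:K|lborel. \<delta> K x \<bullet> \<delta> K x) = 0" .
  then have zero: "(LINT x:K|lborel. \<delta> K x \<bullet> \<delta> K x) = 0" if "K \<in> T" for K
    using that finite_T by (subst (asm) sum_nonneg_eq_0_iff) (auto intro: set_integral_nonneg_real)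
  have "\<delta> K x = 0" if K: "K \<in> T" for K x
  proof -
    have "\<delta> K y $ i = 0" for y i
    proof -
      have p: "(\<lambda>y. \<delta> K y $ i) \<in> poly_space m"
        using dg_vec_space_poly[OF \<delta> K] by (simp add: vec_poly_space_def)
      have "(\<Sum>j\<in>UNIV. LINT y:K|lborel. \<delta> K y $ j * \<delta> K y $ j) = 0"
        using zero[OF K] inner_integral_components[OF K cont(3)[OF K] cont(3)[OF K]] by simp
      then have "(LINT y:K|lborel. \<delta> K y $ i * \<delta> K y $ i) = 0"
        by (subst (asm) sum_nonneg_eq_0_iff) (auto intro: set_integral_nonneg_real)
      then have "\<delta> K y $ i = 0" if "y \<in> ball (centre K) (rad K)" for y
        using continuous_zero_if_square_integral_zero[OF compact_T[OF K] ball_rad_subset[OF K]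
          poly_space_continuous[OF p]]
          that by blast
      then show ?thesis
        using poly_space_zero_if_zero_on_ball[OF p rad(1)[OF K], of "centre K" y] by blast
    qed
    then show ?thesis by (simp add: vec_eq_iff)
  qed
  then have "r K = r' K" if "K \<in> T" for K using that unfolding \<delta>_def by (auto simp: fun_eq_iff)
  then show ?thesis by (rule PiE_ext[OF r[unfolded dg_vec_space_def]])
qed

text \<open>Existence and uniqueness discharge the definite description; at the same time the
  integral over \<open>\<Omega>\<close> is replaced by the sum over elements, the form used from
  here on.\<close>

lemma lifting_spec:
  assumes \<phi>: "\<And>F. F \<in> faces \<Longrightarrow> continuous_on UNIV (\<phi> F)"
  shows "lifting \<Omega> T D m \<phi> \<in> dg_vec_space T m"
    and "\<sigma> \<in> dg_vec_space T m \<Longrightarrow> (\<Sum>K\<in>T. LINT x:K|lborel. lifting \<Omega> T D m \<phi> K x \<bullet> \<sigma> K x) =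
        face_form \<phi> \<sigma>"
proof -
  define P where "P r \<longleftrightarrow> r \<in> dg_vec_space T m \<and> (\<forall>\<sigma>\<in>dg_vec_space T m.
    (\<Sum>K\<in>T. LINT x:K|lborel. r K x \<bullet> \<sigma> K x) = face_form \<phi> \<sigma>)" for r
  have "lifting \<Omega> T D m \<phi> = (THE r. P r)"
    unfolding lifting_def P_def face_form_def
  proof (intro arg_cong[where f = The] ext conj_cong refl ball_cong)
    fix r \<sigma> assume "r \<in> dg_vec_space T m" "\<sigma> \<in> dg_vec_space T m"
    then have "(LINT x:\<Omega>|lborel. assemble T r x \<bullet> assemble T \<sigma> x) =
        (\<Sum>K\<in>T. LINT x:K|lborel. r K x \<bullet> \<sigma> K x)"
      using dg_vec_space_continuous by (intro assemble_inner_integral) auto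
    then show "((LINT x:\<Omega>|lborel. assemble T r x \<bullet> assemble T \<sigma> x) = s) \<longleftrightarrow>
        ((\<Sum>K\<in>T. LINT x:K|lborel. r K x \<bullet> \<sigma> K x) = s)" for s by simp
  qed
  moreover have "\<exists>!r. P r"
  proof (rule ex_ex1I)
    show "\<exists>r. P r" using lifting_exists[where \<phi> = \<phi> and m = m, OF \<phi>] unfolding P_def by blast
    show "r = r'" if "P r" "P r'" for r r'
      using that unfolding P_def by (intro lifting_unique) auto
  qed
  ultimately have "P (lifting \<Omega> T D m \<phi>)" using theI'[of P] by simp
  then show "lifting \<Omega> T D m \<phi> \<in> dg_vec_space T m"
    and "\<sigma> \<in> dg_vec_space T m \<Longrightarrow> (\<Sum>K\<in>T. LINT x:K|lborel. lifting \<Omega> T D m \<phi> K x \<bullet> \<sigma> K x) =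
        face_form \<phi> \<sigma>"
    by (auto simp: P_def)
qed

end

section \<open>Stability of the lifted gradient\<close>

lemma young_real:
  fixes a b s :: real
  assumes "s > 0"
  shows "a * b \<le> s / 2 * a\<^sup>2 + 1 / (2 * s) * b\<^sup>2"
proof -
  have "0 \<le> (s * a - b)\<^sup>2 / (2 * s)" using assms by simp
  also have "\<dots> = s / 2 * a\<^sup>2 + 1 / (2 * s) * b\<^sup>2 - a * b"
    using assms by (simp add: power2_eq_square field_simps)
  finally show ?thesis by simp
qed

lemma young_inner:
  fixes v w :: "'a::real_inner"
  assumes "s > 0"
  shows "v \<bullet> w \<le> s / 2 * (norm v)\<^sup>2 + 1 / (2 * s) * (norm w)\<^sup>2"
  using norm_cauchy_schwarz[of v w] young_real[OF assms, of "norm v" "norm w"] by linarith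

lemma barycentric_poly_space:
  fixes K :: "(real^'n) set"
  assumes "int DIM(real^'n) simplex K" "a \<in> vertices K"
  shows "barycentric K a \<in> poly_space 1"
proof -
  obtain n b where nb: "barycentric K a = (\<lambda>x. x \<bullet> n + b)" using barycentric_affine[OF assms]
    by blast
  show ?thesis unfolding nb by (intro poly_space_add poly_space_inner poly_space_const)
qed

lemma hyperplane_proj_poly: "hyperplane_proj \<nu> (q :: real^'n) \<in> vec_poly_space 1"
proof -
  have "(\<lambda>x::real^'n. ((x - q) \<bullet> \<nu>) *\<^sub>R \<nu>) \<in> vec_poly_space (1 + 0)"
    by (intro vec_poly_space_mult vec_poly_space_const poly_space_inner_vec vec_poly_space_diff
      vec_poly_space_id)
  then show ?thesis unfolding hyperplane_proj_def
    by (intro vec_poly_space_diff vec_poly_space_id) simp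
qed

lemma norm_sum_squared_le:
  fixes f :: "'i \<Rightarrow> 'a::real_normed_vector"
  shows "(norm (\<Sum>i\<in>I. f i))\<^sup>2 \<le> real (card I) * (\<Sum>i\<in>I. (norm (f i))\<^sup>2)"
proof -
  have "(norm (\<Sum>i\<in>I. f i))\<^sup>2 \<le> (\<Sum>i\<in>I. norm (f i))\<^sup>2"
    by (intro power_mono norm_sum) simp
  also have "\<dots> \<le> (\<Sum>i\<in>I. (norm (f i))\<^sup>2) * real (card I)"
    by (rule sum_squared_le_sum_of_squares)
  finally show ?thesis by (simp add: mult.commute)
qed

text \<open>\<open>A\<close> bounds point values, \<open>hausdorff_const\<close> the face measure,
  the bracket is the factor of \<open>sum_diameter_faces_le\<close>, and \<open>\<rho> ^ n\<close>
  converts diameters of elements into radii.\<close>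

definition trace_const :: "nat \<Rightarrow> real \<Rightarrow> real \<Rightarrow> real" where
  "trace_const n \<rho> A = A * hausdorff_const n * (2 ^ Suc n * (2 / \<rho>\<^sup>2) ^ n) / \<rho> ^ n"

text \<open>The pointwise gain \<open>\<rho>\<^sup>2 / 4\<close> on the half-size ball, divided by
  the cost of bounding the norm on the element by the one on that ball.\<close>

definition bubble_const :: "nat \<Rightarrow> real \<Rightarrow> real \<Rightarrow> real" where
  "bubble_const n \<rho> A = \<rho>\<^sup>2 / (4 * (unit_ball_vol (real n) * A * (2 / \<rho>) ^ n))"

text \<open>The element field is a sum of \<open>(n + 1)\<^sup>2\<close> terms, each of size at most
  \<open>norm (g x) / \<rho>\<^sup>2\<close>.\<close>

definition bubble_bound :: "nat \<Rightarrow> real \<Rightarrow> real" where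
  "bubble_bound n \<rho> = ((real n + 1)\<^sup>2 / \<rho>\<^sup>2)\<^sup>2"

text \<open>Volume of the element times the sup bound gives \<open>\<rho> ^ n\<close>; the two
  further powers of \<open>\<rho>\<close> come from the square of the ratio of
  \<open>norm (x - a)\<close> to the height over the face.\<close>

definition face_const :: "nat \<Rightarrow> real \<Rightarrow> real \<Rightarrow> real" where
  "face_const n \<rho> A = unit_ball_vol (real n) * A * slab_const n / \<rho> ^ (n + 2)"

definition reg_const :: "nat \<Rightarrow> real \<Rightarrow> real \<Rightarrow> real" where
  "reg_const n \<rho> A = 2 ^ Suc n * face_const n \<rho> A"

text \<open>The inf-sup quotient: \<open>m\<close> is the coercivity of the pairing with the
  combined test field, and the denominator bounds the square of the norm of that field.\<close>

definition lower_const :: "nat \<Rightarrow> real \<Rightarrow> real \<Rightarrow> real" where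
  "lower_const n \<rho> A =
    (let c = bubble_const n \<rho> A; R = reg_const n \<rho> A; \<delta> = c / (2 * R); m = min (c / 2) (\<delta> / 4)
     in m\<^sup>2 / (2 * bubble_bound n \<rho> + 2 * \<delta>\<^sup>2 * R))"

lemma constants_pos:
  assumes "\<rho> > 0" "A > 0"
  shows "trace_const n \<rho> A > 0" "bubble_const n \<rho> A > 0" "bubble_bound n \<rho> \<ge> 0"
    "face_const n \<rho> A > 0" "reg_const n \<rho> A > 0" "lower_const n \<rho> A > 0"
proof -
  show "trace_const n \<rho> A > 0" using assms hausdorff_const_pos[of n] by (simp add: trace_const_def)
  show c: "bubble_const n \<rho> A > 0" using assms by (simp add: bubble_const_def)
  show b: "bubble_bound n \<rho> \<ge> 0" by (simp add: bubble_bound_def)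
  show f: "face_const n \<rho> A > 0" using assms slab_const_pos[of n] by (simp add: face_const_def)
  show r: "reg_const n \<rho> A > 0" using f by (simp add: reg_const_def)
  show "lower_const n \<rho> A > 0" unfolding lower_const_def Let_def using c b r
    by (intro divide_pos_pos zero_less_power add_nonneg_pos) auto
qed

context dg_mesh
begin

lemmas C_trace_pos = constants_pos(1)[OF \<rho>(1) A_pos, of "CARD('n)"]
  and C_bubble_pos = constants_pos(2)[OF \<rho>(1) A_pos, of "CARD('n)"]
  and C_face_pos = constants_pos(4)[OF \<rho>(1) A_pos, of "CARD('n)"]
  and C_reg_pos = constants_pos(5)[OF \<rho>(1) A_pos, of "CARD('n)"]

lemma vec_sup_bound:
  fixes \<sigma> :: "real^'n \<Rightarrow> real^'n"
  assumes \<sigma>: "\<sigma> \<in> vec_poly_space (k + 1)" and r: "r > 0" and y: "y \<in> cball x0 (2 / \<rho> * r)"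
  shows "(norm (\<sigma> y))\<^sup>2 \<le> A / r ^ CARD('n) * (LINT x:cball x0 r|lborel. (norm (\<sigma> x))\<^sup>2)"
proof -
  have \<sigma>i: "(\<lambda>x. \<sigma> x $ i) \<in> poly_space (k + 1)" for i using \<sigma> by (simp add: vec_poly_space_def)
  have sq: "(norm (v :: real^'n))\<^sup>2 = (\<Sum>i\<in>UNIV. (v $ i)\<^sup>2)" for v
    by (simp add: power2_norm_eq_inner inner_vec_def) (simp add: power2_eq_square)
  have "(norm (\<sigma> y))\<^sup>2 \<le> (\<Sum>i\<in>UNIV. A / r ^ CARD('n) * (LINT x:cball x0 r|lborel. (\<sigma> x $ i)\<^sup>2))"
    unfolding sq by (intro sum_mono A[OF \<sigma>i r y])
  also have "\<dots> = A / r ^ CARD('n) * (\<Sum>i\<in>UNIV. LINT x:cball x0 r|lborel. (\<sigma> x $ i)\<^sup>2)"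
    by (simp add: sum_distrib_left)
  also have "(\<Sum>i\<in>UNIV. LINT x:cball x0 r|lborel. (\<sigma> x $ i)\<^sup>2) =
      (LINT x:cball x0 r|lborel. (norm (\<sigma> x))\<^sup>2)"
    unfolding sq by (intro set_integral_finite_sum[symmetric] set_integrable_continuous_lborel
        continuous_on_power poly_space_continuous[OF \<sigma>i]) simp
  finally show ?thesis .
qed

lemma continuous_norm_square:
  "continuous_on UNIV \<sigma> \<Longrightarrow> continuous_on UNIV (\<lambda>x. (norm (\<sigma> x))\<^sup>2 :: real)"
  by (intro continuous_intros)

text \<open>Valid at every point of \<open>K\<close>, boundary included, so that traces on a face
  need only be multiplied by the measure of the face.\<close>

lemma trace_bound:
  assumes \<sigma>: "\<sigma> \<in> vec_poly_space (k + 1)" and K: "K \<in> T" and y: "y \<in> K"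
  shows "(norm (\<sigma> y))\<^sup>2 \<le> A / rad K ^ CARD('n) * (LINT x:K|lborel. (norm (\<sigma> x))\<^sup>2)"
proof -
  have c: "centre K \<in> K" using rad[OF K] by auto
  have "diameter K \<le> 2 / \<rho> * rad K" using diameter_le_rad[OF K] rad(1)[OF K] \<rho>(1)
    by (simp add: field_simps)
  then have "y \<in> cball (centre K) (2 / \<rho> * rad K)"
    using subset_cball_T[OF K c] y by auto
  then have "(norm (\<sigma> y))\<^sup>2 \<le>
      A / rad K ^ CARD('n) * (LINT x:cball (centre K) (rad K)|lborel. (norm (\<sigma> x))\<^sup>2)"
    by (rule vec_sup_bound[OF \<sigma> rad(1)[OF K]])
  also have "\<dots> \<le> A / rad K ^ CARD('n) * (LINT x:K|lborel. (norm (\<sigma> x))\<^sup>2)"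
    using A_pos rad(1)[OF K] rad(2)[OF K]
    by (intro mult_left_mono set_integral_mono_set set_integrable_T[OF K] continuous_norm_square
        vec_poly_space_continuous[OF \<sigma>]) auto
  finally show ?thesis .
qed

lemma measure_T_le:
  assumes K: "K \<in> T"
  shows "measure lborel K \<le> unit_ball_vol (real CARD('n)) * (rad K / \<rho>) ^ CARD('n)"
proof -
  have c: "centre K \<in> K" using rad[OF K] by auto
  have "measure lborel K \<le> measure lborel (cball (centre K) (rad K / \<rho>))"
  proof (rule measure_mono_fmeasurable)
    show "K \<subseteq> cball (centre K) (rad K / \<rho>)"
      using subset_cball_T[OF K c] diameter_le_rad[OF K] by (meson order_trans subset_cball)
    show "K \<in> sets lborel" using compact_T[OF K] by (simp add: borel_compact)
    show "cball (centre K) (rad K / \<rho>) \<in> fmeasurable lborel" 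
      by (intro fmeasurableI) (use emeasure_compact_finite[OF compact_cball] in auto)
  qed
  also have "\<dots> = unit_ball_vol (real CARD('n)) * (rad K / \<rho>) ^ CARD('n)"
    using rad(1)[OF K] \<rho>(1) by (simp add: content_cball)
  finally show ?thesis .
qed

section \<open>Squared broken norms and the stability of the lifting\<close>

definition vol_norm2 :: "((real^'n) set \<Rightarrow> real^'n \<Rightarrow> real^'n) \<Rightarrow> real" where
  "vol_norm2 \<sigma> = (\<Sum>K\<in>T. LINT x:K|lborel. (norm (\<sigma> K x))\<^sup>2)"

definition face_norm2 :: "((real^'n) set \<Rightarrow> real^'n \<Rightarrow> real) \<Rightarrow> real" where
  "face_norm2 \<phi> = (\<Sum>F\<in>faces. 1 / diameter F * (LINT x:F|surface_measure. (\<phi> F x)\<^sup>2))"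

lemma vol_norm2_nonneg: "vol_norm2 \<sigma> \<ge> 0"
  unfolding vol_norm2_def by (intro sum_nonneg set_integral_nonneg_real) simp

lemma face_norm2_nonneg: "face_norm2 \<phi> \<ge> 0"
  unfolding face_norm2_def using diameter_face_pos
  by (intro sum_nonneg mult_nonneg_nonneg set_integral_nonneg_real) (auto intro: less_imp_le)

lemma vol_young:
  assumes f: "\<And>K. K \<in> T \<Longrightarrow> continuous_on UNIV (f K)" and g: "\<And>K. K \<in> T \<Longrightarrow> continuous_on UNIV (g K)"
    and s: "s > 0"
  shows "(\<Sum>K\<in>T. LINT x:K|lborel. f K x \<bullet> g K x) \<le> s / 2 * vol_norm2 f + 1 / (2 * s) * vol_norm2 g"
proof -
  have "(\<Sum>K\<in>T. LINT x:K|lborel. f K x \<bullet> g K x) \<le>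
      (\<Sum>K\<in>T. s / 2 * (LINT x:K|lborel. (norm (f K x))\<^sup>2) + 1 / (2 * s) * (LINT x:K|lborel. (norm
        (g K x))\<^sup>2))"
  proof (intro sum_mono)
    fix K assume K: "K \<in> T"
    have int: "set_integrable lborel K (\<lambda>x. c * (norm (h K x))\<^sup>2)" if "continuous_on UNIV (h K)"
      for c and h :: "(real^'n) set \<Rightarrow> real^'n \<Rightarrow> real^'n"
      using that by (intro set_integrable_T[OF K] continuous_intros)
    have "(LINT x:K|lborel. f K x \<bullet> g K x) \<le>
        (LINT x:K|lborel. s / 2 * (norm (f K x))\<^sup>2 + 1 / (2 * s) * (norm (g K x))\<^sup>2)"
      using f[OF K] g[OF K] young_inner[OF s]
      by (intro set_integral_mono set_integrable_T[OF K] continuous_intros) auto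
    also have "\<dots> = (LINT x:K|lborel. s / 2 * (norm (f K x))\<^sup>2) +
        (LINT x:K|lborel. 1 / (2 * s) * (norm (g K x))\<^sup>2)"
      by (intro set_integral_add int f[OF K] g[OF K])
    finally show "(LINT x:K|lborel. f K x \<bullet> g K x) \<le>
        s / 2 * (LINT x:K|lborel. (norm (f K x))\<^sup>2) + 1 / (2 * s) * (LINT x:K|lborel. (norm
          (g K x))\<^sup>2)"
      by (simp only: set_integral_mult_right)
  qed
  also have "\<dots> = s / 2 * vol_norm2 f + 1 / (2 * s) * vol_norm2 g"
    by (simp add: vol_norm2_def sum.distrib sum_distrib_left)
  finally show ?thesis .
qed

lemma vol_norm2_add:
  assumes f: "\<And>K. K \<in> T \<Longrightarrow> continuous_on UNIV (f K)" and g: "\<And>K. K \<in> T \<Longrightarrow> continuous_on UNIV (g K)"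
    and h: "\<And>K x. K \<in> T \<Longrightarrow> h K x = f K x + g K x"
  shows "vol_norm2 h \<le> 2 * vol_norm2 f + 2 * vol_norm2 g"
proof -
  have "vol_norm2 h \<le> (\<Sum>K\<in>T. 2 * (LINT x:K|lborel. (norm (f K x))\<^sup>2) +
      2 * (LINT x:K|lborel. (norm (g K x))\<^sup>2))"
    unfolding vol_norm2_def
  proof (intro sum_mono)
    fix K assume K: "K \<in> T"
    have hK: "h K = (\<lambda>x. f K x + g K x)" using h[OF K] by auto
    have "(norm (v + w))\<^sup>2 \<le> 2 * (norm v)\<^sup>2 + 2 * (norm w)\<^sup>2" for v w :: "real^'n"
      using zero_le_power2[of "norm (v - w)"] unfolding power2_norm_eq_inner
      by (simp add: inner_add_left inner_add_right inner_diff_left inner_diff_right inner_commute)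
    then have "(LINT x:K|lborel. (norm (h K x))\<^sup>2) \<le>
        (LINT x:K|lborel. 2 * (norm (f K x))\<^sup>2 + 2 * (norm (g K x))\<^sup>2)"
      unfolding hK using f[OF K] g[OF K]
      by (intro set_integral_mono set_integrable_T[OF K] continuous_intros) auto
    also have "\<dots> = (LINT x:K|lborel. 2 * (norm (f K x))\<^sup>2) + (LINT x:K|lborel. 2 * (norm (g K x))\<^sup>2)"
      using f[OF K] g[OF K] by (intro set_integral_add set_integrable_T[OF K] continuous_intros)
    finally show "(LINT x:K|lborel. (norm (h K x))\<^sup>2) \<le>
        2 * (LINT x:K|lborel. (norm (f K x))\<^sup>2) + 2 * (LINT x:K|lborel. (norm (g K x))\<^sup>2)"
      by (simp only: set_integral_mult_right)
  qed
  also have "\<dots> = 2 * vol_norm2 f + 2 * vol_norm2 g"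
    by (simp add: vol_norm2_def sum.distrib sum_distrib_left)
  finally show ?thesis .
qed

lemma card_adj_le: "F \<in> faces \<Longrightarrow> card (adj F) \<le> 2"
  using adj_interior(1)[of F] adj_boundary(1)[of F] card_insert_le_m1[of 2 "{K_int D F}"
    "K_ext D F"]
  by (cases "F \<in> interior_faces T") auto

lemma average_square_le:
  assumes F: "F \<in> faces"
  shows "(average T D (\<lambda>K y. \<sigma> K y \<bullet> face_normal D F) F x)\<^sup>2 \<le> 2 * (\<Sum>K\<in>adj F. (norm (\<sigma> K x))\<^sup>2)"
proof -
  let ?s = "\<Sum>K\<in>adj F. \<sigma> K x \<bullet> face_normal D F"
  have w: "0 \<le> weight F" "weight F \<le> 1" by (auto simp: weight_def)
  have "(weight F * ?s)\<^sup>2 = (weight F)\<^sup>2 * ?s\<^sup>2" by (rule power_mult_distrib)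
  also have "\<dots> \<le> 1 * ?s\<^sup>2" using w by (intro mult_right_mono) (auto intro: power_le_one)
  also have "\<dots> \<le> (\<Sum>K\<in>adj F. (\<sigma> K x \<bullet> face_normal D F)\<^sup>2) * real (card (adj F))"
    using sum_squared_le_sum_of_squares by simp
  also have "\<dots> \<le> (\<Sum>K\<in>adj F. (norm (\<sigma> K x))\<^sup>2) * 2"
  proof (intro mult_mono sum_mono)
    fix K
    have "\<bar>\<sigma> K x \<bullet> face_normal D F\<bar> \<le> norm (\<sigma> K x)"
      using Cauchy_Schwarz_ineq2[of "\<sigma> K x" "face_normal D F"] norm_face_normal[OF F] by simp
    then show "(\<sigma> K x \<bullet> face_normal D F)\<^sup>2 \<le> (norm (\<sigma> K x))\<^sup>2"
      by (metis abs_ge_zero power2_abs power_mono)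
  qed (use card_adj_le[OF F] in \<open>auto intro: sum_nonneg\<close>)
  finally show ?thesis by (simp add: average_normal[OF F] mult.commute)
qed

text \<open>The discrete trace inequality in Young form. The parameter \<open>t\<close> stays free
  so that the volume term can later be absorbed.\<close>

lemma face_form_le:
  assumes \<phi>: "\<And>F. F \<in> faces \<Longrightarrow> continuous_on UNIV (\<phi> F)" and \<sigma>: "\<sigma> \<in> dg_vec_space T (k + 1)"
    and t: "t > 0"
  shows "face_form \<phi> \<sigma> \<le> 1 / (2 * t) * face_norm2 \<phi> + t * trace_const CARD('n) \<rho> A * vol_norm2 \<sigma>"
proof -
  let ?n = "CARD('n)"
  define S where "S K = (LINT x:K|lborel. (norm (\<sigma> K x))\<^sup>2)" for K
  have S0: "S K \<ge> 0" for K unfolding S_def by (intro set_integral_nonneg_real) simp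
  have "face_form \<phi> \<sigma> \<le> (\<Sum>F\<in>faces. 1 / (2 * t) *
      (1 / diameter F * (LINT x:F|surface_measure. (\<phi> F x)\<^sup>2)) +
      (\<Sum>K\<in>adj F. t * A * hausdorff_const CARD('n) * (S K / rad K ^ ?n * diameter F ^ ?n)))"
    unfolding face_form_def
  proof (intro sum_mono)
    fix F assume F: "F \<in> faces"
    let ?avg = "\<lambda>x. average T D (\<lambda>K y. \<sigma> K y \<bullet> face_normal D F) F x" and ?h = "diameter F"
    have h: "?h > 0" using diameter_face_pos[OF F] .
    have avg_cont: "continuous_on UNIV ?avg"
      unfolding average_normal[OF F] using dg_vec_space_continuous[OF \<sigma>]
      by (intro continuous_intros) (auto simp: adj_def)
    have "(LINT x:F|surface_measure. \<phi> F x * ?avg x) \<le>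
        (LINT x:F|surface_measure. 1 / (2 * t * ?h) * (\<phi> F x)\<^sup>2 + t * ?h / 2 * (?avg x)\<^sup>2)"
    proof (intro set_integral_mono set_integrable_face[OF F])
      \<comment> \<open>Young's inequality with parameter \<open>t * ?h\<close> produces exactly the
        weight \<open>1 / ?h\<close> of the jump norm.\<close>
      show "\<phi> F x * ?avg x \<le> 1 / (2 * t * ?h) * (\<phi> F x)\<^sup>2 + t * ?h / 2 * (?avg x)\<^sup>2" for x
        using young_real[of "t * ?h" "?avg x" "\<phi> F x"] t h by (simp add: mult_ac)
    qed (intro continuous_intros \<phi>[OF F] avg_cont)+
    also have "\<dots> = (LINT x:F|surface_measure. 1 / (2 * t * ?h) * (\<phi> F x)\<^sup>2) +
        (LINT x:F|surface_measure. t * ?h / 2 * (?avg x)\<^sup>2)"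
      by (intro set_integral_add set_integrable_face[OF F] continuous_intros \<phi>[OF F] avg_cont)
    also have "\<dots> = 1 / (2 * t) * (1 / ?h * (LINT x:F|surface_measure. (\<phi> F x)\<^sup>2)) +
        t * ?h / 2 * (LINT x:F|surface_measure. (?avg x)\<^sup>2)"
      by (simp only: set_integral_mult_right) simp
    also have "t * ?h / 2 * (LINT x:F|surface_measure. (?avg x)\<^sup>2) \<le>
        (\<Sum>K\<in>adj F. t * A * hausdorff_const CARD('n) * (S K / rad K ^ ?n * ?h ^ ?n))"
    proof -
      define b where "b = 2 * (\<Sum>K\<in>adj F. A / rad K ^ ?n * S K)"
      have "(?avg x)\<^sup>2 \<le> b" if x: "x \<in> F" for x
      proof -
        have "(norm (\<sigma> K x))\<^sup>2 \<le> A / rad K ^ ?n * S K" if "K \<in> adj F" for K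
          using trace_bound[of "\<sigma> K" K x] dg_vec_space_poly[OF \<sigma>, of K] that x
            by (auto simp: adj_def S_def)
        then have "(\<Sum>K\<in>adj F. (norm (\<sigma> K x))\<^sup>2) \<le> (\<Sum>K\<in>adj F. A / rad K ^ ?n * S K)"
          by (rule sum_mono)
        then show ?thesis using average_square_le[OF F, of \<sigma> x] by (simp add: b_def)
      qed
      then have "(LINT x:F|surface_measure. (?avg x)\<^sup>2) \<le> measure surface_measure F * b"
        by (intro set_integral_le_measure sets_surface_measure compact_face[OF F]
          emeasure_face_finite[OF F]
            continuous_on_power avg_cont)
      also have "\<dots> \<le> (hausdorff_const CARD('n) * ?h ^ (?n - 1)) * b"
      proof (intro mult_right_mono measure_face_le[OF F])
        show "b \<ge> 0" unfolding b_def using A_pos S0 rad(1)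
          by (intro mult_nonneg_nonneg sum_nonneg) (auto simp: adj_def intro: less_imp_le)
      qed
      finally have "t * ?h / 2 * (LINT x:F|surface_measure. (?avg x)\<^sup>2) \<le>
          t * ?h / 2 * ((hausdorff_const CARD('n) * ?h ^ (?n - 1)) * b)"
        using t h by (intro mult_left_mono) auto
      also have "\<dots> = t * hausdorff_const CARD('n) / 2 * (?h ^ (?n - 1) * ?h) * b" by simp
      \<comment> \<open>The factor from Young's inequality completes the face measure to the full
        power, which balances \<open>rad K ^ ?n\<close> of the sup bound.\<close>
      also have "?h ^ (?n - 1) * ?h = ?h ^ ?n" by (rule power_minus_mult) simp
      also have "t * hausdorff_const CARD('n) / 2 * ?h ^ ?n * b =
          (\<Sum>K\<in>adj F. t * A * hausdorff_const CARD('n) * (S K / rad K ^ ?n * ?h ^ ?n))"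
        by (simp add: b_def sum_distrib_left mult_ac)
      finally show ?thesis .
    qed
    finally show "(LINT x:F|surface_measure. \<phi> F x * ?avg x) \<le>
        1 / (2 * t) * (1 / ?h * (LINT x:F|surface_measure. (\<phi> F x)\<^sup>2)) +
          (\<Sum>K\<in>adj F. t * A * hausdorff_const CARD('n) * (S K / rad K ^ ?n * ?h ^ ?n))"
      by simp
  qed
  also have "\<dots> = 1 / (2 * t) * face_norm2 \<phi> +
      (\<Sum>F\<in>faces. \<Sum>K\<in>adj F. t * A * hausdorff_const CARD('n) * (S K / rad K ^ ?n * diameter F ^ ?n))"
    by (simp add: sum.distrib face_norm2_def sum_distrib_left)
  \<comment> \<open>Regrouped by elements: now all faces in one element are met together, and the
    sum of the powers of their diameters is bounded by that of the element.\<close>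
  also have "(\<Sum>F\<in>faces. \<Sum>K\<in>adj F. t * A * hausdorff_const CARD('n) * (S K / rad K ^ ?n * diameter F
      ^ ?n)) =
      (\<Sum>K\<in>T. t * A * hausdorff_const CARD('n) * (S K / rad K ^ ?n) *
        (\<Sum>F | F \<in> faces \<and> F \<subseteq> K. diameter F ^ ?n))"
    unfolding sum_faces_adj by (simp add: sum_distrib_left mult_ac)
  also have "\<dots> \<le> (\<Sum>K\<in>T. t * trace_const CARD('n) \<rho> A * S K)"
  proof (intro sum_mono)
    fix K assume K: "K \<in> T"
    let ?C = "2 ^ Suc ?n * (2 / \<rho>\<^sup>2) ^ ?n"
    have "(\<Sum>F | F \<in> faces \<and> F \<subseteq> K. diameter F ^ ?n) \<le> ?C * diameter K ^ ?n"
      by (rule sum_diameter_faces_le[OF K])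
    also have "\<dots> \<le> ?C * (rad K / \<rho>) ^ ?n"
      using diameter_le_rad[OF K] diameter_T_pos[OF K] \<rho> by (intro mult_left_mono power_mono) auto
    finally have "t * A * hausdorff_const CARD('n) * (S K / rad K ^ ?n) * (\<Sum>F | F \<in> faces \<and> F \<subseteq>
        K. diameter F ^ ?n) \<le>
        t * A * hausdorff_const CARD('n) * (S K / rad K ^ ?n) * (?C * (rad K / \<rho>) ^ ?n)"
      using t A_pos hausdorff_const_pos[of "CARD('n)"] S0 rad(1)[OF K]
        by (intro mult_left_mono) auto
    also have "\<dots> = t * trace_const CARD('n) \<rho> A * S K"
      using rad(1)[OF K] by (simp add: trace_const_def power_divide field_simps)
    finally show "t * A * hausdorff_const CARD('n) * (S K / rad K ^ ?n) * (\<Sum>F | F \<in> faces \<and> F \<subseteq>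
        K. diameter F ^ ?n) \<le> t * trace_const CARD('n) \<rho> A * S K" .
  qed
  also have "\<dots> = t * trace_const CARD('n) \<rho> A * vol_norm2 \<sigma>"
    by (simp add: vol_norm2_def S_def sum_distrib_left)
  finally show ?thesis by simp
qed

text \<open>The lifting is its own test field. With \<open>t\<close> equal to 1 over twice the trace
  constant, the volume term takes half of the left-hand side and is absorbed.\<close>

lemma lifting_bound:
  assumes \<phi>: "\<And>F. F \<in> faces \<Longrightarrow> continuous_on UNIV (\<phi> F)"
  shows "vol_norm2 (lifting \<Omega> T D (k + 1) \<phi>) \<le> 2 * trace_const CARD('n) \<rho> A * face_norm2 \<phi>"
proof -
  let ?r = "lifting \<Omega> T D (k + 1) \<phi>"
  have r: "?r \<in> dg_vec_space T (k + 1)" using lifting_spec(1)[where \<phi> = \<phi>, OF \<phi>] .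
  have "vol_norm2 ?r = (\<Sum>K\<in>T. LINT x:K|lborel. ?r K x \<bullet> ?r K x)"
    by (simp add: vol_norm2_def power2_norm_eq_inner)
  also have "\<dots> = face_form \<phi> ?r" using lifting_spec(2)[where \<phi> = \<phi>, OF \<phi> r] .
  also have "\<dots> \<le> 1 / (2 * (1 / (2 * trace_const CARD('n) \<rho> A))) * face_norm2 \<phi> +
      1 / (2 * trace_const CARD('n) \<rho> A) * trace_const CARD('n) \<rho> A * vol_norm2 ?r"
    using face_form_le[where \<phi> = \<phi>, OF \<phi> r, of "1 / (2 * trace_const CARD('n) \<rho> A)"] C_trace_pos
      by simp
  finally show ?thesis using C_trace_pos by simp
qed

subsection \<open>Test functions\<close>

text \<open>For an edge direction \<open>a - b\<close> the field \<open>\<lambda>\<^sub>a \<lambda>\<^sub>b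
  (a - b)\<close> is tangential on every face: either one
  of the barycentric coordinates vanishes there, or the face contains the edge.\<close>

lemma element_test_function:
  assumes K: "K \<in> T" and g: "g \<in> vec_poly_space (k - 1)"
  shows "\<exists>\<tau>\<in>vec_poly_space (k + 1).
    (\<forall>F\<in>faces. K \<in> adj F \<longrightarrow> (\<forall>x\<in>F. \<tau> x \<bullet> face_normal D F = 0)) \<and>
    bubble_const CARD('n) \<rho> A * (LINT x:K|lborel. (norm (g x))\<^sup>2) \<le> (LINT x:K|lborel. g x \<bullet> \<tau> x) \<and>
    (LINT x:K|lborel. (norm (\<tau> x))\<^sup>2) \<le> bubble_bound CARD('n) \<rho> * (LINT x:K|lborel. (norm (g x))\<^sup>2)"
proof -
  let ?V = "vertices K" and ?r = "rad K" and ?l = "barycentric K" and ?n = "CARD('n)"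
  note S = simplex_T[OF K] and V = simplex_vertices[OF simplex_T[OF K]]
  have r: "?r > 0" using rad(1)[OF K] .
  \<comment> \<open>Division by the squared radius compensates for the two edge vectors, so that the
    field has the size of \<open>g\<close>. The degree is \<open>k - 1\<close> plus one for each
    coordinate.\<close>
  define c where "c a b x = ?l a x * ?l b x * (g x \<bullet> (a - b)) / ?r\<^sup>2" for a b x
  define \<tau> where "\<tau> x = (\<Sum>a\<in>?V. \<Sum>b\<in>?V. c a b x *\<^sub>R (a - b))" for x
  have cp: "c a b \<in> poly_space (k + 1)" if "a \<in> ?V" "b \<in> ?V" for a b
  proof -
    have "(\<lambda>x. ?l a x * ?l b x * (g x \<bullet> (a - b)) * (1 / ?r\<^sup>2)) \<in> poly_space (1 + 1 + (k - 1))"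
      using that by (intro poly_space_scale_right poly_space_mult poly_space_inner_vec[OF g]
        barycentric_poly_space[OF S])
    then show ?thesis using k unfolding c_def by simp
  qed
  have "(\<lambda>x. c a b x *\<^sub>R (a - b)) \<in> vec_poly_space (k + 1 + 0)" if "a \<in> ?V" "b \<in> ?V" for a b
    by (intro vec_poly_space_mult cp that vec_poly_space_const)
  then have \<tau>: "\<tau> \<in> vec_poly_space (k + 1)"
    unfolding \<tau>_def by (intro vec_poly_space_sum) simp
  have g': "g \<in> vec_poly_space (k + 1)" using g by (rule vec_poly_space_mono) simp
  have cont: "continuous_on UNIV g" "continuous_on UNIV \<tau>" "continuous_on UNIV (\<lambda>x. g x \<bullet> \<tau> x)"
    using vec_poly_space_continuous[OF g] vec_poly_space_continuous[OF \<tau>]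
      by (auto intro: continuous_on_inner)
  have g\<tau>: "g x \<bullet> \<tau> x = (\<Sum>a\<in>?V. \<Sum>b\<in>?V. ?l a x * ?l b x * (g x \<bullet> (a - b))\<^sup>2 / ?r\<^sup>2)" for x
    by (simp add: \<tau>_def c_def inner_sum_right power2_eq_square mult_ac)
  have nonneg: "0 \<le> ?l a x * ?l b x * (g x \<bullet> (a - b))\<^sup>2 / ?r\<^sup>2" if "x \<in> K" "a \<in> ?V" "b \<in> ?V" for a b x
    using barycentric_expansion(1)[OF S that(1)] that by simp
  have tangential: "\<tau> x \<bullet> face_normal D F = 0" if F: "F \<in> faces" "K \<in> adj F" "x \<in> F" for F x
  proof -
    have xK: "x \<in> K" using F by (auto simp: adj_def)
    have "c a b x * ((a - b) \<bullet> outer_normal F K) = 0" if ab: "a \<in> ?V" "b \<in> ?V" for a b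
    proof (cases "?l a x = 0 \<or> ?l b x = 0")
      case False
      then have "(x - a) \<bullet> outer_normal F K = 0" "(x - b) \<bullet> outer_normal F K = 0"
        using outward_normal_orthogonal_edge[OF S outer_normal[OF F(1,2)] F(3) xK] ab by auto
      then show ?thesis by (simp add: inner_diff_left)
    qed (auto simp: c_def)
    then have "\<tau> x \<bullet> outer_normal F K = 0"
      unfolding \<tau>_def inner_sum_left inner_scaleR_left by (intro sum.neutral ballI)
    then show ?thesis by (auto simp: outer_normal_def split: if_splits)
  qed
  \<comment> \<open>On the half-size ball all barycentric coordinates are bounded below, so one long
    edge in the direction of \<open>g x\<close> suffices; all other terms are nonnegative on
    \<open>K\<close>.\<close>
  let ?H = "cball (centre K) (?r / 2)"
  have HK: "?H \<subseteq> K" using rad(2)[OF K] r subset_cball[of "?r / 2" ?r "centre K"] by simp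
  have lower: "\<rho>\<^sup>2 / 4 * (norm (g x))\<^sup>2 \<le> g x \<bullet> \<tau> x" if x: "x \<in> ?H" for x
  proof -
    obtain a b where ab: "a \<in> ?V" "b \<in> ?V" "(a - b) \<bullet> g x \<ge> 2 * ?r * norm (g x)"
      using exists_long_edge[OF S rad(2)[OF K] r, of "g x"] by blast
    have l: "?l a x \<ge> \<rho> / 4" "?l b x \<ge> \<rho> / 4"
      using ab by (auto simp only: intro!: barycentric_lower_bound[OF S _ \<rho> rad(3)[OF K] rad(2)[OF
        K] x r])
    have "(\<rho> / 4) * (\<rho> / 4) \<le> ?l a x * ?l b x" using l \<rho> by (intro mult_mono) auto
    moreover have "(2 * ?r * norm (g x))\<^sup>2 \<le> (g x \<bullet> (a - b))\<^sup>2"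
      using ab(3) r by (intro power_mono) (auto simp: inner_commute)
    ultimately have "(\<rho> / 4) * (\<rho> / 4) * (2 * ?r * norm (g x))\<^sup>2 \<le>
        ?l a x * ?l b x * (g x \<bullet> (a - b))\<^sup>2"
      using \<rho> l by (intro mult_mono) auto
    then have "(\<rho> / 4) * (\<rho> / 4) * (2 * ?r * norm (g x))\<^sup>2 / ?r\<^sup>2 \<le>
        ?l a x * ?l b x * (g x \<bullet> (a - b))\<^sup>2 / ?r\<^sup>2"
      by (intro divide_right_mono) auto
    also have "(\<rho> / 4) * (\<rho> / 4) * (2 * ?r * norm (g x))\<^sup>2 / ?r\<^sup>2 = \<rho>\<^sup>2 / 4 * (norm (g x))\<^sup>2"
      using r by (simp add: power2_eq_square)
    also have "?l a x * ?l b x * (g x \<bullet> (a - b))\<^sup>2 / ?r\<^sup>2 \<le>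
        (\<Sum>b\<in>?V. ?l a x * ?l b x * (g x \<bullet> (a - b))\<^sup>2 / ?r\<^sup>2)"
      using ab V(2) nonneg[of x a] x HK
        by (intro member_le_sum[of b ?V "\<lambda>b. ?l a x * ?l b x * (g x \<bullet> (a - b))\<^sup>2 / ?r\<^sup>2"]) auto
    also have "\<dots> \<le> (\<Sum>a\<in>?V. \<Sum>b\<in>?V. ?l a x * ?l b x * (g x \<bullet> (a - b))\<^sup>2 / ?r\<^sup>2)"
      using ab V(2) nonneg[of x] x HK
      by (intro member_le_sum[of a ?V
        "\<lambda>a. \<Sum>b\<in>?V. ?l a x * ?l b x * (g x \<bullet> (a - b))\<^sup>2 / ?r\<^sup>2"] sum_nonneg) auto
    finally show ?thesis by (simp only: g\<tau>)
  qed
  define I where "I = (LINT x:?H|lborel. (norm (g x))\<^sup>2)"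
  have I0: "I \<ge> 0" unfolding I_def by (intro set_integral_nonneg_real) simp
  let ?c0 = "unit_ball_vol (real ?n) * A * (2 / \<rho>) ^ ?n"
  have c0: "?c0 > 0" using A_pos \<rho> by simp
  have gsq: "continuous_on UNIV (\<lambda>x. (norm (g x))\<^sup>2)" using cont(1) by (rule continuous_norm_square)
  \<comment> \<open>Gradients are polynomials, so their norm on the element is controlled by the
    half-size ball, where the lower bound is available.\<close>
  have "(LINT x:K|lborel. (norm (g x))\<^sup>2) \<le> measure lborel K * (A / (?r / 2) ^ ?n * I)"
  proof (rule set_integral_le_measure)
    show "emeasure lborel K < \<infinity>" using emeasure_compact_finite[OF compact_T[OF K]] by simp
    fix y assume y: "y \<in> K"
    have c: "centre K \<in> K" using rad(2)[OF K] r by auto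
    have "2 / \<rho> * (?r / 2) = ?r / \<rho>" by simp
    then have "y \<in> cball (centre K) (2 / \<rho> * (?r / 2))"
      using subset_cball_T[OF K c] y diameter_le_rad[OF K]
        by (auto simp del: times_divide_eq_left times_divide_eq_right)
    then show "(norm (g y))\<^sup>2 \<le> A / (?r / 2) ^ ?n * I"
      unfolding I_def using r by (intro vec_sup_bound[OF g']) auto
  qed (use compact_T[OF K] gsq in auto)
  also have "\<dots> \<le> unit_ball_vol (real ?n) * (?r / \<rho>) ^ ?n * (A / (?r / 2) ^ ?n * I)"
    using r A_pos I0 by (intro mult_right_mono measure_T_le[OF K]) auto
  also have "\<dots> = ?c0 * I" using r \<rho> by (simp add: power_divide field_simps)
  finally have gI: "(LINT x:K|lborel. (norm (g x))\<^sup>2) \<le> ?c0 * I" .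
  have "bubble_const CARD('n) \<rho> A * (LINT x:K|lborel. (norm (g x))\<^sup>2) \<le>
      bubble_const CARD('n) \<rho> A * (?c0 * I)"
    using gI C_bubble_pos by (intro mult_left_mono) auto
  also have "\<dots> = \<rho>\<^sup>2 / 4 * I"
  proof -
    have "\<rho>\<^sup>2 / (4 * c) * c = \<rho>\<^sup>2 / 4" if "c > 0" for c using that by simp
    then have "bubble_const CARD('n) \<rho> A * ?c0 = \<rho>\<^sup>2 / 4" unfolding bubble_const_def using c0
      by blast
    then show ?thesis by (simp only: mult.assoc[symmetric])
  qed
  also have "\<dots> = (LINT x:?H|lborel. \<rho>\<^sup>2 / 4 * (norm (g x))\<^sup>2)" unfolding I_def
    by (rule set_integral_mult_right[symmetric])
  also have "\<dots> \<le> (LINT x:?H|lborel. g x \<bullet> \<tau> x)"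
    using lower cont(3) gsq by
      (intro set_integral_mono set_integrable_continuous_lborel continuous_on_mult
        continuous_on_const) auto
  also have "\<dots> \<le> (LINT x:K|lborel. g x \<bullet> \<tau> x)"
  proof (intro set_integral_mono_set set_integrable_T[OF K] cont(3) HK)
    show "0 \<le> g x \<bullet> \<tau> x" if "x \<in> K" for x unfolding g\<tau> using nonneg[OF that] by (intro sum_nonneg)
  qed simp
  finally have 1: "bubble_const CARD('n) \<rho> A * (LINT x:K|lborel. (norm (g x))\<^sup>2) \<le>
      (LINT x:K|lborel. g x \<bullet> \<tau> x)" .
  have upper: "(norm (\<tau> x))\<^sup>2 \<le> bubble_bound CARD('n) \<rho> * (norm (g x))\<^sup>2" if x: "x \<in> K" for x
  proof -
    have ab: "norm (c a b x *\<^sub>R (a - b)) \<le> norm (g x) / \<rho>\<^sup>2" if "a \<in> ?V" "b \<in> ?V" for a b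
    proof -
      have "norm (a - b) \<le> diameter K"
        using diameter_bounded_bound[OF bounded_T[OF K], of a b] that V(5) by (auto simp: dist_norm)
      then have d: "norm (a - b) \<le> ?r / \<rho>" using diameter_le_rad[OF K] by simp
      have la: "0 \<le> ?l a x" "?l a x \<le> 1" "0 \<le> ?l b x" "?l b x \<le> 1"
        using barycentric_expansion(1)[OF S x] barycentric_le_1[OF S x] that by auto
      have "norm (c a b x *\<^sub>R (a - b)) = (?l a x * ?l b x) * \<bar>g x \<bullet> (a - b)\<bar> / ?r\<^sup>2 * norm (a - b)"
        using la by (simp add: c_def abs_mult)
      also have "\<dots> \<le> 1 * (norm (g x) * (?r / \<rho>)) / ?r\<^sup>2 * (?r / \<rho>)"
      proof (intro mult_mono divide_right_mono)
        show "?l a x * ?l b x \<le> 1" using la by (simp add: mult_le_one)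
        show "\<bar>g x \<bullet> (a - b)\<bar> \<le> norm (g x) * (?r / \<rho>)"
          using Cauchy_Schwarz_ineq2[of "g x" "a - b"] mult_left_mono[OF d, of "norm (g x)"] by simp
      qed (use d r \<rho> in auto)
      also have "\<dots> = norm (g x) / \<rho>\<^sup>2" using r by (simp add: power2_eq_square)
      finally show ?thesis .
    qed
    have "norm (\<tau> x) \<le> (\<Sum>a\<in>?V. \<Sum>b\<in>?V. norm (g x) / \<rho>\<^sup>2)"
      unfolding \<tau>_def using ab by (intro sum_norm_le)
    also have "\<dots> = (real ?n + 1)\<^sup>2 / \<rho>\<^sup>2 * norm (g x)"
      using V(3) by (simp add: power2_eq_square algebra_simps)
    finally have "(norm (\<tau> x))\<^sup>2 \<le> ((real ?n + 1)\<^sup>2 / \<rho>\<^sup>2 * norm (g x))\<^sup>2" by (intro power_mono) auto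
    then show ?thesis by (simp only: bubble_bound_def power_mult_distrib)
  qed
  have "(LINT x:K|lborel. (norm (\<tau> x))\<^sup>2) \<le>
      (LINT x:K|lborel. bubble_bound CARD('n) \<rho> * (norm (g x))\<^sup>2)"
    using upper gsq continuous_norm_square[OF cont(2)]
    by (intro set_integral_mono set_integrable_T[OF K] continuous_on_mult continuous_on_const) auto
  then have 2: "(LINT x:K|lborel. (norm (\<tau> x))\<^sup>2) \<le>
      bubble_bound CARD('n) \<rho> * (LINT x:K|lborel. (norm (g x))\<^sup>2)" by simp
  show ?thesis using \<tau> tangential 1 2 by blast
qed

text \<open>The field \<open>x - a\<close>, with \<open>a\<close> the vertex opposite to \<open>F\<close>, is tangential on all other faces and
  has constant normal component on \<open>F\<close>.\<close>

lemma face_test_function: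
  assumes F: "F \<in> faces" and p: "p \<in> poly_space k"
  shows "\<exists>\<tau>\<in>vec_poly_space (k + 1).
    (\<forall>F'\<in>faces. reg F \<in> adj F' \<longrightarrow> F' \<noteq> F \<longrightarrow> (\<forall>x\<in>F'. \<tau> x \<bullet> face_normal D F' = 0)) \<and>
    (\<forall>x\<in>F. \<tau> x \<bullet> face_normal D F = p x) \<and>
    (LINT x:reg F|lborel. (norm (\<tau> x))\<^sup>2) \<le> face_const CARD('n) \<rho> A * diameter F *
      (LINT x:F|surface_measure. (p x)\<^sup>2)"
proof -
  let ?K = "reg F" and ?n = "CARD('n)"
  let ?r = "rad ?K"
  have K: "?K \<in> T" "?K \<in> adj F" using reg(1) reg_adj F by auto
  note S = simplex_T[OF K(1)] and V = simplex_vertices[OF simplex_T[OF K(1)]]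
  have r: "?r > 0" using rad(1)[OF K(1)] .
  obtain a where a: "a \<in> vertices ?K" "F = convex hull (vertices ?K - {a})"
    using element_face_opposite_vertex[OF S reg(2)[OF F]] by blast
  obtain q \<nu> where q: "norm \<nu> = 1" "q \<in> F" "\<forall>x\<in>F. (x - q) \<bullet> \<nu> = 0"
    "\<forall>z. z \<bullet> \<nu> = 0 \<longrightarrow> norm z \<le> ?r \<longrightarrow> q + z \<in> F" using face_disc[OF F] by blast
  let ?P = "hyperplane_proj \<nu> q" and ?N = "outer_normal F ?K"
  \<comment> \<open>Relates the prescribed normal of the face to the one pointing out of
    \<open>reg F\<close>.\<close>
  define s :: real where "s = (if ?K = K_ext D F then 1 else -1)"
  have s: "s * s = 1" "?N = s *\<^sub>R face_normal D F" by (auto simp: s_def outer_normal_def)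
  \<comment> \<open>The height of \<open>a\<close> over \<open>F\<close>, which is the constant
    normal component of \<open>x - a\<close> on \<open>F\<close>; it is at least the inscribed
    radius.\<close>
  define H where "H = (q - a) \<bullet> ?N"
  have out: "outward_unit_normal ?N ?K (convex hull (vertices ?K - {a}))"
    using outer_normal[OF F K(2)] unfolding a(2)[symmetric] .
  have H: "H \<ge> ?r" unfolding H_def
    using inscribed_radius_le_height[OF S rad(2)[OF K(1)] r a(1) _ out] q(2) a(2) by auto
  have H0: "H > 0" using H r by simp
  \<comment> \<open>Composition with the projection makes the scalar factor depend only on the trace
    of \<open>p\<close> on the plane of \<open>F\<close>, hence bounded by an integral over
    \<open>F\<close>.\<close>
  define \<tau> where "\<tau> x = (p (?P x) * (s / H)) *\<^sub>R (x - a)" for x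
  have "(\<lambda>x. (p (?P x) * (s / H)) *\<^sub>R (x - a)) \<in> vec_poly_space (k + 1)"
    by (intro vec_poly_space_mult poly_space_scale_right poly_space_comp[OF p] hyperplane_proj_poly
        vec_poly_space_diff vec_poly_space_id vec_poly_space_const)
  then have \<tau>: "\<tau> \<in> vec_poly_space (k + 1)" unfolding \<tau>_def .
  have other: "\<tau> x \<bullet> face_normal D F' = 0" if F': "F' \<in> faces" "?K \<in> adj F'" "F' \<noteq> F" "x \<in> F'"
    for F' x
  proof -
    have "(x - a) \<bullet> outer_normal F' ?K = 0"
      by (rule other_face_normal_orthogonal[OF F F'(1,3) refl F'(2) a F'(4)])
    then show ?thesis by (auto simp: \<tau>_def outer_normal_def split: if_splits)
  qed
  have same: "\<tau> x \<bullet> face_normal D F = p x" if x: "x \<in> F" for x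
  proof -
    have "?P x = x" using q(3) x by (simp add: hyperplane_proj_def)
    moreover have "(x - a) \<bullet> ?N = H"
      using outer_normal_orthogonal[OF F K(2) q(2) x] by (simp add: H_def inner_diff_left)
    then have "s * ((x - a) \<bullet> face_normal D F) = H" by (simp add: s)
    moreover have "\<tau> x \<bullet> face_normal D F = p (?P x) * (s * ((x - a) \<bullet> face_normal D F)) / H"
      by (simp add: \<tau>_def)
    ultimately show ?thesis using H0 by simp
  qed
  have pP: "(\<lambda>x. p (?P x)) \<in> poly_space (k + 1)"
    by (rule poly_space_mono[OF poly_space_comp[OF p hyperplane_proj_poly]]) simp
  have dK: "diameter ?K \<le> ?r / \<rho>" using diameter_le_rad[OF K(1)] .
  have FK: "F \<subseteq> ?K" using face_subset_reg[OF F] .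
  \<comment> \<open>The projection does not increase the distance to \<open>q\<close>, and
    \<open>F\<close> contains the disc of this radius around \<open>q\<close>.\<close>
  have slab: "?P x \<in> F" if x: "x \<in> cball q ?r" for x
  proof -
    define z where "z = (x - q) - ((x - q) \<bullet> \<nu>) *\<^sub>R \<nu>"
    have "z \<bullet> \<nu> = 0" using q(1) by (simp add: z_def inner_diff_left dot_square_norm)
    moreover have "norm z \<le> ?r"
    proof -
      have "orthogonal z (((x - q) \<bullet> \<nu>) *\<^sub>R \<nu>)" using \<open>z \<bullet> \<nu> = 0\<close> by (simp add: orthogonal_def)
      then have "(norm (x - q))\<^sup>2 = (norm z)\<^sup>2 + (norm (((x - q) \<bullet> \<nu>) *\<^sub>R \<nu>))\<^sup>2"
        using norm_add_Pythagorean[of z "((x - q) \<bullet> \<nu>) *\<^sub>R \<nu>"] by (simp add: z_def)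
      then have "(norm z)\<^sup>2 \<le> (norm (x - q))\<^sup>2" by simp
      then have "norm z \<le> norm (x - q)" by (rule power2_le_imp_le) simp
      then show ?thesis using x by (simp add: dist_norm norm_minus_commute)
    qed
    ultimately have "q + z \<in> F" using q(4) by blast
    then show ?thesis by (simp add: z_def hyperplane_proj_def)
  qed
  define I where "I = (LINT x:cball q ?r|lborel. (p (?P x))\<^sup>2)"
  have I0: "I \<ge> 0" unfolding I_def by (intro set_integral_nonneg_real) simp
  define J where "J = (LINT x:F|surface_measure. (p x)\<^sup>2)"
  have J0: "J \<ge> 0" unfolding J_def by (intro set_integral_nonneg_real) simp
  have IJ: "I \<le> slab_const CARD('n) * ?r * J" unfolding I_def J_def
    using slab_integral_le[OF dim r q(1) compact_face[OF F] face_measure_pos[OF F]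
      emeasure_face_finite[OF F] slab
        poly_space_continuous[OF p]] by blast
  have "(LINT x:?K|lborel. (norm (\<tau> x))\<^sup>2) \<le> measure lborel ?K * (1 / \<rho>\<^sup>2 * (A / ?r ^ ?n * I))"
  proof (rule set_integral_le_measure)
    show "emeasure lborel ?K < \<infinity>" using emeasure_compact_finite[OF compact_T[OF K(1)]] by simp
    show "continuous_on UNIV (\<lambda>x. (norm (\<tau> x))\<^sup>2)"
      by (rule continuous_norm_square[OF vec_poly_space_continuous[OF \<tau>]])
    fix y assume y: "y \<in> ?K"
    have "norm (y - a) \<le> diameter ?K"
      using diameter_bounded_bound[OF bounded_T[OF K(1)] y, of a] a(1) V(5)
        by (auto simp: dist_norm)
    then have "norm (y - a) \<le> ?r / \<rho>" using dK by simp
    then have "norm (y - a) / H \<le> (?r / \<rho>) / ?r" using H r \<rho> by (intro frac_le) auto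
    then have "norm (y - a) / H \<le> 1 / \<rho>" using r by simp
    then have "(norm (y - a) / H)\<^sup>2 \<le> (1 / \<rho>)\<^sup>2" using H0 by (intro power_mono) auto
    \<comment> \<open>The sup bound uses the ball around \<open>q\<close> instead of the inscribed
      ball: it may leave the element, but its projection stays in \<open>F\<close>.\<close>
    moreover have "(p (?P y))\<^sup>2 \<le> A / ?r ^ ?n * I"
    proof -
      have "diameter ?K \<le> 2 / \<rho> * ?r" using dK r \<rho>(1) by (simp add: field_simps)
      moreover have "y \<in> cball q (diameter ?K)" using subset_cball_T[OF K(1), of q] q(2) FK y
        by blast
      ultimately have "y \<in> cball q (2 / \<rho> * ?r)" by simp
      then show ?thesis unfolding I_def by (rule A[OF pP r])
    qed
    moreover have "(norm (\<tau> y))\<^sup>2 = (norm (y - a) / H)\<^sup>2 * (p (?P y))\<^sup>2"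
    proof -
      have "\<bar>s\<bar> = 1" by (simp add: s_def)
      then have "norm (\<tau> y) = (norm (y - a) / H) * \<bar>p (?P y)\<bar>" using H0
        by (simp add: \<tau>_def abs_mult)
      then show ?thesis by (simp add: power_mult_distrib power_divide)
    qed
    ultimately have "(norm (\<tau> y))\<^sup>2 \<le> (1 / \<rho>)\<^sup>2 * (A / ?r ^ ?n * I)"
      by (simp only:) (intro mult_mono; simp)
    then show "(norm (\<tau> y))\<^sup>2 \<le> 1 / \<rho>\<^sup>2 * (A / ?r ^ ?n * I)" by (simp add: power_divide)
  qed (use compact_T[OF K(1)] in auto)
  also have "\<dots> \<le> unit_ball_vol (real ?n) * (?r / \<rho>) ^ ?n * (1 / \<rho>\<^sup>2 * (A / ?r ^ ?n * I))"
    using r A_pos I0 by (intro mult_right_mono measure_T_le[OF K(1)]) auto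
  also have "\<dots> = unit_ball_vol (real ?n) * A / \<rho> ^ (?n + 2) * I"
    using r by (simp add: power_divide power_add power2_eq_square mult_ac)
  also have "\<dots> \<le> unit_ball_vol (real ?n) * A / \<rho> ^ (?n + 2) * (slab_const CARD('n) * ?r * J)"
    using A_pos \<rho> by (intro mult_left_mono IJ) auto
  also have "\<dots> = face_const CARD('n) \<rho> A * ?r * J" by (simp add: face_const_def)
  also have "\<dots> \<le> face_const CARD('n) \<rho> A * diameter F * J"
    using C_face_pos J0 rad_le_diameter_face[OF F] by (intro mult_right_mono mult_left_mono) auto
  finally have bound: "(LINT x:?K|lborel. (norm (\<tau> x))\<^sup>2) \<le>
      face_const CARD('n) \<rho> A * diameter F * J" .
  show ?thesis using \<tau> other same bound unfolding J_def by blast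
qed

end

section \<open>Global test fields and the two-sided bound\<close>

context dg_mesh
begin

lemma lifted_gradient_upper:
  assumes g: "\<And>K. K \<in> T \<Longrightarrow> g K \<in> vec_poly_space (k - 1)" and \<phi>: "\<And>F. F \<in> faces \<Longrightarrow> \<phi> F \<in> poly_space k"
    and w: "\<And>K x. K \<in> T \<Longrightarrow> w K x = g K x - lifting \<Omega> T D (k + 1) \<phi> K x"
  shows "vol_norm2 w \<le> (2 + 4 * trace_const CARD('n) \<rho> A) * (vol_norm2 g + face_norm2 \<phi>)"
proof -
  let ?r = "lifting \<Omega> T D (k + 1) \<phi>"
  have \<phi>c: "continuous_on UNIV (\<phi> F)" if "F \<in> faces" for F using \<phi>[OF that] poly_space_continuous
    by blast
  have r: "?r \<in> dg_vec_space T (k + 1)" using lifting_spec(1)[where \<phi> = \<phi>, OF \<phi>c] .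
  have "vol_norm2 w \<le> 2 * vol_norm2 g + 2 * vol_norm2 (\<lambda>K x. - ?r K x)"
  proof (rule vol_norm2_add)
    show "continuous_on UNIV (g K)" if "K \<in> T" for K using g[OF that] vec_poly_space_continuous
      by blast
    show "continuous_on UNIV (\<lambda>x. - ?r K x)" if "K \<in> T" for K
      using dg_vec_space_continuous[OF r that] by (rule continuous_on_minus)
  qed (simp add: w)
  also have "vol_norm2 (\<lambda>K x. - ?r K x) = vol_norm2 ?r" by (simp add: vol_norm2_def)
  also have "vol_norm2 ?r \<le> 2 * trace_const CARD('n) \<rho> A * face_norm2 \<phi>"
    using lifting_bound[where \<phi> = \<phi>, OF \<phi>c] .
  finally have "vol_norm2 w \<le> 2 * vol_norm2 g + 4 * trace_const CARD('n) \<rho> A * face_norm2 \<phi>" by simp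
  also have "\<dots> \<le> (2 + 4 * trace_const CARD('n) \<rho> A) * (vol_norm2 g + face_norm2 \<phi>)"
    using vol_norm2_nonneg[of g] face_norm2_nonneg[of \<phi>] C_trace_pos by (simp add: algebra_simps)
  finally show ?thesis .
qed

text \<open>Every element carries the fields of the faces assigned to it by \<open>reg\<close>.
  Normal components off the own face vanish, so on \<open>F\<close> only the field of
  \<open>F\<close>, coming from \<open>reg F\<close>, is seen. The sign is negative because the
  lifting is subtracted in the lifted gradient.\<close>

lemma face_field:
  assumes \<phi>: "\<And>F. F \<in> faces \<Longrightarrow> \<phi> F \<in> poly_space k"
  shows "\<exists>\<sigma>\<in>dg_vec_space T (k + 1). vol_norm2 \<sigma> \<le> reg_const CARD('n) \<rho> A * face_norm2 \<phi> \<and>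
    (\<forall>F\<in>faces. \<forall>x\<in>F. (\<Sum>K\<in>adj F. \<sigma> K x \<bullet> face_normal D F) = - \<phi> F x / diameter F)"
proof -
  let ?n = "CARD('n)"
  have "\<forall>F\<in>faces. \<exists>\<tau>\<in>vec_poly_space (k + 1).
    (\<forall>F'\<in>faces. reg F \<in> adj F' \<longrightarrow> F' \<noteq> F \<longrightarrow> (\<forall>x\<in>F'. \<tau> x \<bullet> face_normal D F' = 0)) \<and>
    (\<forall>x\<in>F. \<tau> x \<bullet> face_normal D F = \<phi> F x) \<and>
    (LINT x:reg F|lborel. (norm (\<tau> x))\<^sup>2) \<le> face_const CARD('n) \<rho> A * diameter F *
      (LINT x:F|surface_measure. (\<phi> F x)\<^sup>2)"
    using face_test_function \<phi> by blast
  then obtain \<tau> where \<tau>: "\<forall>F\<in>faces. \<tau> F \<in> vec_poly_space (k + 1) \<and>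
    (\<forall>F'\<in>faces. reg F \<in> adj F' \<longrightarrow> F' \<noteq> F \<longrightarrow> (\<forall>x\<in>F'. \<tau> F x \<bullet> face_normal D F' = 0)) \<and>
    (\<forall>x\<in>F. \<tau> F x \<bullet> face_normal D F = \<phi> F x) \<and>
    (LINT x:reg F|lborel. (norm (\<tau> F x))\<^sup>2) \<le> face_const CARD('n) \<rho> A * diameter F *
      (LINT x:F|surface_measure. (\<phi> F x)\<^sup>2)"
    unfolding bchoice_iff Bex_def by (elim exE)
  have \<tau>p: "\<tau> F \<in> vec_poly_space (k + 1)" if "F \<in> faces" for F using \<tau> that by blast
  have \<tau>o: "\<tau> F x \<bullet> face_normal D F' = 0"
    if "F \<in> faces" "F' \<in> faces" "reg F \<in> adj F'" "F' \<noteq> F" "x \<in> F'" for F F' x using \<tau> that by blast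
  have \<tau>s: "\<tau> F x \<bullet> face_normal D F = \<phi> F x" if "F \<in> faces" "x \<in> F" for F x using \<tau> that by blast
  have \<tau>b: "(LINT x:reg F|lborel. (norm (\<tau> F x))\<^sup>2) \<le>
      face_const CARD('n) \<rho> A * diameter F * (LINT x:F|surface_measure. (\<phi> F x)\<^sup>2)"
    if "F \<in> faces" for F using \<tau> that by blast
  define R where "R K = {F \<in> faces. reg F = K}" for K
  have finR: "finite (R K)" for K using finite_faces by (simp add: R_def)
  have cardR: "real (card (R K)) \<le> 2 ^ Suc ?n" if K: "K \<in> T" for K
  proof -
    have "R K \<subseteq> element_faces K" using reg by (auto simp: R_def)
    then have "card (R K) \<le> card (element_faces K)"
      by (rule card_mono[OF finite_element_faces[OF simplex_T[OF K]]])
    also have "\<dots> \<le> 2 ^ Suc ?n" using card_element_faces_le[OF simplex_T[OF K]] by simp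
    finally show ?thesis using of_nat_mono[where ?'a = real] by fastforce
  qed
  define \<sigma> where "\<sigma> = (\<lambda>K\<in>T. \<lambda>x. \<Sum>F\<in>R K. (- 1 / diameter F) *\<^sub>R \<tau> F x)"
  have \<sigma>K: "\<sigma> K = (\<lambda>x. \<Sum>F\<in>R K. (- 1 / diameter F) *\<^sub>R \<tau> F x)" if "K \<in> T" for K using that
    by (simp add: \<sigma>_def)
  have \<sigma>: "\<sigma> \<in> dg_vec_space T (k + 1)"
  proof -
    have "(\<lambda>x. \<Sum>F\<in>R K. (- 1 / diameter F) *\<^sub>R \<tau> F x) \<in> vec_poly_space (k + 1)" for K
      by (intro vec_poly_space_sum vec_poly_space_scale \<tau>p) (simp add: R_def)
    then show ?thesis unfolding \<sigma>_def dg_vec_space_def by auto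
  qed
  have trace: "(\<Sum>K\<in>adj F. \<sigma> K x \<bullet> face_normal D F) = - \<phi> F x / diameter F" if F: "F \<in> faces"
    and x: "x \<in> F" for F x
  proof -
    have "\<sigma> K x \<bullet> face_normal D F = (if K = reg F then - \<phi> F x / diameter F else 0)"
      if K: "K \<in> adj F" for K
    proof -
      have KT: "K \<in> T" using K by (simp add: adj_def)
      have "\<sigma> K x \<bullet> face_normal D F = (\<Sum>G\<in>R K. (- 1 / diameter G) * (\<tau> G x \<bullet> face_normal D F))"
        by (simp add: \<sigma>K[OF KT] inner_sum_left)
      also have "\<dots> = (\<Sum>G\<in>R K. if G = F then - \<phi> F x / diameter F else 0)"
      proof (intro sum.cong refl)
        fix G assume "G \<in> R K"
        then have G: "G \<in> faces" "reg G = K" by (auto simp: R_def)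
        show "(- 1 / diameter G) * (\<tau> G x \<bullet> face_normal D F) =
            (if G = F then - \<phi> F x / diameter F else 0)"
          using \<tau>s[OF F x] \<tau>o[OF G(1) F _ _ x] G(2) K by (cases "G = F") auto
      qed
      also have "\<dots> = (if F \<in> R K then - \<phi> F x / diameter F else 0)" using finR by simp
      finally show ?thesis using F by (auto simp: R_def)
    qed
    then have "(\<Sum>K\<in>adj F. \<sigma> K x \<bullet> face_normal D F) =
        (\<Sum>K\<in>adj F. if K = reg F then - \<phi> F x / diameter F else 0)"
      by (intro sum.cong) auto
    also have "\<dots> = - \<phi> F x / diameter F" using reg_adj[OF F] finite_adj by simp
    finally show ?thesis .
  qed
  let ?J = "\<lambda>F. LINT x:F|surface_measure. (\<phi> F x)\<^sup>2"
  have "vol_norm2 \<sigma> \<le> (\<Sum>K\<in>T. \<Sum>F\<in>R K. reg_const CARD('n) \<rho> A * (1 / diameter F * ?J F))"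
    unfolding vol_norm2_def
  proof (intro sum_mono)
    fix K assume K: "K \<in> T"
    have c: "continuous_on UNIV (\<tau> F)" if "F \<in> R K" for F
      using \<tau>p that vec_poly_space_continuous by (auto simp: R_def)
    have "(LINT x:K|lborel. (norm (\<sigma> K x))\<^sup>2) \<le>
        (LINT x:K|lborel. 2 ^ Suc ?n * (\<Sum>F\<in>R K. (1 / diameter F)\<^sup>2 * (norm (\<tau> F x))\<^sup>2))"
    proof (intro set_integral_mono set_integrable_T[OF K])
      fix x
      \<comment> \<open>Fields on the same element overlap; their number is at most
        \<open>2 ^ Suc ?n\<close>, which is the factor between \<open>face_const\<close> and
        \<open>reg_const\<close>.\<close>
      have "(norm (\<sigma> K x))\<^sup>2 \<le> real (card (R K)) * (\<Sum>F\<in>R K. (norm ((- 1 / diameter F) *\<^sub>R \<tau> F x))\<^sup>2)"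
        unfolding \<sigma>K[OF K] by (rule norm_sum_squared_le)
      also have "\<dots> \<le> 2 ^ Suc ?n * (\<Sum>F\<in>R K. (norm ((- 1 / diameter F) *\<^sub>R \<tau> F x))\<^sup>2)"
        by (intro mult_right_mono cardR[OF K] sum_nonneg) simp
      also have "(\<Sum>F\<in>R K. (norm ((- 1 / diameter F) *\<^sub>R \<tau> F x))\<^sup>2) =
          (\<Sum>F\<in>R K. (1 / diameter F)\<^sup>2 * (norm (\<tau> F x))\<^sup>2)"
        by (intro sum.cong refl) (simp add: power_mult_distrib power_divide)
      finally show "(norm (\<sigma> K x))\<^sup>2 \<le> 2 ^ Suc ?n * (\<Sum>F\<in>R K. (1 / diameter F)\<^sup>2 * (norm (\<tau> F x))\<^sup>2)" .
    qed (intro continuous_norm_square dg_vec_space_continuous[OF \<sigma> K] continuous_on_mult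
      continuous_on_const
        continuous_on_sum c; simp)+
    also have "\<dots> = 2 ^ Suc ?n * (\<Sum>F\<in>R K. (1 / diameter F)\<^sup>2 * (LINT x:K|lborel. (norm (\<tau> F x))\<^sup>2))"
    proof -
      have "(LINT x:K|lborel. (\<Sum>F\<in>R K. (1 / diameter F)\<^sup>2 * (norm (\<tau> F x))\<^sup>2)) =
          (\<Sum>F\<in>R K. LINT x:K|lborel. (1 / diameter F)\<^sup>2 * (norm (\<tau> F x))\<^sup>2)"
        by (intro set_integral_finite_sum set_integrable_T[OF K] continuous_on_mult
          continuous_on_const
            continuous_norm_square c)
      then show ?thesis by (simp only: set_integral_mult_right)
    qed
    also have "\<dots> \<le> 2 ^ Suc ?n * (\<Sum>F\<in>R K. face_const CARD('n) \<rho> A * (1 / diameter F * ?J F))"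
    proof (intro mult_left_mono sum_mono)
      fix F assume "F \<in> R K"
      then have F: "F \<in> faces" "reg F = K" by (auto simp: R_def)
      \<comment> \<open>One of the two inverse diameters cancels against the field bound; the other
        is the weight in the jump norm.\<close>
      have "(1 / diameter F)\<^sup>2 * (LINT x:K|lborel. (norm (\<tau> F x))\<^sup>2) \<le>
          (1 / diameter F)\<^sup>2 * (face_const CARD('n) \<rho> A * diameter F * ?J F)"
        using \<tau>b[OF F(1)] F(2) by (intro mult_left_mono) auto
      also have "\<dots> = face_const CARD('n) \<rho> A * (1 / diameter F * ?J F)"
        using diameter_face_pos[OF F(1)] by (simp add: power2_eq_square)
      finally show "(1 / diameter F)\<^sup>2 * (LINT x:K|lborel. (norm (\<tau> F x))\<^sup>2) \<le>
          face_const CARD('n) \<rho> A * (1 / diameter F * ?J F)" .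
    qed simp
    also have "\<dots> = (\<Sum>F\<in>R K. reg_const CARD('n) \<rho> A * (1 / diameter F * ?J F))"
      by (simp only: reg_const_def sum_distrib_left mult.assoc)
    finally show "(LINT x:K|lborel. (norm (\<sigma> K x))\<^sup>2) \<le>
        (\<Sum>F\<in>R K. reg_const CARD('n) \<rho> A * (1 / diameter F * ?J F))" .
  qed
  also have "\<dots> = (\<Sum>F\<in>faces. reg_const CARD('n) \<rho> A * (1 / diameter F * ?J F))"
    unfolding R_def using reg(1) by (intro sum.group finite_faces finite_T) auto
  also have "\<dots> = reg_const CARD('n) \<rho> A * face_norm2 \<phi>"
    by (simp add: face_norm2_def sum_distrib_left)
  finally have "vol_norm2 \<sigma> \<le> reg_const CARD('n) \<rho> A * face_norm2 \<phi>" .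
  then show ?thesis using \<sigma> trace by blast
qed

lemma element_field:
  assumes g: "\<And>K. K \<in> T \<Longrightarrow> g K \<in> vec_poly_space (k - 1)"
  shows "\<exists>\<sigma>\<in>dg_vec_space T (k + 1). vol_norm2 \<sigma> \<le> bubble_bound CARD('n) \<rho> * vol_norm2 g \<and>
    bubble_const CARD('n) \<rho> A * vol_norm2 g \<le> (\<Sum>K\<in>T. LINT x:K|lborel. g K x \<bullet> \<sigma> K x) \<and>
    (\<forall>F\<in>faces. \<forall>K\<in>adj F. \<forall>x\<in>F. \<sigma> K x \<bullet> face_normal D F = 0)"
proof -
  have "\<forall>K\<in>T. \<exists>\<tau>\<in>vec_poly_space (k + 1).
    (\<forall>F\<in>faces. K \<in> adj F \<longrightarrow> (\<forall>x\<in>F. \<tau> x \<bullet> face_normal D F = 0)) \<and>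
    bubble_const CARD('n) \<rho> A * (LINT x:K|lborel. (norm (g K x))\<^sup>2) \<le>
      (LINT x:K|lborel. g K x \<bullet> \<tau> x) \<and>
    (LINT x:K|lborel. (norm (\<tau> x))\<^sup>2) \<le> bubble_bound CARD('n) \<rho> * (LINT x:K|lborel. (norm (g K x))\<^sup>2)"
    using element_test_function g by blast
  then obtain \<tau> where \<tau>: "\<forall>K\<in>T. \<tau> K \<in> vec_poly_space (k + 1) \<and>
    (\<forall>F\<in>faces. K \<in> adj F \<longrightarrow> (\<forall>x\<in>F. \<tau> K x \<bullet> face_normal D F = 0)) \<and>
    bubble_const CARD('n) \<rho> A * (LINT x:K|lborel. (norm (g K x))\<^sup>2) \<le>
      (LINT x:K|lborel. g K x \<bullet> \<tau> K x) \<and>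
    (LINT x:K|lborel. (norm (\<tau> K x))\<^sup>2) \<le> bubble_bound CARD('n) \<rho> * (LINT x:K|lborel. (norm
      (g K x))\<^sup>2)"
    unfolding bchoice_iff Bex_def by (elim exE)
  define \<sigma> where "\<sigma> = restrict \<tau> T"
  have \<sigma>K: "\<sigma> K = \<tau> K" if "K \<in> T" for K using that by (simp add: \<sigma>_def)
  have "\<sigma> \<in> dg_vec_space T (k + 1)" unfolding \<sigma>_def dg_vec_space_def using \<tau> by auto
  moreover have "vol_norm2 \<sigma> \<le> bubble_bound CARD('n) \<rho> * vol_norm2 g"
    unfolding vol_norm2_def sum_distrib_left using \<tau> by (intro sum_mono) (auto simp: \<sigma>K)
  moreover have "bubble_const CARD('n) \<rho> A * vol_norm2 g \<le> (\<Sum>K\<in>T. LINT x:K|lborel. g K x \<bullet> \<sigma> K x)"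
    unfolding vol_norm2_def sum_distrib_left using \<tau> by (intro sum_mono) (auto simp: \<sigma>K)
  moreover have "\<sigma> K x \<bullet> face_normal D F = 0" if "F \<in> faces" "K \<in> adj F" "x \<in> F" for F K x
    using \<tau> that \<sigma>K[of K] by (auto simp: adj_def)
  ultimately show ?thesis by blast
qed

text \<open>Paired with \<open>\<sigma>1 + \<delta> *\<^sub>R \<sigma>2\<close>, the lifted gradient
  gives the broken gradient through \<open>\<sigma>1\<close> and the jumps through
  \<open>\<sigma>2\<close>. The only mixed term is \<open>g\<close> against
  \<open>\<sigma>2\<close>, and a small \<open>\<delta>\<close> absorbs it.\<close>

lemma lifted_gradient_lower:
  assumes g: "\<And>K. K \<in> T \<Longrightarrow> g K \<in> vec_poly_space (k - 1)" and \<phi>: "\<And>F. F \<in> faces \<Longrightarrow> \<phi> F \<in> poly_space k"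
    and w: "\<And>K x. K \<in> T \<Longrightarrow> w K x = g K x - lifting \<Omega> T D (k + 1) \<phi> K x"
  shows "lower_const CARD('n) \<rho> A * (vol_norm2 g + face_norm2 \<phi>) \<le> vol_norm2 w"
proof -
  let ?r = "lifting \<Omega> T D (k + 1) \<phi>"
  define G where "G = vol_norm2 g"
  define J where "J = face_norm2 \<phi>"
  have G0: "G \<ge> 0" and J0: "J \<ge> 0" using vol_norm2_nonneg face_norm2_nonneg
    by (auto simp: G_def J_def)
  have \<phi>c: "continuous_on UNIV (\<phi> F)" if "F \<in> faces" for F using \<phi>[OF that] poly_space_continuous
    by blast
  have gc: "continuous_on UNIV (g K)" if "K \<in> T" for K using g[OF that] vec_poly_space_continuous
    by blast
  have r: "?r \<in> dg_vec_space T (k + 1)" using lifting_spec(1)[where \<phi> = \<phi>, OF \<phi>c] .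
  note rc = dg_vec_space_continuous[OF r]
  obtain \<sigma>1 where \<sigma>1: "\<sigma>1 \<in> dg_vec_space T (k + 1)" "vol_norm2 \<sigma>1 \<le> bubble_bound CARD('n) \<rho> * G"
    "bubble_const CARD('n) \<rho> A * G \<le> (\<Sum>K\<in>T. LINT x:K|lborel. g K x \<bullet> \<sigma>1 K x)"
    "\<forall>F\<in>faces. \<forall>K\<in>adj F. \<forall>x\<in>F. \<sigma>1 K x \<bullet> face_normal D F = 0"
    using element_field[where g = g, OF g] unfolding G_def by blast
  obtain \<sigma>2 where \<sigma>2: "\<sigma>2 \<in> dg_vec_space T (k + 1)" "vol_norm2 \<sigma>2 \<le> reg_const CARD('n) \<rho> A * J"
    "\<forall>F\<in>faces. \<forall>x\<in>F. (\<Sum>K\<in>adj F. \<sigma>2 K x \<bullet> face_normal D F) = - \<phi> F x / diameter F"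
    using face_field[where \<phi> = \<phi>, OF \<phi>] unfolding J_def by blast
  note c1 = dg_vec_space_continuous[OF \<sigma>1(1)] and c2 = dg_vec_space_continuous[OF \<sigma>2(1)]
  \<comment> \<open>With this weight the mixed term uses up half of the gradient
    contribution.\<close>
  define \<delta> where "\<delta> = bubble_const CARD('n) \<rho> A / (2 * reg_const CARD('n) \<rho> A)"
  have \<delta>: "\<delta> > 0" "\<delta> * reg_const CARD('n) \<rho> A = bubble_const CARD('n) \<rho> A / 2"
    using C_bubble_pos C_reg_pos by (auto simp: \<delta>_def)
  define \<sigma> where "\<sigma> = (\<lambda>K\<in>T. \<lambda>x. \<sigma>1 K x + \<delta> *\<^sub>R \<sigma>2 K x)"
  have \<sigma>K: "\<sigma> K = (\<lambda>x. \<sigma>1 K x + \<delta> *\<^sub>R \<sigma>2 K x)" if "K \<in> T" for K using that by (simp add: \<sigma>_def)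
  have \<sigma>: "\<sigma> \<in> dg_vec_space T (k + 1)"
    using dg_vec_space_poly[OF \<sigma>1(1)] dg_vec_space_poly[OF \<sigma>2(1)]
    unfolding \<sigma>_def dg_vec_space_def by (auto intro!: vec_poly_space_add vec_poly_space_scale)
  note \<sigma>c = dg_vec_space_continuous[OF \<sigma>]
  have form: "face_form \<phi> \<sigma> \<le> - (\<delta> / 2) * J"
  proof -
    have "face_form \<phi> \<sigma> = (\<Sum>F\<in>faces. (- \<delta> * weight F) *
        (1 / diameter F * (LINT x:F|surface_measure. (\<phi> F x)\<^sup>2)))"
      unfolding face_form_def
    proof (intro sum.cong refl)
      fix F assume F: "F \<in> faces"
      have "\<phi> F x * average T D (\<lambda>K y. \<sigma> K y \<bullet> face_normal D F) F x =
          (- \<delta> * weight F / diameter F) * (\<phi> F x)\<^sup>2"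
        if x: "x \<in> F" for x
      proof -
        have "(\<Sum>K\<in>adj F. \<sigma> K x \<bullet> face_normal D F) = (\<Sum>K\<in>adj F. \<delta> * (\<sigma>2 K x \<bullet> face_normal D F))"
          using \<sigma>1(4) F x by (intro sum.cong refl) (auto simp: adj_def \<sigma>K inner_add_left)
        also have "\<dots> = \<delta> * (- \<phi> F x / diameter F)"
          using \<sigma>2(3) F x by (simp flip: sum_distrib_left)
        finally show ?thesis by (simp add: average_normal[OF F] power2_eq_square)
      qed
      then have "(LINT x:F|surface_measure. \<phi> F x * average T D (\<lambda>K y. \<sigma> K y \<bullet> face_normal D F) F x)
          =
          (LINT x:F|surface_measure. (- \<delta> * weight F / diameter F) * (\<phi> F x)\<^sup>2)"
        using compact_face[OF F] by (intro set_lebesgue_integral_cong)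
          (auto simp: sets_surface_measure borel_compact)
      also have "\<dots> = (- \<delta> * weight F / diameter F) * (LINT x:F|surface_measure. (\<phi> F x)\<^sup>2)"
        by (rule set_integral_mult_right)
      finally show "(LINT x:F|surface_measure. \<phi> F x * average T D (\<lambda>K y. \<sigma> K y \<bullet> face_normal D F) F
          x) =
          (- \<delta> * weight F) * (1 / diameter F * (LINT x:F|surface_measure. (\<phi> F x)\<^sup>2))" by simp
    qed
    also have "\<dots> \<le> (\<Sum>F\<in>faces. - (\<delta> / 2) * (1 / diameter F * (LINT x:F|surface_measure. (\<phi> F x)\<^sup>2)))"
    proof (intro sum_mono mult_right_mono)
      fix F assume F: "F \<in> faces"
      \<comment> \<open>On interior faces the average halves the one-sided trace; this is why only
        \<open>\<delta> / 2\<close> remains.\<close>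
      have "weight F \<ge> 1 / 2" by (simp add: weight_def)
      then show "- \<delta> * weight F \<le> - (\<delta> / 2)" using \<delta>(1) by simp
      show "0 \<le> 1 / diameter F * (LINT x:F|surface_measure. (\<phi> F x)\<^sup>2)"
        using diameter_face_pos[OF F] by (intro mult_nonneg_nonneg set_integral_nonneg_real) auto
    qed
    also have "\<dots> = - (\<delta> / 2) * J" by (simp only: J_def face_norm2_def sum_distrib_left)
    finally show ?thesis .
  qed
  have wK: "w K = (\<lambda>x. g K x - ?r K x)" if "K \<in> T" for K using w[OF that] by auto
  have wc: "continuous_on UNIV (w K)" if "K \<in> T" for K
    unfolding wK[OF that] using gc[OF that] rc[OF that] by (intro continuous_intros)
  let ?I = "\<lambda>u v. \<Sum>K\<in>T. LINT x:K|lborel. u K x \<bullet> (v K x :: real^'n)"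
  have int: "set_integrable lborel K (\<lambda>x. u x \<bullet> v x)"
    if "K \<in> T" "continuous_on UNIV u" "continuous_on UNIV v"
    for K and u v :: "real^'n \<Rightarrow> real^'n" using that by (intro set_integrable_T continuous_on_inner)
  have "?I w \<sigma> = ?I g \<sigma> - ?I ?r \<sigma>"
    unfolding sum_subtractf[symmetric]
  proof (intro sum.cong refl)
    fix K assume K: "K \<in> T"
    show "(LINT x:K|lborel. w K x \<bullet> \<sigma> K x) = (LINT x:K|lborel. g K x \<bullet> \<sigma> K x) -
        (LINT x:K|lborel. ?r K x \<bullet> \<sigma> K x)"
      unfolding wK[OF K] inner_diff_left by (intro set_integral_diff int K gc rc \<sigma>c)
  qed
  moreover have "?I ?r \<sigma> = face_form \<phi> \<sigma>" using lifting_spec(2)[where \<phi> = \<phi>, OF \<phi>c \<sigma>] .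
  moreover have "?I g \<sigma> = ?I g \<sigma>1 + \<delta> * ?I g \<sigma>2"
    unfolding sum_distrib_left sum.distrib[symmetric]
  proof (intro sum.cong refl)
    fix K assume K: "K \<in> T"
    have "(LINT x:K|lborel. g K x \<bullet> \<sigma> K x) =
        (LINT x:K|lborel. g K x \<bullet> \<sigma>1 K x + \<delta> * (g K x \<bullet> \<sigma>2 K x))"
      by (simp add: \<sigma>K[OF K] inner_add_right)
    also have "\<dots> = (LINT x:K|lborel. g K x \<bullet> \<sigma>1 K x) + (LINT x:K|lborel. \<delta> * (g K x \<bullet> \<sigma>2 K x))"
      by (intro set_integral_add set_integrable_mult_right int K gc c1 c2)
    finally show "(LINT x:K|lborel. g K x \<bullet> \<sigma> K x) = (LINT x:K|lborel. g K x \<bullet> \<sigma>1 K x) +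
        \<delta> * (LINT x:K|lborel. g K x \<bullet> \<sigma>2 K x)"
      by (simp only: set_integral_mult_right)
  qed
  moreover have "?I g \<sigma>2 \<ge> - (reg_const CARD('n) \<rho> A * G + J / 4)"
  proof -
    \<comment> \<open>The parameter is twice \<open>reg_const\<close>: the jump part becomes
      \<open>J / 4\<close>, and its multiple by \<open>\<delta>\<close> takes half of what
      \<open>form\<close> provides.\<close>
    have "?I (\<lambda>K x. - g K x) \<sigma>2 \<le> (2 * reg_const CARD('n) \<rho> A) / 2 * vol_norm2 (\<lambda>K x. - g K x) +
        1 / (2 * (2 * reg_const CARD('n) \<rho> A)) * vol_norm2 \<sigma>2"
      using C_reg_pos by (intro vol_young c2 continuous_on_minus gc) auto
    also have "vol_norm2 (\<lambda>K x. - g K x) = G" by (simp add: G_def vol_norm2_def)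
    also have "1 / (2 * (2 * reg_const CARD('n) \<rho> A)) * vol_norm2 \<sigma>2 \<le>
        1 / (2 * (2 * reg_const CARD('n) \<rho> A)) * (reg_const CARD('n) \<rho> A * J)"
      using \<sigma>2(2) C_reg_pos by (intro mult_left_mono) auto
    also have "\<dots> = J / 4" using C_reg_pos by simp
    also have "?I (\<lambda>K x. - g K x) \<sigma>2 = - ?I g \<sigma>2"
      by (simp add: set_lebesgue_integral_def sum_negf)
    finally show ?thesis by simp
  qed
  then have "\<delta> * ?I g \<sigma>2 \<ge> \<delta> * (- (reg_const CARD('n) \<rho> A * G + J / 4))" using \<delta>(1)
    by (intro mult_left_mono) auto
  moreover have "\<delta> * (- (reg_const CARD('n) \<rho> A * G + J / 4)) = -
      (bubble_const CARD('n) \<rho> A / 2) * G - \<delta> / 4 * J"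
    by (simp add: \<delta>(2)[symmetric] algebra_simps)
  ultimately have lower: "?I w \<sigma> \<ge> bubble_const CARD('n) \<rho> A / 2 * G + \<delta> / 4 * J"
    using form \<sigma>1(3) by linarith
  define m where "m = min (bubble_const CARD('n) \<rho> A / 2) (\<delta> / 4)"
  define M where "M = 2 * bubble_bound CARD('n) \<rho> + 2 * \<delta>\<^sup>2 * reg_const CARD('n) \<rho> A"
  have m: "m > 0" using C_bubble_pos \<delta> by (simp add: m_def)
  have M: "M > 0" unfolding M_def using \<delta> C_reg_pos
    by (intro add_nonneg_pos) (auto simp: bubble_bound_def)
  have "m * (G + J) = m * G + m * J" by (rule distrib_left)
  also have "\<dots> \<le> bubble_const CARD('n) \<rho> A / 2 * G + \<delta> / 4 * J"
    using G0 J0 by (intro add_mono mult_right_mono) (auto simp: m_def)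
  finally have "m * (G + J) \<le> ?I w \<sigma>" using lower by simp
  \<comment> \<open>With parameter \<open>M / m\<close> the term with \<open>\<sigma>\<close> is at
    most half of \<open>m * (G + J)\<close> and moves to the left.\<close>
  also have "\<dots> \<le> (M / m) / 2 * vol_norm2 w + 1 / (2 * (M / m)) * vol_norm2 \<sigma>"
    using m M by (intro vol_young wc \<sigma>c) auto
  also have "vol_norm2 \<sigma> \<le> M * (G + J)"
  proof -
    have "vol_norm2 \<sigma> \<le> 2 * vol_norm2 \<sigma>1 + 2 * vol_norm2 (\<lambda>K x. \<delta> *\<^sub>R \<sigma>2 K x)"
      by (intro vol_norm2_add c1 continuous_on_scaleR continuous_on_const c2) (auto simp: \<sigma>K)
    also have "vol_norm2 (\<lambda>K x. \<delta> *\<^sub>R \<sigma>2 K x) = \<delta>\<^sup>2 * vol_norm2 \<sigma>2"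
      by (simp add: vol_norm2_def power_mult_distrib sum_distrib_left)
    also have "2 * vol_norm2 \<sigma>1 + 2 * (\<delta>\<^sup>2 * vol_norm2 \<sigma>2) \<le> 2 * (bubble_bound CARD('n) \<rho> * G) +
        2 * (\<delta>\<^sup>2 * (reg_const CARD('n) \<rho> A * J))"
      using \<sigma>1(2) \<sigma>2(2) by (intro add_mono mult_left_mono) auto
    also have "\<dots> \<le> M * (G + J)"
      unfolding M_def using G0 J0 C_reg_pos by (simp add: algebra_simps bubble_bound_def)
    finally show ?thesis .
  qed
  also have "1 / (2 * (M / m)) * (M * (G + J)) = m / 2 * (G + J)" using m M by simp
  finally have "m / 2 * (G + J) \<le> (M / m) / 2 * vol_norm2 w" using m M
    by (simp add: mult_left_mono divide_right_mono)
  then have "m / 2 * (G + J) * (2 * m / M) \<le> (M / m) / 2 * vol_norm2 w * (2 * m / M)"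
    using m M by (intro mult_right_mono) auto
  moreover have "m / 2 * x * (2 * m / M) = m\<^sup>2 / M * x" for x by (simp add: power2_eq_square)
  moreover have "(M / m) / 2 * v * (2 * m / M) = v" for v using m M by simp
  ultimately have "m\<^sup>2 / M * (G + J) \<le> vol_norm2 w" by (simp only:)
  then show ?thesis by (simp add: lower_const_def Let_def G_def J_def m_def M_def \<delta>_def)
qed

lemma jump_poly_space:
  assumes "u \<in> dg_space T k" "F \<in> faces"
  shows "jump T D u F \<in> poly_space k"
proof -
  have u: "u K \<in> poly_space k" if "K \<in> T" for K using assms(1) that unfolding dg_space_def
    by (rule PiE_mem)
  show ?thesis
  proof (cases "F \<in> interior_faces T")
    case True
    then have "K_ext D F \<in> T" "K_int D F \<in> T" using adj_interior(1)[OF True] by (auto simp: adj_def)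
    moreover have "jump T D u F = (\<lambda>x. u (K_ext D F) x - u (K_int D F) x)" using True
      by (auto simp: jump_def)
    ultimately show ?thesis using u by (auto intro: poly_space_diff)
  next
    case False
    then have "K_ext D F \<in> T" using adj_boundary(1)[OF assms(2) False] by (auto simp: adj_def)
    moreover have "jump T D u F = u (K_ext D F)" using False by (auto simp: jump_def)
    ultimately show ?thesis using u by auto
  qed
qed

lemma lifted_gradient_bounds:
  assumes u: "u \<in> dg_space T k"
  shows "sqrt (lower_const CARD('n) \<rho> A) * dg_norm \<Omega> T D u \<le>
      L2_norm_on lborel \<Omega> (assemble T (lifted_gradient \<Omega> T D k u))"
    and "L2_norm_on lborel \<Omega> (assemble T (lifted_gradient \<Omega> T D k u)) \<le>
      sqrt (2 + 4 * trace_const CARD('n) \<rho> A) * dg_norm \<Omega> T D u"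
proof -
  let ?g = "broken_gradient T u" and ?\<phi> = "jump T D u" and ?w = "lifted_gradient \<Omega> T D k u"
  have g: "?g K \<in> vec_poly_space (k - 1)" if "K \<in> T" for K
  proof -
    have "u K \<in> poly_space k" using u that unfolding dg_space_def by (rule PiE_mem)
    then show ?thesis using that gradient_poly_space by (simp add: broken_gradient_def)
  qed
  note \<phi> = jump_poly_space[OF u]
  have w: "?w K x = ?g K x - lifting \<Omega> T D (k + 1) ?\<phi> K x" if "K \<in> T" for K x
    using that by (simp add: lifted_gradient_def)
  have r: "lifting \<Omega> T D (k + 1) ?\<phi> \<in> dg_vec_space T (k + 1)"
    using lifting_spec(1)[where \<phi> = ?\<phi>] poly_space_continuous[OF \<phi>] by blast
  have "continuous_on UNIV (?w K)" if "K \<in> T" for K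
  proof -
    have "?w K = (\<lambda>x. ?g K x - lifting \<Omega> T D (k + 1) ?\<phi> K x)" using w[OF that] by auto
    then show ?thesis
      using vec_poly_space_continuous[OF g[OF that]] dg_vec_space_continuous[OF r that]
      by (simp add: continuous_on_diff)
  qed
  then have L2: "L2_norm_on lborel \<Omega> (assemble T ?w) = sqrt (vol_norm2 ?w)"
    using L2_norm_assemble by (simp add: vol_norm2_def)
  have sq: "(L2_norm_on M A f)\<^sup>2 = (LINT x:A|M. (norm (f x))\<^sup>2)" for M A
    and f :: "real^'n \<Rightarrow> 'b::real_normed_vector"
    unfolding L2_norm_on_def by (intro real_sqrt_pow2 set_integral_nonneg_real) simp
  have dg: "dg_norm \<Omega> T D u = sqrt (vol_norm2 ?g + face_norm2 ?\<phi>)"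
    unfolding dg_norm_def sq vol_norm2_def face_norm2_def by simp
  have "lower_const CARD('n) \<rho> A * (vol_norm2 ?g + face_norm2 ?\<phi>) \<le> vol_norm2 ?w"
    using lifted_gradient_lower[where g = ?g and \<phi> = ?\<phi> and w = ?w, OF g \<phi> w] .
  then show "sqrt (lower_const CARD('n) \<rho> A) * dg_norm \<Omega> T D u \<le>
      L2_norm_on lborel \<Omega> (assemble T ?w)"
    unfolding L2 dg real_sqrt_mult[symmetric] by (rule real_sqrt_le_mono)
  have "vol_norm2 ?w \<le> (2 + 4 * trace_const CARD('n) \<rho> A) * (vol_norm2 ?g + face_norm2 ?\<phi>)"
    using lifted_gradient_upper[where g = ?g and \<phi> = ?\<phi> and w = ?w, OF g \<phi> w] .
  then show "L2_norm_on lborel \<Omega> (assemble T ?w) \<le>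
      sqrt (2 + 4 * trace_const CARD('n) \<rho> A) * dg_norm \<Omega> T D u"
    unfolding L2 dg real_sqrt_mult[symmetric] by (rule real_sqrt_le_mono)
qed

end

section \<open>Constants uniform over all domains and meshes\<close>

theorem theorem1:
  fixes k :: nat and \<rho>\<^sub>1 \<rho>\<^sub>2 :: real
  assumes "CARD('n::finite) \<in> {2, 3}" and "k \<ge> 1" and "\<rho>\<^sub>1 > 0" and "\<rho>\<^sub>2 > 0"
  shows "\<exists>C\<^sub>1 > 0. \<exists>C\<^sub>2 > 0. \<forall>(\<Omega> :: (real^'n) set) H T.
    polytopal_lipschitz_domain \<Omega> \<longrightarrow>
    mesh_sequence \<Omega> H T \<longrightarrow>
    (\<forall>h\<in>H. shape_contact_regular \<rho>\<^sub>1 \<rho>\<^sub>2 \<Omega> (T h)) \<longrightarrow>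
    (\<forall>h\<in>H. face_regular \<Omega> (T h)) \<longrightarrow>
    (\<forall>h\<in>H. \<forall>D. valid_face_data \<Omega> (T h) D \<longrightarrow>
      (\<forall>u\<in>dg_space (T h) k.
         C\<^sub>1 * dg_norm \<Omega> (T h) D u
           \<le> L2_norm_on lborel \<Omega> (assemble (T h) (lifted_gradient \<Omega> (T h) D k u)) \<and>
         L2_norm_on lborel \<Omega> (assemble (T h) (lifted_gradient \<Omega> (T h) D k u))
           \<le> C\<^sub>2 * dg_norm \<Omega> (T h) D u))"
proof -
  \<comment> \<open>The ratio of radius to diameter from
    \<open>shape_contact_regular_inscribed_ball\<close>, capped at 1 as the locale demands.\<close>
  define \<rho> where "\<rho> = min 1 (\<rho>\<^sub>1 * \<rho>\<^sub>2 / 2)"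
  have \<rho>: "0 < \<rho>" "\<rho> \<le> 1" using assms(3,4) by (auto simp: \<rho>_def)
  \<comment> \<open>Fixed before any domain or mesh, which is the source of uniformity. The factor
    \<open>2 / \<rho>\<close> lets a ball of half the inscribed radius reach the whole
    element.\<close>
  obtain A where A: "A > 0" "\<forall>p\<in>(poly_space (k + 1) :: (real^'n \<Rightarrow> real) set). \<forall>x0 r. r > 0 \<longrightarrow>
    (\<forall>y\<in>cball x0 (2 / \<rho> * r). (p y)\<^sup>2 \<le> A / r ^ CARD('n) * (LINT x:cball x0 r|lborel. (p x)\<^sup>2))"
    using poly_sup_bound[of "k + 1" "2 / \<rho>", where ?'n = 'n] by blast
  note pos = constants_pos[OF \<rho>(1) A(1), of "CARD('n)"]
  have bounds: "sqrt (lower_const CARD('n) \<rho> A) * dg_norm \<Omega> M D u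
        \<le> L2_norm_on lborel \<Omega> (assemble M (lifted_gradient \<Omega> M D k u)) \<and>
      L2_norm_on lborel \<Omega> (assemble M (lifted_gradient \<Omega> M D k u))
        \<le> sqrt (2 + 4 * trace_const CARD('n) \<rho> A) * dg_norm \<Omega> M D u"
    if dom: "polytopal_lipschitz_domain \<Omega>" and mesh: "simplicial_mesh \<Omega> M"
      and shape: "shape_contact_regular \<rho>\<^sub>1 \<rho>\<^sub>2 \<Omega> M" and freg: "face_regular \<Omega> M"
      and valid: "valid_face_data \<Omega> M D" and u: "u \<in> dg_space M k"
    for \<Omega> :: "(real^'n) set" and M D u
  proof -
    have "\<forall>K\<in>M. \<exists>xr. snd xr > 0 \<and> cball (fst xr) (snd xr) \<subseteq> K \<and> \<rho> * diameter K \<le> snd xr"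
    proof
      fix K assume K: "K \<in> M"
      obtain x r where r: "r > 0" "cball x r \<subseteq> K" "\<rho>\<^sub>1 * \<rho>\<^sub>2 / 2 * diameter K \<le> r"
        using shape_contact_regular_inscribed_ball[OF mesh shape assms(3,4) K] by blast
      have "bounded K" using mesh K compact_simplex compact_imp_bounded
        unfolding simplicial_mesh_def by blast
      then have "\<rho> * diameter K \<le> \<rho>\<^sub>1 * \<rho>\<^sub>2 / 2 * diameter K"
        by (intro mult_right_mono diameter_ge_0) (auto simp: \<rho>_def)
      then show "\<exists>xr. snd xr > 0 \<and> cball (fst xr) (snd xr) \<subseteq> K \<and> \<rho> * diameter K \<le> snd xr"
        using r by (intro exI[of _ "(x, r)"]) auto
    qed
    then obtain xr where xr: "\<forall>K\<in>M. snd (xr K) > 0 \<and> cball (fst (xr K)) (snd (xr K)) \<subseteq> K \<and>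
        \<rho> * diameter K \<le> snd (xr K)"
      unfolding bchoice_iff by (elim exE)
    obtain reg where reg: "\<forall>F\<in>mesh_faces \<Omega> M. reg F \<in> M \<and> F \<in> element_faces (reg F)"
      using freg unfolding face_regular_def Bex_def bchoice_iff by (elim exE)
    \<comment> \<open>Centres, radii and regular elements are chosen mesh by mesh; the constants
      depend on none of these choices.\<close>
    interpret dg_mesh \<Omega> M D k \<rho> A "\<lambda>K. fst (xr K)" "\<lambda>K. snd (xr K)" reg
    proof
      show "CARD('n) \<ge> 2" using assms(1) by auto
      show "(p y)\<^sup>2 \<le> A / r ^ CARD('n) * (LINT x:cball x0 r|lborel. (p x)\<^sup>2)"
        if "p \<in> poly_space (k + 1)" "r > 0" "y \<in> cball x0 (2 / \<rho> * r)" for p :: "real^'n \<Rightarrow> real"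
          and x0 r y
        using A(2) that by blast
    qed (use dom mesh valid assms(2) \<rho> xr reg A(1) in auto)
    show ?thesis using lifted_gradient_bounds[OF u] by blast
  qed
  show ?thesis
  proof (rule exI[of _ "sqrt (lower_const CARD('n) \<rho> A)"], rule conjI,
      rule_tac [2] exI[of _ "sqrt (2 + 4 * trace_const CARD('n) \<rho> A)"], rule_tac [2] conjI)
    show "sqrt (lower_const CARD('n) \<rho> A) > 0" "sqrt (2 + 4 * trace_const CARD('n) \<rho> A) > 0"
      using pos by auto
  next
    show "\<forall>(\<Omega> :: (real^'n) set) H T.
      polytopal_lipschitz_domain \<Omega> \<longrightarrow>
      mesh_sequence \<Omega> H T \<longrightarrow>
      (\<forall>h\<in>H. shape_contact_regular \<rho>\<^sub>1 \<rho>\<^sub>2 \<Omega> (T h)) \<longrightarrow>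
      (\<forall>h\<in>H. face_regular \<Omega> (T h)) \<longrightarrow>
      (\<forall>h\<in>H. \<forall>D. valid_face_data \<Omega> (T h) D \<longrightarrow>
        (\<forall>u\<in>dg_space (T h) k.
           sqrt (lower_const CARD('n) \<rho> A) * dg_norm \<Omega> (T h) D u
             \<le> L2_norm_on lborel \<Omega> (assemble (T h) (lifted_gradient \<Omega> (T h) D k u)) \<and>
           L2_norm_on lborel \<Omega> (assemble (T h) (lifted_gradient \<Omega> (T h) D k u))
             \<le> sqrt (2 + 4 * trace_const CARD('n) \<rho> A) * dg_norm \<Omega> (T h) D u))"
      by (intro allI impI ballI bounds) (simp_all add: mesh_sequence_def)
  qed
qed

end
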